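(* Let $w$ be a cyclically reduced word in the letters $g_1,g_1^{-1},\ldots,g_k,g_k^{-1}$ such that the element of the group $F_k/[g_1^{d_1},\ldots,g_k^{d_k}]$ represented by $w$ has infinite order, and let $\sigma_n=w(s_1(n),\ldots,s_k(n))$. Then two cases can occur: (i) None of the $(d_1,\ldots,d_k)$-cyclic reductions of $w$ is of the type $g_i^\alpha$ with $i\in[k]$ and $\alpha$ an integer. In this case, for all $l\geq 1$, as $n$ goes to infinity, $$\liminf_{n\to\infty}\ \mathbb{E}(N_l(\sigma_n))\ \geq\ \frac1l .$$ (ii) There is $i\in[k]$ such that $A_i$ is infinite and the $(d_1,\ldots,d_k)$-cyclic reduction of $w$ is $g_i^\alpha$ with $\alpha$ a nonzero integer. In this case, for all $l\geq 1$ such that $l|\alpha|\in A_i$, as $n$ goes to infinity, $$\liminf_{n\to\infty}\ \mathbb{E}(N_l(\sigma_n))\ \geq\ \frac1l .$$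
   Context: Notation: $[n]=\{1,\ldots,n\}$; $\mathfrak{S}_n$ is the group of permutations of $[n]$; for a set $A$ of positive integers, $\mathfrak{S}_n(A)$ is the set of permutations of $[n]$ all of whose cycles have length in $A$; for a permutation $\sigma$ and $l\ge 1$, $N_l(\sigma)$ is the number of cycles of length $l$ of $\sigma$ (fixed points are cycles of length 1). Random permutations. Fix $k\ge1$ and nonempty sets $A_1,\ldots,A_k$ of positive integers, none of them equal to $\{1\}$, such that each $A_i$ is either finite or satisfies $\sum_{j\geq1,\,j\notin A_i}\frac1j<\infty$. Put $d_i=\sup A_i\in\{2,3,\ldots\}\cup\{\infty\}$. Only integers $n$ such that $\mathfrak{S}_n(A_1),\ldots,\mathfrak{S}_n(A_k)$ are all nonempty are considered, and limits as $n\to\infty$ are along such $n$. For such $n$, $s_1(n),\ldots,s_k(n)$ are independent random permutations, $s_i(n)$ being uniformly distributed on $\mathfrak{S}_n(A_i)$. For a word $w$, $w(s_1(n),\ldots,s_k(n))$ is the permutation obtained by replacing each letter $g_i^{\pm1}$ of $w$ by $s_i(n)^{\pm1}$ and composing. Words. $\mathbb{M}_k$ is the set of words (finite sequences, possibly empty) in the letters $g_1,g_1^{-1},\ldots,g_k,g_k^{-1}$. A word is reduced if no letter is followed by its inverse, and cyclically reduced if moreover its first and last letters are not inverses of each other. $F_k$ is the free group on $g_1,\ldots,g_k$, and $F_k/[g_1^{d_1},\ldots,g_k^{d_k}]$ is its quotient by the normal subgroup generated by $\{g_i^{d_i} : i\in[k], d_i<\infty\}$. Cyclic reductions. A word is $(d_1,\ldots,d_k)$-cyclically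 reduced if it is of the form $g_{i_1}^{\alpha_1}\cdots g_{i_m}^{\alpha_m}$ with $m\ge0$, $i_1\neq i_2\neq\cdots\neq i_m\neq i_1$ in $[k]$ (the condition $i_m\ne i_1$ being void for $m=1$) and integers $\alpha_j$ with $0<|\alpha_j|<d_{i_j}$. A partial $(d_1,\ldots,d_k)$-cyclic reduction of a cyclically reduced word $w$ is a word obtained from $w$ in finitely many steps of the following types (in (b), (c), $d_i<\infty$): (a) $uv\to vu$ with $u,v\in\mathbb{M}_k$; (b) $ug_i^{\alpha d_i}u^{-1}v\to v$ with $i\in[k]$, $\alpha$ a nonzero integer, $u$ a nonempty word and $v$ a cyclically reduced word; (c) $g_i^{\alpha d_i}v\to v$ with $i\in[k]$, $\alpha$ a nonzero integer and $v=g_i^\beta v'$ with $\beta$ an integer, $|\beta|<d_i$, and $v'$ a word whose first and last letters do not belong to $\{g_i,g_i^{-1}\}$ ($v'$ may be empty). A $(d_1,\ldots,d_k)$-cyclic reduction of $w$ is a partial $(d_1,\ldots,d_k)$-cyclic reduction of $w$ which is $(d_1,\ldots,d_k)$-cyclically reduced; if there is only one, it is called "the" $(d_1,\ldots,d_k)$-cyclic reduction of $w$. *)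

theory Defs
  imports
    "HOL-Probability.Probability"
    "HOL-Algebra.Multiplicative_Group"
    "HOL-Combinatorics.Orbits"
begin

section \<open>Permutations with restricted cycle lengths\<close>

text \<open>A permutation of \<open>{1..n}\<close> is a function that \<open>permutes {1..n}\<close>; its cycles are its orbits
  on \<open>{1..n}\<close> (points outside \<open>{1..n}\<close>, which are fixed by the function, do not count).\<close>

definition cycles_on :: "nat \<Rightarrow> (nat \<Rightarrow> nat) \<Rightarrow> nat set set" where
  "cycles_on n \<sigma> = orbit \<sigma> ` {1..n}"

definition perms_with_cycles :: "nat \<Rightarrow> nat set \<Rightarrow> (nat \<Rightarrow> nat) set" where
  "perms_with_cycles n A = {\<sigma>. \<sigma> permutes {1..n} \<and> (\<forall>c\<in>cycles_on n \<sigma>. card c \<in> A)}"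

definition num_cycles :: "nat \<Rightarrow> nat \<Rightarrow> (nat \<Rightarrow> nat) \<Rightarrow> nat" where
  "num_cycles n l \<sigma> = card {c \<in> cycles_on n \<sigma>. card c = l}"

definition admissible :: "nat \<Rightarrow> (nat \<Rightarrow> nat set) \<Rightarrow> nat set" where
  "admissible k A = {n. \<forall>i\<in>{1..k}. perms_with_cycles n (A i) \<noteq> {}}"


section \<open>Words\<close>

text \<open>The letter \<open>(i, True)\<close> stands for \<open>g\<^sub>i\<close> and \<open>(i, False)\<close> for its inverse.\<close>

type_synonym letter = "nat \<times> bool"
type_synonym word = "letter list"

definition words :: "nat \<Rightarrow> word set" where
  "words k = lists ({1..k} \<times> UNIV)"

definition inv_letter :: "letter \<Rightarrow> letter" where
  "inv_letter x = (fst x, \<not> snd x)"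

definition inv_word :: "word \<Rightarrow> word" where
  "inv_word w = rev (map inv_letter w)"

definition gpow :: "nat \<Rightarrow> int \<Rightarrow> word" where
  "gpow i a = replicate (nat \<bar>a\<bar>) (i, 0 \<le> a)"

definition reduced :: "word \<Rightarrow> bool" where
  "reduced w \<longleftrightarrow> successively (\<lambda>x y. y \<noteq> inv_letter x) w"

definition cyclically_reduced :: "word \<Rightarrow> bool" where
  "cyclically_reduced w \<longleftrightarrow> reduced w \<and> (w \<noteq> [] \<longrightarrow> last w \<noteq> inv_letter (hd w))"

definition eval_letter :: "(nat \<Rightarrow> nat \<Rightarrow> nat) \<Rightarrow> letter \<Rightarrow> nat \<Rightarrow> nat" where
  "eval_letter s x = (if snd x then s (fst x) else inv_into UNIV (s (fst x)))"

definition eval_word :: "(nat \<Rightarrow> nat \<Rightarrow> nat) \<Rightarrow> word \<Rightarrow> nat \<Rightarrow> nat" where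
  "eval_word s w = foldr (\<lambda>x f. eval_letter s x \<circ> f) w id"


section \<open>The group \<open>F\<^sub>k / [g\<^sub>1^d\<^sub>1, \<dots>, g\<^sub>k^d\<^sub>k]\<close>\<close>

text \<open>The free group on \<open>g\<^sub>1, \<dots>, g\<^sub>k\<close> is the set of words modulo insertion and deletion of
  factors \<open>x x\<inverse>\<close>, with concatenation.\<close>

inductive_set free_equiv :: "nat \<Rightarrow> (word \<times> word) set" for k where
  cancel: "u \<in> words k \<Longrightarrow> v \<in> words k \<Longrightarrow> x \<in> {1..k} \<times> UNIV \<Longrightarrow>
    (u @ [x, inv_letter x] @ v, u @ v) \<in> free_equiv k"
| refl: "u \<in> words k \<Longrightarrow> (u, u) \<in> free_equiv k"
| sym: "(u, v) \<in> free_equiv k \<Longrightarrow> (v, u) \<in> free_equiv k"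
| trans: "(u, v) \<in> free_equiv k \<Longrightarrow> (v, w) \<in> free_equiv k \<Longrightarrow> (u, w) \<in> free_equiv k"

definition word_class :: "nat \<Rightarrow> word \<Rightarrow> word set" where
  "word_class k w = free_equiv k `` {w}"

definition free_group :: "nat \<Rightarrow> word set monoid" where
  "free_group k =
    \<lparr>carrier = words k // free_equiv k,
     mult = (\<lambda>X Y. \<Union>u\<in>X. \<Union>v\<in>Y. word_class k (u @ v)),
     one = word_class k []\<rparr>"

definition normal_closure :: "('a, 'b) monoid_scheme \<Rightarrow> 'a set \<Rightarrow> 'a set" where
  "normal_closure G S = \<Inter> {N. N \<lhd> G \<and> S \<subseteq> N}"

definition relators :: "nat \<Rightarrow> (nat \<Rightarrow> enat) \<Rightarrow> word set set" where
  "relators k d = {word_class k [(i, True)] [^]\<^bsub>free_group k\<^esub> m | i m. i \<in> {1..k} \<and> d i = enat m}"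

definition quot_group :: "nat \<Rightarrow> (nat \<Rightarrow> enat) \<Rightarrow> word set set monoid" where
  "quot_group k d = free_group k Mod normal_closure (free_group k) (relators k d)"

definition quot_elem :: "nat \<Rightarrow> (nat \<Rightarrow> enat) \<Rightarrow> word \<Rightarrow> word set set" where
  "quot_elem k d w = normal_closure (free_group k) (relators k d) #>\<^bsub>free_group k\<^esub> word_class k w"

lemma free_equiv_words:
  assumes "(u, v) \<in> free_equiv k"
  shows "u \<in> words k \<and> v \<in> words k"
  using assms by induction (auto simp: words_def inv_letter_def)

lemma equiv_free_equiv: "equiv (words k) (free_equiv k)"
proof (rule equivI)
  show "free_equiv k \<subseteq> words k \<times> words k" using free_equiv_words by auto
  show "refl_on (words k) (free_equiv k)" by (auto simp: refl_on_def intro: free_equiv.refl)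
  show "Relation.sym (free_equiv k)" by (rule symI) (rule free_equiv.sym)
  show "Relation.trans (free_equiv k)" by (rule transI) (rule free_equiv.trans)
qed

lemma free_equiv_append_left:
  assumes "(u, v) \<in> free_equiv k" "w \<in> words k"
  shows "(w @ u, w @ v) \<in> free_equiv k"
  using assms
proof induction
  case (cancel u v x)
  have "w @ u \<in> words k" using cancel by (auto simp: words_def)
  from free_equiv.cancel[OF this cancel(2,3)] show ?case by simp
next
  case (refl u)
  have "w @ u \<in> words k" using refl by (auto simp: words_def)
  then show ?case by (rule free_equiv.refl)
next
  case (sym u v)
  then show ?case by (blast intro: free_equiv.sym)
next
  case (trans u v w')
  then show ?case by (blast intro: free_equiv.trans[of _ "w @ v"])
qed

lemma free_equiv_append_right:
  assumes "(u, v) \<in> free_equiv k" "w \<in> words k"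
  shows "(u @ w, v @ w) \<in> free_equiv k"
  using assms
proof induction
  case (cancel u v x)
  have "v @ w \<in> words k" using cancel by (auto simp: words_def)
  from free_equiv.cancel[OF cancel(1) this cancel(3)] show ?case by simp
next
  case (refl u)
  have "u @ w \<in> words k" using refl by (auto simp: words_def)
  then show ?case by (rule free_equiv.refl)
next
  case (sym u v)
  then show ?case by (blast intro: free_equiv.sym)
next
  case (trans u v w')
  then show ?case by (blast intro: free_equiv.trans[of _ "v @ w"])
qed

lemma free_equiv_append:
  assumes "(u, u') \<in> free_equiv k" "(v, v') \<in> free_equiv k"
  shows "(u @ v, u' @ v') \<in> free_equiv k"
proof (rule free_equiv.trans)
  show "(u @ v, u' @ v) \<in> free_equiv k"
    using assms free_equiv_append_right free_equiv_words by blast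
  show "(u' @ v, u' @ v') \<in> free_equiv k"
    using assms free_equiv_append_left free_equiv_words by blast
qed

lemma word_class_eq_iff:
  "u \<in> words k \<Longrightarrow> v \<in> words k \<Longrightarrow> word_class k u = word_class k v \<longleftrightarrow> (u, v) \<in> free_equiv k"
  unfolding word_class_def by (rule eq_equiv_class_iff[OF equiv_free_equiv])

lemma carrier_free_group: "carrier (free_group k) = word_class k ` words k"
  by (auto simp: free_group_def quotient_def word_class_def)

lemma mult_free_group:
  assumes "u \<in> words k" "v \<in> words k"
  shows "word_class k u \<otimes>\<^bsub>free_group k\<^esub> word_class k v = word_class k (u @ v)"
proof -
  have "word_class k (u' @ v') = word_class k (u @ v)"
    if "u' \<in> word_class k u" "v' \<in> word_class k v" for u' v'
  proof -
    have "(u @ v, u' @ v') \<in> free_equiv k"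
      using that by (auto simp: word_class_def intro: free_equiv_append)
    then show ?thesis
      unfolding word_class_def using equiv_class_eq[OF equiv_free_equiv] by metis
  qed
  moreover have "u \<in> word_class k u" "v \<in> word_class k v"
    using assms by (auto simp: word_class_def intro: free_equiv.refl)
  ultimately have "(\<Union>u'\<in>word_class k u. \<Union>v'\<in>word_class k v. word_class k (u' @ v')) =
      word_class k (u @ v)"
    by blast
  then show ?thesis by (simp add: free_group_def)
qed

lemma inv_word_words: "u \<in> words k \<Longrightarrow> inv_word u \<in> words k"
  by (induction u) (auto simp: words_def inv_word_def inv_letter_def)

lemma inv_word_cancel:
  assumes "u \<in> words k"
  shows "(inv_word u @ u, []) \<in> free_equiv k"
  using assms
proof (induction u)
  case Nil
  then show ?case by (auto simp: inv_word_def words_def intro: free_equiv.refl)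
next
  case (Cons x u)
  have u: "u \<in> words k" and x: "inv_letter x \<in> {1..k} \<times> UNIV"
    using Cons.prems by (auto simp: words_def inv_letter_def)
  have "inv_letter (inv_letter x) = x" by (simp add: inv_letter_def)
  then have "(inv_word (x # u) @ x # u, inv_word u @ u) \<in> free_equiv k"
    using free_equiv.cancel[OF inv_word_words[OF u] u x] by (simp add: inv_word_def)
  then show ?case using Cons.IH[OF u] by (rule free_equiv.trans)
qed

lemma group_free_group: "group (free_group k)"
proof (rule groupI)
  have nil: "[] \<in> words k" and app: "\<And>u v. u \<in> words k \<Longrightarrow> v \<in> words k \<Longrightarrow> u @ v \<in> words k"
    by (auto simp: words_def)
  have one: "\<one>\<^bsub>free_group k\<^esub> = word_class k []" by (simp add: free_group_def)
  show "\<one>\<^bsub>free_group k\<^esub> \<in> carrier (free_group k)"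
    using nil by (simp add: one carrier_free_group)
  fix X assume "X \<in> carrier (free_group k)"
  then obtain u where u: "u \<in> words k" "X = word_class k u" by (auto simp: carrier_free_group)
  show "\<one>\<^bsub>free_group k\<^esub> \<otimes>\<^bsub>free_group k\<^esub> X = X"
    using u nil by (simp add: one mult_free_group)
  show "\<exists>Y\<in>carrier (free_group k). Y \<otimes>\<^bsub>free_group k\<^esub> X = \<one>\<^bsub>free_group k\<^esub>"
    using u inv_word_words[OF u(1)] inv_word_cancel[OF u(1)] nil app
    by (auto simp: one carrier_free_group mult_free_group word_class_eq_iff)
  fix Y assume "Y \<in> carrier (free_group k)"
  then obtain v where v: "v \<in> words k" "Y = word_class k v" by (auto simp: carrier_free_group)
  show "X \<otimes>\<^bsub>free_group k\<^esub> Y \<in> carrier (free_group k)"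
    using u v app by (auto simp: carrier_free_group mult_free_group)
  fix Z assume "Z \<in> carrier (free_group k)"
  then obtain w where w: "w \<in> words k" "Z = word_class k w" by (auto simp: carrier_free_group)
  show "X \<otimes>\<^bsub>free_group k\<^esub> Y \<otimes>\<^bsub>free_group k\<^esub> Z = X \<otimes>\<^bsub>free_group k\<^esub> (Y \<otimes>\<^bsub>free_group k\<^esub> Z)"
    using u v w app by (simp add: mult_free_group)
qed

lemma (in group) normal_closure_normal:
  assumes "S \<subseteq> carrier G"
  shows "normal_closure G S \<lhd> G"
proof -
  have "carrier G \<lhd> G" by (simp add: normal_inv_iff subgroup_self)
  then have ne: "{N. N \<lhd> G \<and> S \<subseteq> N} \<noteq> {}" using assms by auto
  have "subgroup (normal_closure G S) G"
    unfolding normal_closure_def using ne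
    by (intro subgroups_Inter) (auto intro: normal_imp_subgroup)
  then show ?thesis
    unfolding normal_inv_iff by (auto simp: normal_closure_def normal_inv_iff)
qed

lemma normal_relators: "normal_closure (free_group k) (relators k d) \<lhd> free_group k"
proof (rule group.normal_closure_normal[OF group_free_group])
  have "word_class k [(i, True)] \<in> carrier (free_group k)" if "i \<in> {1..k}" for i
    using that by (auto simp: carrier_free_group words_def)
  then show "relators k d \<subseteq> carrier (free_group k)"
    by (auto simp: relators_def intro: monoid.nat_pow_closed[OF group.is_monoid[OF group_free_group]])
qed

lemma group_quot_group: "group (quot_group k d)"
  unfolding quot_group_def by (rule normal.factorgroup_is_group[OF normal_relators])

lemma quot_elem_carrier: "w \<in> words k \<Longrightarrow> quot_elem k d w \<in> carrier (quot_group k d)"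
  by (auto simp: quot_elem_def quot_group_def FactGroup_def RCOSETS_def carrier_free_group)

text \<open>As \<open>group.ord\<close> is \<open>0\<close> exactly for elements of infinite order, the next predicate
  says that \<open>w\<close> represents an element of infinite order.\<close>

definition infinite_order :: "nat \<Rightarrow> (nat \<Rightarrow> enat) \<Rightarrow> word \<Rightarrow> bool" where
  "infinite_order k d w \<longleftrightarrow> group.ord (quot_group k d) (quot_elem k d w) = 0"

lemma infinite_order_iff:
  assumes "w \<in> words k"
  shows "infinite_order k d w \<longleftrightarrow>
    (\<forall>m::nat. m \<noteq> 0 \<longrightarrow> quot_elem k d w [^]\<^bsub>quot_group k d\<^esub> m \<noteq> \<one>\<^bsub>quot_group k d\<^esub>)"
  unfolding infinite_order_def
  by (rule group.ord_eq_0[OF group_quot_group quot_elem_carrier[OF assms]])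


section \<open>Cyclic reductions\<close>

definition d_cyclically_reduced :: "nat \<Rightarrow> (nat \<Rightarrow> enat) \<Rightarrow> word \<Rightarrow> bool" where
  "d_cyclically_reduced k d w \<longleftrightarrow>
    (\<exists>ss :: (nat \<times> int) list.
       w = concat (map (\<lambda>(i, a). gpow i a) ss) \<and>
       (\<forall>(i, a) \<in> set ss. i \<in> {1..k} \<and> 0 < \<bar>a\<bar> \<and> enat (nat \<bar>a\<bar>) < d i) \<and>
       successively (\<lambda>p q. fst p \<noteq> fst q) ss \<and>
       (2 \<le> length ss \<longrightarrow> fst (last ss) \<noteq> fst (hd ss)))"

inductive cyc_step :: "nat \<Rightarrow> (nat \<Rightarrow> enat) \<Rightarrow> word \<Rightarrow> word \<Rightarrow> bool"
  for k :: nat and d :: "nat \<Rightarrow> enat" where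
  rotate: "u \<in> words k \<Longrightarrow> v \<in> words k \<Longrightarrow> cyc_step k d (u @ v) (v @ u)"
| conj: "i \<in> {1..k} \<Longrightarrow> d i = enat m \<Longrightarrow> a \<noteq> 0 \<Longrightarrow> u \<in> words k \<Longrightarrow> u \<noteq> [] \<Longrightarrow>
    v \<in> words k \<Longrightarrow> cyclically_reduced v \<Longrightarrow>
    cyc_step k d (u @ gpow i (a * int m) @ inv_word u @ v) v"
| power: "i \<in> {1..k} \<Longrightarrow> d i = enat m \<Longrightarrow> a \<noteq> 0 \<Longrightarrow> \<bar>b\<bar> < int m \<Longrightarrow> v' \<in> words k \<Longrightarrow>
    (v' \<noteq> [] \<longrightarrow> fst (hd v') \<noteq> i \<and> fst (last v') \<noteq> i) \<Longrightarrow> v = gpow i b @ v' \<Longrightarrow>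
    cyc_step k d (gpow i (a * int m) @ v) v"

definition partial_cyc_reduction :: "nat \<Rightarrow> (nat \<Rightarrow> enat) \<Rightarrow> word \<Rightarrow> word \<Rightarrow> bool" where
  "partial_cyc_reduction k d w v \<longleftrightarrow> (cyc_step k d)\<^sup>*\<^sup>* w v"

definition cyc_reductions :: "nat \<Rightarrow> (nat \<Rightarrow> enat) \<Rightarrow> word \<Rightarrow> word set" where
  "cyc_reductions k d w = {v. partial_cyc_reduction k d w v \<and> d_cyclically_reduced k d v}"

end

theory Submission
  imports Defs "HOL-Combinatorics.Cycles"
begin

text \<open>An \<open>l\<close>-cycle of \<open>w(s\<^sub>1, \<dots>, s\<^sub>k)\<close> can be seen in the graph on \<open>{1..n}\<close> that has an edge of
colour \<open>i\<close> from \<open>x\<close> to \<open>s\<^sub>i x\<close> for all \<open>i\<close> and \<open>x\<close>. The proof constructs one finite coloured graph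
with a marked vertex such that every embedding of it sends the marked vertex to a point of an
\<open>l\<close>-cycle of \<open>w(s\<^sub>1, \<dots>, s\<^sub>k)\<close>, and such that the expected number of embeddings is at least
\<open>1 - o(1)\<close>. The image of the marked vertex determines the embedding, so an \<open>l\<close>-cycle accounts for at
most \<open>l\<close> embeddings and the expected number of \<open>l\<close>-cycles is at least \<open>(1 - o(1)) / l\<close>
(\<open>expected_num_cycles_ge\<close>).

The number of embeddings. In each colour \<open>i\<close> the vertex set \<open>V\<close> is partitioned into
components: isolated vertices, closed cycles of length \<open>d\<^sub>i\<close> if \<open>d\<^sub>i\<close> is finite, paths if
it is infinite. The law of \<open>s\<^sub>i\<close> is invariant under conjugation, so all injections of \<open>V\<close> into
\<open>{1..n}\<close> respect colour \<open>i\<close> with the same probability. On average all but \<open>o(n)\<close> points lie in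
cycles of length at least \<open>R\<close>, for every \<open>R \<le> d\<^sub>i\<close>; hence a component can be placed by choosing the
image of its first vertex almost freely, and with \<open>c\<^sub>i\<close> components this probability is at least
\<open>(1 - o(1)) n powr (c\<^sub>i - |V|)\<close> (\<open>realizing_density\<close>). Summing over the \<open>n powr |V|\<close>
injections gives \<open>n\<close> to the power \<open>|V| + (\<Sum>i. c\<^sub>i - |V|)\<close>. This exponent is the Euler
characteristic of the graph in which each component is one cell; it is \<open>1\<close> for a tree of components
and \<open>0\<close> for a connected graph with a single loop, which is the case that is used
(\<open>expected_models_ge\<close>).

Short cycles. Let \<open>a\<^sub>n\<close> be the proportion of permutations of \<open>n\<close> points with cycle lengths in \<open>A\<close>. The
expected number of points in \<open>j\<close>-cycles is \<open>a\<^bsub>n - j\<^esub> / a\<^sub>n\<close>. The Cauchy-Schwarz inequality shows that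
this ratio almost does not decrease when \<open>n\<close> is replaced by \<open>n - j\<close>. If it were of order \<open>n\<close> for some
\<open>j < D\<close> with \<open>j, D \<in> A\<close>, then \<open>a\<^bsub>n - jD\<^esub> / a\<^sub>n\<close> would be of order \<open>n ^ D\<close>, but removing
\<open>j\<close> cycles of length \<open>D\<close> bounds it by \<open>n ^ j\<close> (\<open>cyc_density_ratio_sublinear\<close>).

The graph. For a \<open>(d\<^sub>1, \<dots>, d\<^sub>k)\<close>-cyclically reduced word \<open>v\<close> with at least two syllables, walk
along \<open>v ^ l\<close>, let every syllable use a component of its own, and let the last syllable return to
the start: one loop (\<open>realizable_syllables\<close>). A step of a cyclic reduction can be undone: a rotation
moves the marked vertex, and the insertion of \<open>u g ^ (\<alpha>d) u\<inverse>\<close> glues closed cycles onto the graph,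
which does not change the Euler characteristic (\<open>realizable_partial_cyc_reduction\<close>). Every
cyclically reduced word reaches a \<open>(d\<^sub>1, \<dots>, d\<^sub>k)\<close>-cyclically reduced one
(\<open>cyc_reduction_exists\<close>). If the reduction is a power of \<open>g\<^sub>i\<close> with exponent \<open>\<alpha>\<close>, the loop is a cycle of
length \<open>l |\<alpha>|\<close> of \<open>s\<^sub>i\<close> itself; it costs no more than a path of that many edges because
\<open>a\<^sub>n\<close> converges to a positive limit if the reciprocals of the missing lengths have a finite sum
(\<open>cyc_density_tendsto\<close>).

The two cases. A reduction step preserves the conjugacy class in the quotient group, hence infinite
order; so if a power of \<open>g\<^sub>i\<close> with exponent \<open>\<alpha>\<close> is a reduction, then \<open>\<alpha> \<noteq> 0\<close> and \<open>d\<^sub>i\<close> is infinite. The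
exponent sum of \<open>g\<^sub>i\<close> is then an invariant and separates the reductions with one syllable. There is no
reduction with several syllables: otherwise the lower bound above, applied to permutations with
\<open>s\<^sub>j ^ d\<^sub>j = 1\<close> whose \<open>s\<^sub>i\<close> has only cycles longer than \<open>|\<alpha>|\<close>, would give a fixed point of
\<open>w(s\<^sub>1, \<dots>, s\<^sub>k)\<close>, which is conjugate to the \<open>\<alpha>\<close>-th power of \<open>s\<^sub>i\<close>
(\<open>realizable_not_conj_gpow\<close>).\<close>

section \<open>Permutations with prescribed cycle lengths\<close>

text \<open>The notation \<open>inv\<close> denotes the inverse in a group here, so the inverse function gets its own name.\<close>

abbreviation finv :: "('a \<Rightarrow> 'b) \<Rightarrow> 'b \<Rightarrow> 'a" where
  "finv f \<equiv> inv_into UNIV f"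

text \<open>In a graph with edges from \<open>x\<close> to \<open>s x\<close>, a list is traversed as a path (\<open>walk\<close>) or as a cycle.\<close>

definition walk :: "('a \<Rightarrow> 'a) \<Rightarrow> 'a list \<Rightarrow> bool" where
  "walk s ys \<longleftrightarrow> (\<forall>t. Suc t < length ys \<longrightarrow> s (ys ! t) = ys ! Suc t)"

definition closed_walk :: "('a \<Rightarrow> 'a) \<Rightarrow> 'a list \<Rightarrow> bool" where
  "closed_walk s ys \<longleftrightarrow> (\<forall>t<length ys. s (ys ! t) = ys ! (Suc t mod length ys))"

text \<open>Arbitrary base sets are needed because deleting a cycle leaves a permutation of the other
points.\<close>

definition cyc_perms :: "'a set \<Rightarrow> nat set \<Rightarrow> ('a \<Rightarrow> 'a) set" where
  "cyc_perms X A = {\<sigma>. \<sigma> permutes X \<and> (\<forall>x\<in>X. card (orbit \<sigma> x) \<in> A)}"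

lemma perms_with_cycles_eq_cyc_perms: "perms_with_cycles n A = cyc_perms {1..n} A"
  by (auto simp: perms_with_cycles_def cyc_perms_def cycles_on_def)

lemma finite_cyc_perms: "finite X \<Longrightarrow> finite (cyc_perms X A)"
  unfolding cyc_perms_def by (rule finite_subset[OF _ finite_permutations[of X]]) auto

lemma cyc_perms_permutes: "\<sigma> \<in> cyc_perms X A \<Longrightarrow> \<sigma> permutes X"
  by (simp add: cyc_perms_def)

lemma closed_walk_imp_walk: "closed_walk s ys \<Longrightarrow> walk s ys"
  by (auto simp: walk_def closed_walk_def)

lemma walk_funpow: "walk s ys \<Longrightarrow> t + m < length ys \<Longrightarrow> (s ^^ m) (ys ! t) = ys ! (t + m)"
  by (induction m) (auto simp: walk_def)

lemma closed_walk_funpow: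
  "closed_walk s ys \<Longrightarrow> t < length ys \<Longrightarrow> (s ^^ m) (ys ! t) = ys ! ((t + m) mod length ys)"
proof (induction m)
  case (Suc m)
  have "(t + m) mod length ys < length ys" using Suc.prems by (intro mod_less_divisor) auto
  then show ?case using Suc by (simp add: closed_walk_def mod_Suc_eq)
qed simp

lemma closed_walk_orbit:
  assumes "closed_walk s ys" "y \<in> set ys"
  shows "orbit s y = set ys"
proof -
  obtain t where t: "t < length ys" "y = ys ! t" using assms(2) by (auto simp: in_set_conv_nth)
  have *: "(s ^^ m) y = ys ! ((t + m) mod length ys)" for m
    using closed_walk_funpow[OF assms(1) t(1)] t by simp
  have "(s ^^ length ys) y = y" using *[of "length ys"] t by simp
  then have "orbit s y = {(s ^^ m) y |m. m < length ys}"
    using t by (intro orbit_altdef_bounded) auto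
  also have "\<dots> = (\<lambda>m. ys ! ((t + m) mod length ys)) ` {..<length ys}" using * by auto
  also have "\<dots> = set ys"
  proof -
    have "(\<lambda>m. (t + m) mod length ys) ` {..<length ys} = {..<length ys}"
    proof (rule card_subset_eq)
      show "(\<lambda>m. (t + m) mod length ys) ` {..<length ys} \<subseteq> {..<length ys}"
        using t by (auto intro!: mod_less_divisor)
      have "inj_on (\<lambda>m. (t + m) mod length ys) {..<length ys}"
      proof (rule inj_onI)
        fix a b assume a: "a \<in> {..<length ys}" "b \<in> {..<length ys}"
          and eq: "(t + a) mod length ys = (t + b) mod length ys"
        have "int a mod int (length ys) = (int t + int a - int t) mod int (length ys)" by simp
        also have "\<dots> = (int t + int b - int t) mod int (length ys)"
          using eq by (intro mod_diff_cong) (simp_all flip: of_nat_add of_nat_mod)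
        finally show "a = b" using a by (simp flip: of_nat_mod)
      qed
      then show "card ((\<lambda>m. (t + m) mod length ys) ` {..<length ys}) = card {..<length ys}"
        by (rule card_image)
    qed simp
    then have "(!) ys ` (\<lambda>m. (t + m) mod length ys) ` {..<length ys} = (!) ys ` {..<length ys}"
      by simp
    then have "(\<lambda>m. ys ! ((t + m) mod length ys)) ` {..<length ys} = (!) ys ` {..<length ys}"
      by (simp add: image_image)
    also have "\<dots> = set ys" by (auto simp: set_conv_nth)
    finally show ?thesis .
  qed
  finally show ?thesis .
qed

lemma ex_permutes_extending:
  assumes "finite X" "inj_on f U" "inj_on g U" "f ` U \<subseteq> X" "g ` U \<subseteq> X"
  shows "\<exists>h. h permutes X \<and> (\<forall>u\<in>U. h (f u) = g u)"
proof -
  have b1: "bij_betw (g \<circ> the_inv_into U f) (f ` U) (g ` U)"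
    using assms by (intro bij_betw_trans[OF bij_betw_the_inv_into inj_on_imp_bij_betw])
      (auto simp: bij_betw_def)
  have "finite U" using assms finite_imageD finite_subset by metis
  have "card (X - f ` U) = card (X - g ` U)"
    using assms \<open>finite U\<close> by (simp add: card_Diff_subset card_image)
  then obtain b where b: "bij_betw b (X - f ` U) (X - g ` U)"
    using assms(1) by (metis finite_Diff finite_same_card_bij)
  define h where "h x = (if x \<in> f ` U then (g \<circ> the_inv_into U f) x else if x \<in> X then b x else x)" for x
  have "bij_betw h (f ` U \<union> (X - f ` U)) (g ` U \<union> (X - g ` U))"
  proof (rule bij_betw_combine)
    show "bij_betw h (f ` U) (g ` U)"
      using b1 by (rule bij_betw_cong[THEN iffD1, rotated]) (simp add: h_def)
    show "bij_betw h (X - f ` U) (X - g ` U)"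
      using b by (rule bij_betw_cong[THEN iffD1, rotated]) (simp add: h_def)
  qed auto
  then have "bij_betw h X X" using assms by (simp add: Un_absorb1)
  moreover have "h x = x" if "x \<notin> X" for x using that assms by (auto simp: h_def)
  ultimately have "h permutes X" by (rule bij_imp_permutes)
  moreover have "h (f u) = g u" if "u \<in> U" for u
    using that assms by (simp add: h_def the_inv_into_f_f)
  ultimately show ?thesis by blast
qed

lemma orbit_conj:
  assumes "bij h" "x \<in> orbit s x"
  shows "orbit (h \<circ> s \<circ> finv h) (h x) = h ` orbit s x"
  using orbit_inverse[OF assms(2), of "h \<circ> s \<circ> finv h" h] assms(1)
  by (simp add: bij_is_inj)

lemma self_in_orbit: "\<sigma> permutes X \<Longrightarrow> finite X \<Longrightarrow> x \<in> orbit \<sigma> x"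
  by (auto intro: permutation_self_in_orbit permutes_imp_permutation)

lemma conj_mem_cyc_perms:
  assumes "\<sigma> \<in> cyc_perms X A" "bij h" "finite X"
  shows "h \<circ> \<sigma> \<circ> finv h \<in> cyc_perms (h ` X) A"
proof -
  have p: "\<sigma> permutes X" using assms by (simp add: cyc_perms_def)
  have "bij_betw (finv h) (h ` X) X"
    using assms(2) by (auto simp: bij_betw_def bij_is_inj inj_on_def image_image inv_into_f_f)
  moreover have "bij_betw h X (h ` X)"
    using assms(2) by (simp add: bij_betw_def inj_on_subset[OF bij_is_inj])
  ultimately have "bij_betw (h \<circ> (\<sigma> \<circ> finv h)) (h ` X) (h ` X)"
    using permutes_imp_bij[OF p] by (intro bij_betw_trans[where B = X]) (auto intro: bij_betw_trans)
  moreover have "(h \<circ> (\<sigma> \<circ> finv h)) y = y" if "y \<notin> h ` X" for y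
  proof -
    have y: "h (finv h y) = y" using assms(2) by (simp add: bij_is_surj surj_f_inv_f)
    then have "finv h y \<notin> X" using that by (metis imageI)
    then show ?thesis using permutes_not_in[OF p] y by simp
  qed
  ultimately have "h \<circ> \<sigma> \<circ> finv h permutes h ` X"
    unfolding comp_assoc by (rule bij_imp_permutes)
  moreover have "card (orbit (h \<circ> \<sigma> \<circ> finv h) (h x)) = card (orbit \<sigma> x)" for x
    using orbit_conj[OF assms(2) self_in_orbit[OF p assms(3)]] assms(2)
    by (metis bij_is_inj card_image inj_on_subset subset_UNIV)
  ultimately show ?thesis using assms(1) by (auto simp: cyc_perms_def)
qed

lemma inj_on_conj:
  fixes h :: "'a \<Rightarrow> 'a"
  assumes "inj h"
  shows "inj_on (\<lambda>\<sigma>. h \<circ> \<sigma> \<circ> finv h) S"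
proof (rule inj_onI)
  fix s s' :: "'a \<Rightarrow> 'a" assume eq: "h \<circ> s \<circ> finv h = h \<circ> s' \<circ> finv h"
  have "h (s x) = h (s' x)" for x
    using fun_cong[OF eq, of "h x"] inv_f_f[OF assms] by simp
  then have "s x = s' x" for x using assms by (simp add: inj_eq)
  then show "s = s'" by (rule ext)
qed

text \<open>Conjugation by a permutation \<open>h\<close> of \<open>X \<union> Y\<close> with \<open>h ` X = Y\<close> is injective.\<close>

lemma card_cyc_perms_cong:
  fixes X Y :: "'a set"
  assumes "finite X" "finite Y" "card X = card Y"
  shows "card (cyc_perms X A) = card (cyc_perms Y A)"
proof -
  have le: "card (cyc_perms X A) \<le> card (cyc_perms Y A)"
    if "finite X" "finite Y" "card X = card Y" for X Y :: "'a set"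
  proof -
    from finite_same_card_bij[OF that] obtain b where b: "bij_betw b X Y" ..
    have "inj_on b X" using b by (rule bij_betw_imp_inj_on)
    moreover have "b ` X \<subseteq> X \<union> Y" using bij_betw_imp_surj_on[OF b] by blast
    ultimately have "\<exists>h. h permutes (X \<union> Y) \<and> (\<forall>x\<in>X. h x = b x)"
      using ex_permutes_extending[of "X \<union> Y" "\<lambda>x. x" X b] that(1,2)
      by (simp only: finite_Un inj_on_id2 image_ident Un_upper1 simp_thms)
    then obtain h where h: "h permutes (X \<union> Y)" "\<forall>x\<in>X. h x = b x" by blast
    have "h ` X = Y" using h(2) b by (auto simp: bij_betw_def)
    have bh: "bij h" using h(1) by (rule permutes_bij)
    show ?thesis
    proof (rule card_inj_on_le[where f = "\<lambda>\<sigma>. h \<circ> \<sigma> \<circ> finv h"])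
      show "(\<lambda>\<sigma>. h \<circ> \<sigma> \<circ> finv h) ` cyc_perms X A \<subseteq> cyc_perms Y A"
        using conj_mem_cyc_perms[OF _ bh that(1)] \<open>h ` X = Y\<close> by auto
      show "inj_on (\<lambda>\<sigma>. h \<circ> \<sigma> \<circ> finv h) (cyc_perms X A)"
        using permutes_inj[OF h(1)] by (rule inj_on_conj)
    qed (simp add: that finite_cyc_perms)
  qed
  show ?thesis using le[OF assms] le[of Y X] assms by simp
qed

lemma closed_walk_cycle_of_list:
  assumes "distinct ys"
  shows "closed_walk (cycle_of_list ys) ys"
proof -
  have "map (cycle_of_list ys ^^ 1) ys = rotate 1 ys" using cyclic_rotation[OF assms] by metis
  then have "map (cycle_of_list ys) ys = rotate1 ys" by simp
  then show ?thesis
    unfolding closed_walk_def by (metis length_map nth_map nth_rotate1)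
qed

lemma closed_walk_cong: "(\<And>y. y \<in> set ys \<Longrightarrow> s y = s' y) \<Longrightarrow> closed_walk s ys = closed_walk s' ys"
  by (auto simp: closed_walk_def)

lemma closed_walk_unique:
  "closed_walk s ys \<Longrightarrow> closed_walk s' ys \<Longrightarrow> y \<in> set ys \<Longrightarrow> s y = s' y"
  by (auto simp: closed_walk_def in_set_conv_nth)

lemma orbit_perm_restrict:
  assumes "\<sigma> permutes X" "finite X" "closed_walk \<sigma> ys" "x \<notin> set ys"
  shows "orbit (perm_restrict \<sigma> (X - set ys)) x = orbit \<sigma> x"
proof (rule orbit_cong[OF self_in_orbit[OF assms(1,2)]])
  fix y assume y: "y \<in> orbit \<sigma> x"
  have "y \<notin> set ys"
  proof
    assume "y \<in> set ys"
    then have "orbit \<sigma> y = set ys" using closed_walk_orbit assms(3) by metis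
    moreover have "x \<in> orbit \<sigma> y"
      using y self_in_orbit[OF assms(1,2)] orbit_swap by metis
    ultimately show False using assms(4) by simp
  qed
  then show "perm_restrict \<sigma> (X - set ys) y = \<sigma> y"
    using permutes_not_in[OF assms(1)] by (auto simp: perm_restrict_def)
qed

text \<open>Deleting a prescribed cycle is inverse to composing with that cycle, and does not touch the other
cycles. All recursions for the number of permutations come from this bijection.\<close>

lemma remove_cycle_bij:
  assumes "finite X" "distinct ys" "set ys \<subseteq> X" "length ys \<in> A"
  shows "bij_betw (\<lambda>\<sigma>. perm_restrict \<sigma> (X - set ys))
    {\<sigma> \<in> cyc_perms X A. closed_walk \<sigma> ys} (cyc_perms (X - set ys) A)"
proof (rule bij_betwI[where g = "\<lambda>\<tau>. \<tau> \<circ> cycle_of_list ys"])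
  let ?r = "\<lambda>\<sigma>. perm_restrict \<sigma> (X - set ys)" and ?c = "cycle_of_list ys"
  have c: "?c permutes set ys" by (rule cycle_permutes)
  have cc: "closed_walk ?c ys" using assms(2) by (rule closed_walk_cycle_of_list)
  show "?r \<in> {\<sigma> \<in> cyc_perms X A. closed_walk \<sigma> ys} \<rightarrow> cyc_perms (X - set ys) A"
  proof
    fix \<sigma> assume "\<sigma> \<in> {\<sigma> \<in> cyc_perms X A. closed_walk \<sigma> ys}"
    then have s: "\<sigma> permutes X" "\<forall>x\<in>X. card (orbit \<sigma> x) \<in> A" "closed_walk \<sigma> ys"
      by (auto simp: cyc_perms_def)
    have "?r \<sigma> permutes (X - set ys)"
    proof (cases "ys = []")
      case False
      then have "cyclic_on \<sigma> (set ys)"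
        unfolding cyclic_on_def using closed_walk_orbit[OF s(3)] by (metis list.set_sel(1))
      then show ?thesis using s(1) by (intro perm_restrict_diff_cyclic)
    qed (use s in simp)
    then show "?r \<sigma> \<in> cyc_perms (X - set ys) A"
      using s orbit_perm_restrict[OF s(1) assms(1) s(3)] by (auto simp: cyc_perms_def)
  qed
  have comp: "(\<tau> \<circ> ?c) x = (if x \<in> set ys then ?c x else \<tau> x)" if "\<tau> permutes (X - set ys)" for \<tau> x
    using permutes_not_in[OF c, of x] permutes_not_in[OF that, of "?c x"] permutes_in_image[OF c, of x]
    by auto
  show "(\<lambda>\<tau>. \<tau> \<circ> ?c) \<in> cyc_perms (X - set ys) A \<rightarrow> {\<sigma> \<in> cyc_perms X A. closed_walk \<sigma> ys}"
  proof
    fix \<tau> assume "\<tau> \<in> cyc_perms (X - set ys) A"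
    then have t: "\<tau> permutes (X - set ys)" "\<forall>x\<in>X - set ys. card (orbit \<tau> x) \<in> A"
      by (auto simp: cyc_perms_def)
    have p: "(\<tau> \<circ> ?c) permutes X"
      using permutes_subset[OF t(1), of X] permutes_subset[OF c assms(3)]
      by (auto intro: permutes_compose)
    have cl: "closed_walk (\<tau> \<circ> ?c) ys"
      using cc comp[OF t(1)] closed_walk_cong[of ys "\<tau> \<circ> ?c" ?c] by simp
    have r: "?r (\<tau> \<circ> ?c) = \<tau>"
      using comp[OF t(1)] permutes_not_in[OF t(1)] by (auto simp: fun_eq_iff perm_restrict_def)
    have "card (orbit (\<tau> \<circ> ?c) x) \<in> A" if "x \<in> X" for x
    proof (cases "x \<in> set ys")
      case True
      then show ?thesis using closed_walk_orbit[OF cl] assms(2,4) distinct_card[of ys] by simp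
    next
      case False
      have "orbit (\<tau> \<circ> ?c) x = orbit \<tau> x"
        using orbit_perm_restrict[OF p assms(1) cl False] r by metis
      then show ?thesis using False t(2) that by (metis DiffI)
    qed
    then show "(\<tau> \<circ> ?c) \<in> {\<sigma> \<in> cyc_perms X A. closed_walk \<sigma> ys}"
      using p cl by (simp add: cyc_perms_def)
  qed
  show "?r (\<tau> \<circ> ?c) = \<tau>" if "\<tau> \<in> cyc_perms (X - set ys) A" for \<tau>
    using comp[of \<tau>] permutes_not_in[of \<tau>] that by (auto simp: fun_eq_iff perm_restrict_def cyc_perms_def)
  show "?r \<sigma> \<circ> ?c = \<sigma>" if s: "\<sigma> \<in> {\<sigma> \<in> cyc_perms X A. closed_walk \<sigma> ys}" for \<sigma>
  proof
    fix x
    have "?r \<sigma> permutes (X - set ys)"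
      using \<open>?r \<in> _ \<rightarrow> _\<close> s by (metis (no_types, lifting) Pi_iff cyc_perms_permutes)
    from comp[OF this, of x] show "(?r \<sigma> \<circ> ?c) x = \<sigma> x"
      using closed_walk_unique[OF cc, of \<sigma> x] s
      by (auto simp: perm_restrict_def cyc_perms_def dest: permutes_not_in)
  qed
qed

definition num_cyc_perms :: "nat set \<Rightarrow> nat \<Rightarrow> nat" where
  "num_cyc_perms A n = card (cyc_perms {1..n} A)"

lemma card_cyc_perms: "finite X \<Longrightarrow> card (cyc_perms (X :: nat set) A) = num_cyc_perms A (card X)"
  unfolding num_cyc_perms_def by (rule card_cyc_perms_cong) auto

definition cycle_points :: "nat \<Rightarrow> 'a set \<Rightarrow> ('a \<Rightarrow> 'a) \<Rightarrow> nat" where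
  "cycle_points j X \<sigma> = card {x\<in>X. card (orbit \<sigma> x) = j}"

definition dlists :: "'a set \<Rightarrow> nat \<Rightarrow> 'a list set" where
  "dlists X j = {ys. length ys = j \<and> distinct ys \<and> set ys \<subseteq> X}"

lemma finite_dlists: "finite X \<Longrightarrow> finite (dlists X j)"
  unfolding dlists_def by (rule finite_subset[OF _ finite_lists_length_eq[of X j]]) auto

lemma card_dlists:
  assumes "finite X" "j \<le> card X"
  shows "card (dlists X j) * fact (card X - j) = (fact (card X) :: nat)"
proof -
  have *: "\<Prod>{n - j + 1..n} * fact (n - j) = (fact n :: nat)" if "j \<le> n" for n
  proof -
    have "{1..n} = {1..n - j} \<union> {n - j + 1..n}" using that by auto
    then have "(fact n :: nat) = \<Prod>({1..n - j} \<union> {n - j + 1..n})" by (simp add: fact_prod)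
    also have "\<dots> = \<Prod>{1..n - j} * \<Prod>{n - j + 1..n}"
      by (rule prod.union_disjoint) auto
    finally show ?thesis by (simp add: fact_prod)
  qed
  show ?thesis
    unfolding dlists_def card_lists_distinct_length_eq[OF assms] using *[OF assms(2)] .
qed

lemma orbit_period:
  assumes "\<sigma> permutes X" "finite X"
  shows "(\<sigma> ^^ card (orbit \<sigma> x)) x = x"
    and "inj_on (\<lambda>t. (\<sigma> ^^ t) x) {..<card (orbit \<sigma> x)}"
    and "orbit \<sigma> x = (\<lambda>t. (\<sigma> ^^ t) x) ` {..<card (orbit \<sigma> x)}"
proof -
  have self: "x \<in> orbit \<sigma> x" by (rule self_in_orbit[OF assms])
  \<comment> \<open>The first return time is the period.\<close>
  define m where "m = (LEAST n. 0 < n \<and> (\<sigma> ^^ n) x = x)"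
  have ex: "\<exists>n. 0 < n \<and> (\<sigma> ^^ n) x = x" using self unfolding orbit_altdef by force
  have m: "0 < m" "(\<sigma> ^^ m) x = x" using LeastI_ex[OF ex] by (auto simp: m_def)
  have min: "(\<sigma> ^^ n) x \<noteq> x" if "0 < n" "n < m" for n
    using not_less_Least[of n "\<lambda>n. 0 < n \<and> (\<sigma> ^^ n) x = x"] that by (auto simp: m_def)
  have inj: "inj_on (\<lambda>t. (\<sigma> ^^ t) x) {..<m}"
  proof -
    have "(\<sigma> ^^ a) x \<noteq> (\<sigma> ^^ b) x" if "a < b" "b < m" for a b
    proof
      assume "(\<sigma> ^^ a) x = (\<sigma> ^^ b) x"
      also have "\<dots> = (\<sigma> ^^ a) ((\<sigma> ^^ (b - a)) x)"
        using that by (metis add_diff_inverse_nat comp_apply funpow_add less_imp_not_less)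
      finally have "x = (\<sigma> ^^ (b - a)) x"
        using inj_fn[OF permutes_inj[OF assms(1)], of a] by (simp add: inj_eq)
      moreover have "0 < b - a" "b - a < m" using that by linarith+
      ultimately show False using min by metis
    qed
    then show ?thesis by (intro inj_onI) (metis lessThan_iff nat_neq_iff)
  qed
  have orb: "orbit \<sigma> x = (\<lambda>t. (\<sigma> ^^ t) x) ` {..<m}"
    using orbit_altdef_bounded[OF m(2,1)] by auto
  then have "card (orbit \<sigma> x) = m" using card_image[OF inj] by simp
  then show "(\<sigma> ^^ card (orbit \<sigma> x)) x = x" "inj_on (\<lambda>t. (\<sigma> ^^ t) x) {..<card (orbit \<sigma> x)}"
    "orbit \<sigma> x = (\<lambda>t. (\<sigma> ^^ t) x) ` {..<card (orbit \<sigma> x)}"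
    using m inj orb by simp_all
qed

text \<open>A point of a \<open>j\<close>-cycle is the same as a \<open>j\<close>-cycle written as a list that starts at this point.\<close>

lemma card_closed_walks:
  assumes "\<sigma> permutes X" "finite X" "j \<ge> 1"
  shows "card {ys \<in> dlists X j. closed_walk \<sigma> ys} = cycle_points j X \<sigma>"
proof -
  let ?l = "\<lambda>x. map (\<lambda>t. (\<sigma> ^^ t) x) [0..<j]"
  have "bij_betw ?l {x\<in>X. card (orbit \<sigma> x) = j} {ys \<in> dlists X j. closed_walk \<sigma> ys}"
  proof (rule bij_betwI[where g = hd])
    show "hd (?l x) = x" for x using assms(3) by (simp add: hd_map hd_upt)
    show "?l \<in> {x\<in>X. card (orbit \<sigma> x) = j} \<rightarrow> {ys \<in> dlists X j. closed_walk \<sigma> ys}"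
    proof
      fix x assume "x \<in> {x\<in>X. card (orbit \<sigma> x) = j}"
      then have x: "x \<in> X" "card (orbit \<sigma> x) = j" by auto
      note per = orbit_period[OF assms(1,2), of x]
      have close: "(\<sigma> ^^ j) x = x" using per(1) x(2) by simp
      have "set (?l x) = orbit \<sigma> x" using per(3) x(2) by auto
      moreover have "orbit \<sigma> x \<subseteq> X" using permutes_orbit_subset[OF assms(1) x(1)] .
      moreover have "distinct (?l x)"
        using per(2) x(2) by (simp add: distinct_map lessThan_atLeast0)
      moreover have "closed_walk \<sigma> (?l x)"
        unfolding closed_walk_def
      proof (intro allI impI)
        fix t assume "t < length (?l x)"
        then show "\<sigma> (?l x ! t) = ?l x ! (Suc t mod length (?l x))"
          using close by (cases "Suc t = j") auto
      qed
      ultimately show "?l x \<in> {ys \<in> dlists X j. closed_walk \<sigma> ys}" by (auto simp: dlists_def)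
    qed
    show "hd \<in> {ys \<in> dlists X j. closed_walk \<sigma> ys} \<rightarrow> {x\<in>X. card (orbit \<sigma> x) = j}"
    proof
      fix ys assume "ys \<in> {ys \<in> dlists X j. closed_walk \<sigma> ys}"
      then have y: "length ys = j" "distinct ys" "set ys \<subseteq> X" "closed_walk \<sigma> ys"
        by (auto simp: dlists_def)
      have "hd ys \<in> set ys" using y(1) assms(3) by (intro hd_in_set) auto
      then show "hd ys \<in> {x\<in>X. card (orbit \<sigma> x) = j}"
        using closed_walk_orbit[OF y(4)] y distinct_card by auto
    qed
    show "?l (hd ys) = ys" if "ys \<in> {ys \<in> dlists X j. closed_walk \<sigma> ys}" for ys
    proof (rule nth_equalityI)
      show "length (?l (hd ys)) = length ys" using that by (simp add: dlists_def)
      fix t assume "t < length (?l (hd ys))"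
      then show "?l (hd ys) ! t = ys ! t"
        using walk_funpow[OF closed_walk_imp_walk, of \<sigma> ys 0 t] that
        by (cases "ys = []") (auto simp: dlists_def hd_conv_nth)
    qed
  qed
  from bij_betw_same_card[OF this] show ?thesis by (simp add: cycle_points_def)
qed

text \<open>Double counting of the pairs formed by a permutation and a point of one of its \<open>j\<close>-cycles.\<close>

lemma sum_cycle_points_weighted:
  fixes h :: "('a \<Rightarrow> 'a) \<Rightarrow> nat"
  assumes "finite X" "j \<ge> 1"
  shows "(\<Sum>\<sigma>\<in>cyc_perms X A. cycle_points j X \<sigma> * h \<sigma>) =
    (\<Sum>ys\<in>dlists X j. \<Sum>\<sigma> | \<sigma> \<in> cyc_perms X A \<and> closed_walk \<sigma> ys. h \<sigma>)"
proof -
  have "(\<Sum>\<sigma>\<in>cyc_perms X A. cycle_points j X \<sigma> * h \<sigma>) =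
      (\<Sum>\<sigma>\<in>cyc_perms X A. \<Sum>ys | ys \<in> dlists X j \<and> closed_walk \<sigma> ys. h \<sigma>)"
    using card_closed_walks[OF cyc_perms_permutes assms] by (intro sum.cong) auto
  also have "\<dots> = (\<Sum>ys\<in>dlists X j. \<Sum>\<sigma> | \<sigma> \<in> cyc_perms X A \<and> closed_walk \<sigma> ys. h \<sigma>)"
    by (rule sum.swap_restrict) (simp_all add: assms finite_cyc_perms finite_dlists)
  finally show ?thesis .
qed

lemma card_perms_with_closed_walk:
  assumes "finite (X :: nat set)" "ys \<in> dlists X j" "j \<in> A"
  shows "card {\<sigma> \<in> cyc_perms X A. closed_walk \<sigma> ys} = num_cyc_perms A (card X - j)"
  using bij_betw_same_card[OF remove_cycle_bij[of X ys A]] assms card_cyc_perms[of "X - set ys" A]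
  by (auto simp: dlists_def card_Diff_subset distinct_card)

lemma cycle_points_remove:
  assumes "finite X" "ys \<in> dlists X j" "j \<ge> 1" "\<sigma> permutes X" "closed_walk \<sigma> ys"
  shows "cycle_points j X \<sigma> = j + cycle_points j (X - set ys) (perm_restrict \<sigma> (X - set ys))"
proof -
  have y: "length ys = j" "distinct ys" "set ys \<subseteq> X" using assms by (auto simp: dlists_def)
  have "{x\<in>X. card (orbit \<sigma> x) = j} = set ys \<union>
      {x\<in>X - set ys. card (orbit (perm_restrict \<sigma> (X - set ys)) x) = j}"
    using closed_walk_orbit[OF assms(5)] orbit_perm_restrict[OF assms(4,1,5)] y distinct_card[OF y(2)]
    by auto
  then have "cycle_points j X \<sigma> =
      card (set ys \<union> {x\<in>X - set ys. card (orbit (perm_restrict \<sigma> (X - set ys)) x) = j})"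
    by (simp add: cycle_points_def)
  also have "\<dots> = card (set ys) + card {x\<in>X - set ys. card (orbit (perm_restrict \<sigma> (X - set ys)) x) = j}"
    using assms(1) by (intro card_Un_disjoint) auto
  finally show ?thesis using y distinct_card[OF y(2)] by (simp add: cycle_points_def)
qed

lemma sum_cycle_points:
  assumes "finite (X :: nat set)" "j \<ge> 1" "j \<in> A"
  shows "(\<Sum>\<sigma>\<in>cyc_perms X A. cycle_points j X \<sigma>) = card (dlists X j) * num_cyc_perms A (card X - j)"
  using sum_cycle_points_weighted[OF assms(1,2), where A = A and h = "\<lambda>_. 1"] card_perms_with_closed_walk[OF assms(1) _ assms(3)]
  by simp

text \<open>Second moment: after a \<open>j\<close>-cycle has been deleted, \<open>j\<close> points are lost, and the rest is again a sum of
the first kind.\<close>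

lemma sum_cycle_points_sq:
  assumes "finite (X :: nat set)" "j \<ge> 1" "j \<in> A"
  shows "(\<Sum>\<sigma>\<in>cyc_perms X A. (cycle_points j X \<sigma>)^2) = card (dlists X j) *
    (j * num_cyc_perms A (card X - j) + card (dlists {1..card X - j} j) * num_cyc_perms A (card X - 2 * j))"
proof -
  have "(\<Sum>\<sigma> | \<sigma> \<in> cyc_perms X A \<and> closed_walk \<sigma> ys. cycle_points j X \<sigma>) =
     j * num_cyc_perms A (card X - j) + card (dlists {1..card X - j} j) * num_cyc_perms A (card X - 2 * j)"
    if ys: "ys \<in> dlists X j" for ys
  proof -
    let ?Y = "X - set ys"
    have y: "length ys = j" "distinct ys" "set ys \<subseteq> X" using ys by (auto simp: dlists_def)
    then have cY: "card ?Y = card X - j" "finite ?Y"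
      using assms(1) by (auto simp: card_Diff_subset distinct_card)
    have "(\<Sum>\<sigma> | \<sigma> \<in> cyc_perms X A \<and> closed_walk \<sigma> ys. cycle_points j X \<sigma>) =
        (\<Sum>\<sigma> | \<sigma> \<in> cyc_perms X A \<and> closed_walk \<sigma> ys. j + cycle_points j ?Y (perm_restrict \<sigma> ?Y))"
      using cycle_points_remove[OF assms(1) ys assms(2)] by (intro sum.cong) (auto simp: cyc_perms_def)
    also have "\<dots> = (\<Sum>\<tau>\<in>cyc_perms ?Y A. j + cycle_points j ?Y \<tau>)"
      using remove_cycle_bij[of X ys A] y assms by (intro sum.reindex_bij_betw) auto
    also have "\<dots> = j * num_cyc_perms A (card X - j) + card (dlists ?Y j) * num_cyc_perms A (card ?Y - j)"
      using sum_cycle_points[OF cY(2) assms(2,3)] card_cyc_perms[OF cY(2)] cY by (simp add: sum.distrib)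
    also have "card (dlists ?Y j) = card (dlists {1..card X - j} j)"
    proof (cases "j \<le> card ?Y")
      case True
      have "card (dlists ?Y j) * fact (card ?Y - j) = card (dlists {1..card X - j} j) * fact (card ?Y - j)"
        using card_dlists[OF cY(2) True] card_dlists[of "{1..card X - j}" j] True cY by simp
      then show ?thesis by simp
    next
      case False
      have "dlists Z j = {}" if "finite Z" "card Z < j" for Z :: "nat set"
      proof -
        have "card (set zs) \<le> card Z" if "set zs \<subseteq> Z" for zs using that \<open>finite Z\<close> by (rule card_mono[rotated])
        then show ?thesis using that(2) distinct_card by (fastforce simp: dlists_def)
      qed
      from this[of ?Y] this[of "{1..card X - j}"] show ?thesis using False cY by simp
    qed
    also have "card ?Y - j = card X - 2 * j" using cY by simp
    finally show ?thesis .
  qed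
  then show ?thesis
    using sum_cycle_points_weighted[OF assms(1,2), where A = A and h = "cycle_points j X"]
    by (simp add: power2_eq_square)
qed

section \<open>Points in short cycles\<close>

definition cyc_density :: "nat set \<Rightarrow> nat \<Rightarrow> real" where
  "cyc_density A n = real (num_cyc_perms A n) / fact n"

lemma cyc_density_nonneg: "cyc_density A n \<ge> 0"
  by (simp add: cyc_density_def)

lemma cyc_density_pos_iff: "cyc_density A n > 0 \<longleftrightarrow> num_cyc_perms A n > 0"
  by (simp add: cyc_density_def zero_less_divide_iff)

lemma num_cyc_perms_0: "num_cyc_perms A 0 = 1"
proof -
  have "cyc_perms {1..0} A = {id :: nat \<Rightarrow> nat}" by (auto simp: cyc_perms_def)
  then show ?thesis by (simp add: num_cyc_perms_def)
qed

lemma cyc_density_0: "cyc_density A 0 = 1"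
  by (simp add: cyc_density_def num_cyc_perms_0)

lemma num_cyc_perms_conv: "real (num_cyc_perms A n) = fact n * cyc_density A n"
  by (simp add: cyc_density_def)

lemma real_card_dlists:
  assumes "finite X" "j \<le> card X"
  shows "real (card (dlists X j)) = fact (card X) / fact (card X - j)"
proof -
  have "real (card (dlists X j)) * fact (card X - j) = fact (card X)"
    using arg_cong[where f = real, OF card_dlists[OF assms]] by simp
  then show ?thesis by (simp add: eq_divide_eq)
qed

lemma sum_cycle_points_density:
  assumes "finite (X :: nat set)" "j \<ge> 1" "j \<in> A" "j \<le> card X"
  shows "(\<Sum>\<sigma>\<in>cyc_perms X A. real (cycle_points j X \<sigma>)) = fact (card X) * cyc_density A (card X - j)"
  using arg_cong[where f = real, OF sum_cycle_points[of X j A]] assms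
  by (simp add: real_card_dlists cyc_density_def)

lemma sum_cycle_points_sq_density:
  assumes "j \<ge> 1" "j \<in> A" "2 * j \<le> n"
  shows "(\<Sum>\<sigma>\<in>cyc_perms {1..n} A. (real (cycle_points j {1..n} \<sigma>))\<^sup>2) =
    fact n * (cyc_density A (n - 2 * j) + j * cyc_density A (n - j))"
proof -
  have "n - j - j = n - 2 * j" by simp
  then show ?thesis
  using arg_cong[where f = real, OF sum_cycle_points_sq[of "{1..n}" j A]] assms
  by (simp add: real_card_dlists cyc_density_def field_simps)
qed

lemma cycle_points_le: "finite X \<Longrightarrow> cycle_points j X \<sigma> \<le> card X"
  unfolding cycle_points_def by (rule card_mono) auto

text \<open>The quotient of the two densities is the expected number of points in \<open>j\<close>-cycles, which is at most \<open>n\<close>.\<close>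

lemma cyc_density_diff_le:
  assumes "j \<ge> 1" "j \<in> A" "j \<le> n"
  shows "cyc_density A (n - j) \<le> n * cyc_density A n"
proof -
  have "fact n * cyc_density A (n - j) = (\<Sum>\<sigma>\<in>cyc_perms {1..n} A. real (cycle_points j {1..n} \<sigma>))"
    using sum_cycle_points_density[of "{1..n}", OF _ assms(1,2)] assms(3) by simp
  also have "\<dots> \<le> (\<Sum>\<sigma>\<in>cyc_perms {1..n} A. real n)"
    by (intro sum_mono) (use cycle_points_le[of "{1..n}"] in auto)
  also have "\<dots> = n * (fact n * cyc_density A n)"
    by (simp add: num_cyc_perms_conv[symmetric] num_cyc_perms_def)
  finally show ?thesis by (simp add: mult.left_commute[of _ "fact n"])
qed

text \<open>This is the inequality of Cauchy and Schwarz for the number of points in \<open>j\<close>-cycles. Up to the term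
\<open>j\<close>, it says that the density is logarithmically convex along steps of size \<open>j\<close>.\<close>

lemma cyc_density_log_convex:
  assumes "j \<ge> 1" "j \<in> A" "2 * j \<le> n"
  shows "(cyc_density A (n - j))\<^sup>2 \<le> cyc_density A n * (cyc_density A (n - 2 * j) + j * cyc_density A (n - j))"
proof -
  let ?P = "\<lambda>\<sigma>. real (cycle_points j {1..n} \<sigma>)"
  have "(fact n * cyc_density A (n - j))\<^sup>2 = (\<Sum>\<sigma>\<in>cyc_perms {1..n} A. ?P \<sigma>)\<^sup>2"
    using sum_cycle_points_density[of "{1..n}", OF _ assms(1,2)] assms(3) by simp
  also have "\<dots> \<le> (\<Sum>\<sigma>\<in>cyc_perms {1..n} A. (?P \<sigma>)\<^sup>2) * card (cyc_perms {1..n} A)"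
    by (rule sum_squared_le_sum_of_squares) 
  also have "\<dots> = (fact n)\<^sup>2 * (cyc_density A n * (cyc_density A (n - 2 * j) + j * cyc_density A (n - j)))"
    using sum_cycle_points_sq_density[OF assms] num_cyc_perms_conv[of A n]
    by (simp add: num_cyc_perms_def power2_eq_square)
  finally show ?thesis by (simp add: power_mult_distrib)
qed

lemma sum_cycle_points_all:
  assumes "\<sigma> \<in> cyc_perms {1..n} A"
  shows "(\<Sum>j\<in>A \<inter> {1..n}. cycle_points j {1..n} \<sigma>) = n"
proof -
  have p: "\<sigma> permutes {1..n}" using assms by (rule cyc_perms_permutes)
  have "card (orbit \<sigma> x) \<in> A \<inter> {1..n}" if "x \<in> {1..n}" for x
  proof -
    have "orbit \<sigma> x \<subseteq> {1..n}" using permutes_orbit_subset[OF p that] .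
    then have "card (orbit \<sigma> x) \<le> n" "finite (orbit \<sigma> x)"
      using card_mono[of "{1..n}" "orbit \<sigma> x"] finite_subset[of "orbit \<sigma> x" "{1..n}"] by simp_all
    moreover from this have "card (orbit \<sigma> x) \<noteq> 0" using orbit_nonempty[of \<sigma> x] by simp
    moreover have "card (orbit \<sigma> x) \<in> A" using assms that unfolding cyc_perms_def by blast
    ultimately show ?thesis by (simp add: Suc_le_eq card_gt_0_iff)
  qed
  then have "{1..n} = (\<Union>j\<in>A \<inter> {1..n}. {x \<in> {1..n}. card (orbit \<sigma> x) = j})" by blast
  then have "n = card (\<Union>j\<in>A \<inter> {1..n}. {x \<in> {1..n}. card (orbit \<sigma> x) = j})" by simp
  also have "\<dots> = (\<Sum>j\<in>A \<inter> {1..n}. cycle_points j {1..n} \<sigma>)"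
    unfolding cycle_points_def by (rule card_UN_disjoint) auto
  finally show ?thesis by simp
qed

text \<open>Every point lies in a cycle of some length, so the expected numbers of points in \<open>j\<close>-cycles add up to \<open>n\<close>.\<close>

lemma cyc_density_rec: "n * cyc_density A n = (\<Sum>j\<in>A \<inter> {1..n}. cyc_density A (n - j))"
proof -
  have "fact n * (n * cyc_density A n) = (\<Sum>\<sigma>\<in>cyc_perms {1..n} A. real n)"
    using num_cyc_perms_conv[of A n] by (simp add: num_cyc_perms_def)
  also have "\<dots> = (\<Sum>\<sigma>\<in>cyc_perms {1..n} A. \<Sum>j\<in>A \<inter> {1..n}. real (cycle_points j {1..n} \<sigma>))"
    using sum_cycle_points_all[of _ n A] by (intro sum.cong) (simp_all flip: of_nat_sum)
  also have "\<dots> = (\<Sum>j\<in>A \<inter> {1..n}. \<Sum>\<sigma>\<in>cyc_perms {1..n} A. real (cycle_points j {1..n} \<sigma>))"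
    by (rule sum.swap)
  also have "\<dots> = (\<Sum>j\<in>A \<inter> {1..n}. fact n * cyc_density A (n - j))"
    using sum_cycle_points_density[of "{1..n}" _ A] by (intro sum.cong) auto
  finally show ?thesis by (simp flip: sum_distrib_left)
qed

text \<open>With \<open>r = a\<^bsub>n - j\<^esub> / a\<^sub>n\<close>, log-convexity bounds the ratio at \<open>n - tj\<close> below by \<open>r - tj\<close>, so the
product of \<open>D\<close> consecutive ratios is at least \<open>(r - Dj) ^ D\<close>. The same quotient \<open>a\<^bsub>n - jD\<^esub> / a\<^sub>n\<close> is a
product of \<open>j\<close> ratios for the length \<open>D\<close>, each of which is at most \<open>n\<close>.\<close>

lemma cyc_density_ratio_bound:
  assumes j: "j \<ge> 1" "j \<in> A" and D: "D \<in> A" "D \<ge> 1" and n: "D * j \<le> n" and pos: "cyc_density A n > 0"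
    and big: "cyc_density A (n - j) > real (D * j) * cyc_density A n"
  shows "(cyc_density A (n - j) / cyc_density A n - D * j) ^ D \<le> real n ^ j"
proof -
  let ?a = "cyc_density A"
  define r where "r = ?a (n - j) / ?a n"
  have r: "r > D * j" using big pos by (simp add: r_def field_simps)
  have step: "?a (n - t * j) > 0 \<and> ?a (n - Suc t * j) \<ge> (r - t * j) * ?a (n - t * j)" if "t < D" for t
    using that
  proof (induction t)
    case 0
    then show ?case using pos by (simp add: r_def)
  next
    case (Suc t)
    let ?m = "n - t * j"
    have tD: "Suc (Suc t) * j \<le> n" 
      using Suc.prems n mult_le_mono1[of "Suc (Suc t)" D j] by linarith
    then have m2: "2 * j \<le> ?m" by simp
    have e1: "?m - j = n - Suc t * j" "?m - 2 * j = n - Suc (Suc t) * j" by auto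
    have IH: "?a ?m > 0" "?a (n - Suc t * j) \<ge> (r - t * j) * ?a ?m" using Suc by auto
    have "real (Suc t * j) \<le> real (D * j)" using Suc.prems by (intro of_nat_mono mult_le_mono1) simp
    then have rt: "r - t * j > 0" "r - Suc t * j > 0" using r j by (auto simp: algebra_simps)
    then have p: "?a (n - Suc t * j) > 0" using IH by (smt (verit) mult_pos_pos)
    have "(?a (n - Suc t * j))\<^sup>2 \<le> ?a ?m * (?a (n - Suc (Suc t) * j) + j * ?a (n - Suc t * j))"
      using cyc_density_log_convex[OF j m2] unfolding e1 .
    moreover have "(r - t * j) * ?a ?m * ?a (n - Suc t * j) \<le> (?a (n - Suc t * j))\<^sup>2"
      using IH(2) p by (simp add: power2_eq_square mult_right_mono)
    ultimately have "?a ?m * ((r - t * j) * ?a (n - Suc t * j)) \<le>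
        ?a ?m * (?a (n - Suc (Suc t) * j) + j * ?a (n - Suc t * j))" by (simp add: mult_ac)
    then have "(r - t * j) * ?a (n - Suc t * j) \<le> ?a (n - Suc (Suc t) * j) + j * ?a (n - Suc t * j)"
      using IH(1) by simp
    then show ?case using p by (simp add: algebra_simps)
  qed
  have pow: "?a (n - t * j) \<ge> (r - D * j) ^ t * ?a n" if "t \<le> D" for t
    using that
  proof (induction t)
    case (Suc t)
    have "real (t * j) \<le> real (D * j)" using Suc.prems by (intro of_nat_mono mult_le_mono1) simp
    then have "(r - D * j) ^ Suc t * ?a n \<le> (r - t * j) * ?a (n - t * j)"
      using Suc r cyc_density_nonneg[of A n]
      by (simp add: mult.assoc) (intro mult_mono, auto)
    also have "\<dots> \<le> ?a (n - Suc t * j)" using step[of t] Suc.prems by simp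
    finally show ?case .
  qed simp
  have up: "?a (n - t * D) \<le> real n ^ t * ?a n" if "t * D \<le> n" for t
    using that
  proof (induction t)
    case (Suc t)
    have "?a (n - Suc t * D) = ?a ((n - t * D) - D)" by (simp add: algebra_simps)
    also have "\<dots> \<le> real (n - t * D) * ?a (n - t * D)"
      using Suc.prems D by (intro cyc_density_diff_le) auto
    also have "\<dots> \<le> real n * (real n ^ t * ?a n)"
      using Suc cyc_density_nonneg by (intro mult_mono) auto
    finally show ?case by simp
  qed simp
  have "(r - D * j) ^ D * ?a n \<le> real n ^ j * ?a n"
    using pow[of D] up[of j] n by (simp add: mult.commute)
  then show ?thesis using pos by (simp add: r_def)
qed

text \<open>If the ratio exceeded \<open>\<epsilon>n\<close>, the preceding bound would make \<open>(\<epsilon>n/2) ^ D\<close> at most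
\<open>n ^ (D - 1)\<close>.\<close>

lemma cyc_density_ratio_sublinear:
  fixes \<epsilon> :: real
  assumes j: "j \<ge> 1" "j \<in> A" and D: "D \<in> A" "j < D" and e: "\<epsilon> > 0"
  shows "\<exists>n0. \<forall>n\<ge>n0. cyc_density A (n - j) \<le> \<epsilon> * n * cyc_density A n"
proof -
  let ?a = "cyc_density A"
  \<comment> \<open>Beyond \<open>n0\<close>, the correction \<open>Dj\<close> is at most half of \<open>\<epsilon>n\<close>, and \<open>(\<epsilon>n/2) ^ D\<close> exceeds \<open>n ^ (D - 1)\<close>.\<close>
  define n0 where "n0 = max (D * j) (max (nat \<lceil>2 * D * j / \<epsilon>\<rceil>) (nat \<lceil>(2 / \<epsilon>) ^ D\<rceil> + 1))"
  have "?a (n - j) \<le> \<epsilon> * n * ?a n" if "n \<ge> n0" for n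
  proof (cases "?a n = 0")
    case True
    have "1 * j \<le> D * j" using D by (intro mult_le_mono1) auto
    also have "D * j \<le> n" using that by (simp add: n0_def)
    finally have "j \<le> n" by simp
    then have "?a (n - j) \<le> n * ?a n" using j by (intro cyc_density_diff_le)
    then show ?thesis using True by simp
  next
    case False
    then have pos: "?a n > 0" using cyc_density_nonneg[of A n] by linarith
    show ?thesis
    proof (rule ccontr)
      assume "\<not> ?thesis"
      then have r: "?a (n - j) / ?a n > \<epsilon> * n" using pos by (simp add: field_simps)
      have "2 * D * j / \<epsilon> \<le> n" using that unfolding n0_def by linarith
      then have half: "D * j \<le> \<epsilon> * n / 2" using e by (simp add: field_simps)
      have "(2 / \<epsilon>) ^ D < n" using that unfolding n0_def by linarith
      moreover have "0 < (2 / \<epsilon>) ^ D" using e by simp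
      ultimately have npos: "real n > 0" by linarith
      have "0 \<le> \<epsilon> * n / 2" using e by simp
      then have big: "?a (n - j) > real (D * j) * ?a n"
      proof -
        have "real (D * j) < ?a (n - j) / ?a n" using half r \<open>0 \<le> \<epsilon> * n / 2\<close> by simp
        then show ?thesis using pos by (simp add: field_simps)
      qed
      have "(\<epsilon> * n / 2) ^ D \<le> (?a (n - j) / ?a n - D * j) ^ D"
      proof (rule power_mono)
        show "\<epsilon> * n / 2 \<le> ?a (n - j) / ?a n - D * j"
          using half r by (simp only: of_nat_mult)
        show "0 \<le> \<epsilon> * n / 2" by fact
      qed
      also have "\<dots> \<le> real n ^ j"
        using that D by (intro cyc_density_ratio_bound j D pos big) (auto simp: n0_def)
      also have "\<dots> \<le> real n ^ (D - 1)"
        using D npos by (intro power_increasing) auto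
      finally have "(\<epsilon> * n / 2) ^ D \<le> real n ^ (D - 1)" .
      moreover have "real n ^ D = n * real n ^ (D - 1)" using D by (cases D) auto
      ultimately have "(\<epsilon> / 2) ^ D * n * real n ^ (D - 1) \<le> 1 * real n ^ (D - 1)"
        by (simp add: power_mult_distrib power_divide mult.assoc)
      then have "(\<epsilon> / 2) ^ D * n \<le> 1" using npos by (simp only: mult_le_cancel_right) auto
      then have "n \<le> (2 / \<epsilon>) ^ D" using e by (simp add: power_divide field_simps)
      then show False using \<open>(2 / \<epsilon>) ^ D < n\<close> by linarith
    qed
  qed
  then show ?thesis by blast
qed

section \<open>Convergence of the density\<close>

unbundle fps_syntax

lemma sum_fps_mult_le:
  fixes f g :: "real fps"
  assumes "\<And>n. f $ n \<ge> 0" "\<And>n. g $ n \<ge> 0"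
  shows "(\<Sum>n\<le>N. (f * g) $ n) \<le> (\<Sum>n\<le>N. f $ n) * (\<Sum>n\<le>N. g $ n)"
proof -
  have "(\<Sum>n\<le>N. (f * g) $ n) = (\<Sum>n\<le>N. \<Sum>i\<le>n. f $ i * g $ (n - i))"
    by (simp add: fps_mult_nth atMost_atLeast0)
  also have "\<dots> = (\<Sum>(i, j)\<in>{(i, j). i + j \<le> N}. f $ i * g $ j)"
    by (rule sum.triangle_reindex_eq[symmetric])
  also have "\<dots> \<le> (\<Sum>(i, j)\<in>{..N} \<times> {..N}. f $ i * g $ j)"
    using assms by (intro sum_mono2) auto
  also have "\<dots> = (\<Sum>n\<le>N. f $ n) * (\<Sum>n\<le>N. g $ n)"
    by (simp add: sum_product sum.cartesian_product)
  finally show ?thesis .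
qed

lemma fps_mult_nth_nonneg:
  fixes f g :: "real fps"
  assumes "\<And>n. f $ n \<ge> 0" "\<And>n. g $ n \<ge> 0"
  shows "(f * g) $ n \<ge> 0"
  using assms by (auto simp: fps_mult_nth intro!: sum_nonneg)

lemma fps_power_nth_nonneg:
  fixes f :: "real fps"
  assumes "\<And>n. f $ n \<ge> 0"
  shows "(f ^ m) $ n \<ge> 0"
proof (induction m arbitrary: n)
  case (Suc m)
  then show ?case unfolding power_Suc by (rule fps_mult_nth_nonneg[OF assms])
qed (simp add: fps_one_nth)

lemma sum_fps_power_le:
  fixes f :: "real fps"
  assumes "\<And>n. f $ n \<ge> 0"
  shows "(\<Sum>n\<le>N. (f ^ m) $ n) \<le> (\<Sum>n\<le>N. f $ n) ^ m"
proof (induction m)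
  case 0
  have "(\<Sum>n\<le>N. (1 :: real fps) $ n) = (\<Sum>n\<le>N. if n = 0 then 1 else 0)"
    by (rule sum.cong) simp_all
  then show ?case by simp
next
  case (Suc m)
  have "(\<Sum>n\<le>N. (f ^ Suc m) $ n) \<le> (\<Sum>n\<le>N. f $ n) * (\<Sum>n\<le>N. (f ^ m) $ n)"
    unfolding power_Suc by (rule sum_fps_mult_le) (simp_all add: assms fps_power_nth_nonneg)
  also have "\<dots> \<le> (\<Sum>n\<le>N. f $ n) * (\<Sum>n\<le>N. f $ n) ^ m"
    using Suc by (intro mult_left_mono sum_nonneg assms) auto
  finally show ?case by simp
qed

lemma sum_fps_exp_compose_le:
  fixes f :: "real fps"
  assumes "\<And>n. f $ n \<ge> 0"
  shows "(\<Sum>n\<le>N. (fps_exp 1 oo f) $ n) \<le> exp (\<Sum>n\<le>N. f $ n)"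
proof -
  let ?b = "\<Sum>n\<le>N. f $ n"
  have "(\<Sum>n\<le>N. (fps_exp 1 oo f) $ n) = (\<Sum>n\<le>N. \<Sum>m\<le>n. (f ^ m) $ n / fact m)"
    by (simp add: fps_compose_nth atMost_atLeast0)
  also have "\<dots> \<le> (\<Sum>n\<le>N. \<Sum>m\<le>N. (f ^ m) $ n / fact m)"
    using fps_power_nth_nonneg[OF assms] by (intro sum_mono sum_mono2) auto
  also have "\<dots> = (\<Sum>m\<le>N. (\<Sum>n\<le>N. (f ^ m) $ n) / fact m)"
    by (subst sum.swap) (simp add: sum_divide_distrib)
  also have "\<dots> \<le> (\<Sum>m\<le>N. ?b ^ m / fact m)"
    by (intro sum_mono divide_right_mono sum_fps_power_le assms) auto
  also have "\<dots> \<le> (\<Sum>m. ?b ^ m / fact m)"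
  proof (rule sum_le_suminf)
    show "summable (\<lambda>m. ?b ^ m / fact m)"
      using summable_exp[of ?b] by (simp add: divide_inverse_commute)
    show "0 \<le> ?b ^ m / fact m" for m
      by (intro divide_nonneg_nonneg zero_le_power sum_nonneg assms) simp
  qed simp
  also have "\<dots> = exp ?b" by (simp add: exp_def divide_inverse_commute scaleR_conv_of_real)
  finally show ?thesis .
qed

text \<open>Let \<open>\<beta>\<close> be the power series whose coefficient at a missing length \<open>j\<close> is \<open>1/j\<close>. The generating
function of the densities is \<open>exp (- \<beta>) / (1 - X)\<close>, since both sides satisfy the same recursion. The
densities are thus the partial sums of the coefficients of \<open>exp (- \<beta>)\<close>, which converge absolutely
because they are dominated by those of \<open>exp \<beta>\<close>. The limit is not zero because its product with the
sum of the coefficients of \<open>exp \<beta>\<close> is \<open>1\<close>.\<close>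

lemma cyc_density_tendsto:
  assumes "(\<lambda>j. 1 / real j) summable_on ({1..} - A)"
  shows "\<exists>L>0. cyc_density A \<longlonglongrightarrow> L"
proof -
  define \<beta> :: "real fps" where "\<beta> = Abs_fps (\<lambda>n. if n \<ge> 1 \<and> n \<notin> A then 1 / real n else 0)"
  define C where "C = fps_exp (-1 :: real) oo \<beta>"
  define E where "E = fps_exp (1 :: real) oo \<beta>"
  define G :: "real fps" where "G = Abs_fps (\<lambda>_. 1)"
  have \<beta>0: "\<beta> $ 0 = 0" and \<beta>nn: "\<beta> $ n \<ge> 0" for n by (auto simp: \<beta>_def)
  have d\<beta>: "fps_deriv \<beta> $ n = (if Suc n \<notin> A then 1 else 0)" for n
    by (simp add: \<beta>_def)
  have dC: "fps_deriv C = - C * fps_deriv \<beta>"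
  proof -
    have "fps_deriv (fps_exp (-1 :: real)) = - fps_exp (-1)"
      by (simp add: fps_eq_iff)
    then show ?thesis
      unfolding C_def by (simp add: fps_compose_deriv[OF \<beta>0] fps_compose_uminus)
  qed
  have dE: "fps_deriv E = E * fps_deriv \<beta>"
    unfolding E_def by (subst fps_compose_deriv[OF \<beta>0]) simp
  have CE: "C * E = 1"
  proof -
    have "C * E = (fps_exp (-1) * fps_exp 1) oo \<beta>"
      unfolding C_def E_def by (rule fps_compose_mult_distrib[symmetric, OF \<beta>0])
    also have "fps_exp (-1 :: real) * fps_exp 1 = 1" by (simp flip: fps_exp_add_mult)
    finally show ?thesis by simp
  qed
  have C0: "C $ 0 = 1" and E0: "E $ 0 = 1" by (simp_all add: C_def E_def fps_compose_nth)
  have recE: "real (Suc n) * E $ Suc n = (\<Sum>i\<le>n. E $ i * fps_deriv \<beta> $ (n - i))" for n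
    using arg_cong[OF dE, of "\<lambda>f. f $ n"] by (simp add: fps_mult_nth atMost_atLeast0)
  have recC: "real (Suc n) * C $ Suc n = - (\<Sum>i\<le>n. C $ i * fps_deriv \<beta> $ (n - i))" for n
    using arg_cong[OF dC, of "\<lambda>f. f $ n"] by (simp add: fps_mult_nth atMost_atLeast0 sum_negf)
  have le: "\<bar>C $ n\<bar> \<le> E $ n" for n
  proof (induction n rule: less_induct)
    case (less n)
    show ?case
    proof (cases n)
      case 0
      then show ?thesis using C0 E0 by simp
    next
      case (Suc m)
      have "real (Suc m) * \<bar>C $ Suc m\<bar> = \<bar>real (Suc m) * C $ Suc m\<bar>" by (simp add: abs_mult)
      also have "\<dots> = \<bar>\<Sum>i\<le>m. C $ i * fps_deriv \<beta> $ (m - i)\<bar>" unfolding recC by simp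
      also have "\<dots> \<le> (\<Sum>i\<le>m. \<bar>C $ i * fps_deriv \<beta> $ (m - i)\<bar>)" by (rule sum_abs)
      also have "\<dots> \<le> (\<Sum>i\<le>m. E $ i * fps_deriv \<beta> $ (m - i))"
      proof (intro sum_mono)
        fix i assume "i \<in> {..m}"
        moreover have "fps_deriv \<beta> $ (m - i) \<ge> 0" by (simp only: d\<beta>) simp
        ultimately show "\<bar>C $ i * fps_deriv \<beta> $ (m - i)\<bar> \<le> E $ i * fps_deriv \<beta> $ (m - i)"
          using less[of i] Suc by (simp add: abs_mult mult_right_mono del: fps_deriv_nth)
      qed
      also have "\<dots> = real (Suc m) * E $ Suc m" unfolding recE ..
      finally show ?thesis using Suc by simp
    qed
  qed
  have bound: "(\<Sum>n<N. E $ n) \<le> exp (infsum (\<lambda>j. 1 / real j) ({1..} - A))" for N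
  proof -
    have "(\<Sum>n<N. E $ n) \<le> (\<Sum>n\<le>N. E $ n)"
      using le order_trans[OF abs_ge_zero le] by (intro sum_mono2) auto
    also have "\<dots> \<le> exp (\<Sum>n\<le>N. \<beta> $ n)" unfolding E_def by (rule sum_fps_exp_compose_le[OF \<beta>nn])
    also have "(\<Sum>n\<le>N. \<beta> $ n) = (\<Sum>n\<in>{1..N} - A. 1 / real n)"
      by (rule sum.mono_neutral_cong_right) (auto simp: \<beta>_def)
    also have "\<dots> \<le> infsum (\<lambda>j. 1 / real j) ({1..} - A)"
      by (rule finite_sum_le_infsum[OF assms]) auto
    finally show ?thesis by simp
  qed
  have sE: "summable (\<lambda>n. E $ n)"
    using order_trans[OF abs_ge_zero le] bound by (rule summableI_nonneg_bounded)
  have sC: "summable (\<lambda>n. norm (C $ n))"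
    using le by (intro summable_comparison_test[OF _ sE]) auto
  have sE': "summable (\<lambda>n. norm (E $ n))"
    using sE order_trans[OF abs_ge_zero le] by simp
  have prod: "(\<Sum>n. C $ n) * (\<Sum>n. E $ n) = 1"
  proof -
    have "(\<lambda>n. \<Sum>i\<le>n. C $ i * E $ (n - i)) sums ((\<Sum>n. C $ n) * (\<Sum>n. E $ n))"
      by (rule Cauchy_product_sums[OF sC sE'])
    moreover have "(\<lambda>n. \<Sum>i\<le>n. C $ i * E $ (n - i)) = (\<lambda>n. if n = 0 then 1 else 0)"
      using CE by (simp add: fps_eq_iff fps_mult_nth atMost_atLeast0 fun_eq_iff)
    moreover have "(\<lambda>n::nat. if n = 0 then 1 else 0 :: real) sums 1" using sums_single[of 0 "\<lambda>_. 1"] by simp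
    ultimately show ?thesis using sums_unique2 by metis
  qed
  \<comment> \<open>\<open>G\<close> is the geometric series, so \<open>T\<close> is the quotient of \<open>C\<close> by \<open>1 - X\<close>.\<close>
  define T where "T = C * G"
  have dG: "fps_deriv G = G * G" by (simp add: fps_eq_iff G_def fps_mult_nth)
  have dT: "fps_deriv T = T * (G - fps_deriv \<beta>)"
    unfolding T_def by (simp add: dC dG algebra_simps)
  have GB: "(G - fps_deriv \<beta>) $ i = (if Suc i \<in> A then 1 else 0)" for i
    unfolding fps_sub_nth d\<beta> by (simp add: G_def)
  have T: "cyc_density A n = T $ n" for n
  proof (induction n rule: less_induct)
    case (less n)
    show ?case
    proof (cases n)
      case 0
      then show ?thesis using C0 by (simp add: T_def G_def cyc_density_0)
    next
      case (Suc m)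
      have "real (Suc m) * T $ Suc m = (T * (G - fps_deriv \<beta>)) $ m"
        using arg_cong[OF dT, of "\<lambda>f. f $ m"] by simp
      also have "\<dots> = (\<Sum>i = 0..m. T $ i * (if Suc (m - i) \<in> A then 1 else 0))"
        unfolding fps_mult_nth[of T] GB ..
      also have "\<dots> = (\<Sum>i\<in>{i\<in>{0..m}. Suc (m - i) \<in> A}. T $ i)"
        by (rule sum.mono_neutral_cong_right) auto
      also have "\<dots> = (\<Sum>j\<in>A \<inter> {1..Suc m}. T $ (Suc m - j))"
        by (rule sum.reindex_bij_witness[where i = "\<lambda>j. Suc m - j" and j = "\<lambda>i. Suc m - i"])
          (auto simp: Suc_diff_le)
      also have "\<dots> = (\<Sum>j\<in>A \<inter> {1..Suc m}. cyc_density A (Suc m - j))"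
        using less Suc by (intro sum.cong) auto
      also have "\<dots> = real (Suc m) * cyc_density A (Suc m)" by (rule cyc_density_rec[symmetric])
      finally show ?thesis using Suc by simp
    qed
  qed
  have "T $ n = (\<Sum>i\<le>n. C $ i)" for n by (simp add: T_def G_def fps_mult_nth atMost_atLeast0)
  then have "cyc_density A = (\<lambda>n. \<Sum>i\<le>n. C $ i)" using T by (simp add: fun_eq_iff)
  then have lim: "cyc_density A \<longlonglongrightarrow> (\<Sum>n. C $ n)"
    using summable_LIMSEQ'[OF summable_norm_cancel[OF sC]] by simp
  have "(\<Sum>n. C $ n) \<ge> 0"
    using lim by (rule LIMSEQ_le_const) (use cyc_density_nonneg in auto)
  moreover have "(\<Sum>n. C $ n) \<noteq> 0" using prod by auto
  ultimately show ?thesis using lim by (intro exI[of _ "\<Sum>n. C $ n"]) simp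
qed

unbundle no fps_syntax

section \<open>Probability of prescribed paths and cycles\<close>

text \<open>There are finitely many lengths below \<open>R\<close>, and each of them accounts for \<open>o(n)\<close> points.\<close>

lemma few_points_in_short_cycles:
  fixes \<epsilon> :: real
  assumes A: "A \<subseteq> {1..}" and D: "D \<in> A" "R \<le> D" and e: "\<epsilon> > 0"
  shows "\<exists>n0. \<forall>X :: nat set. finite X \<longrightarrow> n0 \<le> card X \<longrightarrow>
    (\<Sum>\<sigma>\<in>cyc_perms X A. real (card {x\<in>X. card (orbit \<sigma> x) < R})) \<le>
      \<epsilon> * card X * card (cyc_perms X A)"
proof -
  let ?J = "A \<inter> {..<R}"
  have "\<exists>n0. \<forall>n\<ge>n0. cyc_density A (n - j) \<le> (\<epsilon> / (R + 1)) * n * cyc_density A n" if "j \<in> ?J" for j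
    using that A D e by (intro cyc_density_ratio_sublinear) auto
  then obtain N where N: "\<And>j n. j \<in> ?J \<Longrightarrow> n \<ge> N j \<Longrightarrow>
      cyc_density A (n - j) \<le> (\<epsilon> / (R + 1)) * n * cyc_density A n"
    by metis
  define n0 where "n0 = Max (insert R (N ` ?J))"
  have n0: "R \<le> n0" "\<And>j. j \<in> ?J \<Longrightarrow> N j \<le> n0" by (auto simp: n0_def)
  show ?thesis
  proof (intro exI[of _ n0] allI impI)
    fix X :: "nat set" assume X: "finite X" "n0 \<le> card X"
    let ?n = "card X"
    have "real (card {x\<in>X. card (orbit \<sigma> x) < R}) \<le> (\<Sum>j\<in>?J. real (cycle_points j X \<sigma>))"
      if "\<sigma> \<in> cyc_perms X A" for \<sigma>
    proof -
      have "{x\<in>X. card (orbit \<sigma> x) < R} = (\<Union>j\<in>?J. {x\<in>X. card (orbit \<sigma> x) = j})"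
        using that by (auto simp: cyc_perms_def)
      then have "card {x\<in>X. card (orbit \<sigma> x) < R} \<le> (\<Sum>j\<in>?J. cycle_points j X \<sigma>)"
        unfolding cycle_points_def by (simp add: card_UN_le)
      then show ?thesis by (simp flip: of_nat_sum)
    qed
    then have "(\<Sum>\<sigma>\<in>cyc_perms X A. real (card {x\<in>X. card (orbit \<sigma> x) < R})) \<le>
        (\<Sum>\<sigma>\<in>cyc_perms X A. \<Sum>j\<in>?J. real (cycle_points j X \<sigma>))"
      by (rule sum_mono)
    also have "\<dots> = (\<Sum>j\<in>?J. \<Sum>\<sigma>\<in>cyc_perms X A. real (cycle_points j X \<sigma>))" by (rule sum.swap)
    also have "\<dots> = (\<Sum>j\<in>?J. fact ?n * cyc_density A (?n - j))"
      using A X n0 by (intro sum.cong sum_cycle_points_density) auto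
    also have "\<dots> \<le> (\<Sum>j\<in>?J. fact ?n * ((\<epsilon> / (R + 1)) * ?n * cyc_density A ?n))"
    proof (intro sum_mono mult_left_mono)
      fix j assume j: "j \<in> ?J"
      show "cyc_density A (?n - j) \<le> \<epsilon> / (R + 1) * ?n * cyc_density A ?n"
        using n0(2)[OF j] X by (intro N j) auto
    qed simp
    also have "\<dots> = card ?J * ((\<epsilon> / (R + 1)) * ?n * card (cyc_perms X A))"
      using card_cyc_perms[OF X(1), of A] num_cyc_perms_conv[of A ?n] by simp
    also have "\<dots> \<le> (R + 1) * ((\<epsilon> / (R + 1)) * ?n * card (cyc_perms X A))"
    proof (rule mult_right_mono)
      have "card ?J \<le> card {..<R}" by (rule card_mono) auto
      then show "real (card ?J) \<le> real (R + 1)" by simp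
    qed (use e in simp)
    also have "\<dots> = \<epsilon> * ?n * card (cyc_perms X A)" by simp
    finally show "(\<Sum>\<sigma>\<in>cyc_perms X A. real (card {x\<in>X. card (orbit \<sigma> x) < R})) \<le>
      \<epsilon> * card X * card (cyc_perms X A)" .
  qed
qed

definition injections :: "'b set \<Rightarrow> 'a set \<Rightarrow> ('b \<Rightarrow> 'a) set" where
  "injections V X = {\<psi> \<in> V \<rightarrow>\<^sub>E X. inj_on \<psi> V}"

lemma finite_injections: "finite V \<Longrightarrow> finite X \<Longrightarrow> finite (injections V X)"
  unfolding injections_def by (rule finite_subset[OF _ finite_PiE[of V "\<lambda>_. X"]]) auto

lemma card_injections_le: 
  assumes "finite V" "finite X"
  shows "card (injections V X) \<le> card X ^ card V"
proof -
  have "card (injections V X) \<le> card (V \<rightarrow>\<^sub>E X)"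
    unfolding injections_def using assms by (intro card_mono finite_PiE) auto
  then show ?thesis using assms by (simp add: card_PiE)
qed

lemma walk_cong: "(\<And>t. Suc t < length ys \<Longrightarrow> s (ys ! t) = s' (ys ! t)) \<Longrightarrow> walk s ys = walk s' ys"
  by (auto simp: walk_def)

text \<open>The lists are placed one after the other. A list is placed by choosing the image \<open>x\<close> of its
head: the list is injective if the cycle of \<open>x\<close> has at least \<open>R\<close> points, and it
misses the lists that are already placed unless one of \<open>R\<close> iterates of \<open>x\<close> is an occupied point. Each list
thus has all but \<open>K\<close> of the points in long cycles at its disposal.\<close>

lemma card_embeddings_ge:
  fixes \<sigma> :: "'a \<Rightarrow> 'a" and P :: "'b list set"
  assumes "\<sigma> permutes X" "finite X"
    and "finite P" "\<And>xs. xs \<in> P \<Longrightarrow> xs \<noteq> [] \<and> distinct xs \<and> length xs \<le> R"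
    and "disjoint_family_on set P" and "R * card (\<Union>xs\<in>P. set xs) \<le> K"
  shows "(card {x\<in>X. card (orbit \<sigma> x) \<ge> R} - K) ^ card P \<le>
    card {\<psi> \<in> injections (\<Union>xs\<in>P. set xs) X.
      \<forall>xs\<in>P. walk \<sigma> (map \<psi> xs) \<and> card (orbit \<sigma> (\<psi> (hd xs))) \<ge> R}"
  using assms(3-)
proof (induction P rule: finite_induct)
  case empty
  have "injections ({} :: 'b set) X = {\<lambda>_. undefined}" by (auto simp: injections_def)
  then show ?case by simp
next
  case (insert xs P)
  let ?G = "{x\<in>X. card (orbit \<sigma> x) \<ge> R}"
  let ?V = "\<Union>xs\<in>P. set xs"
  let ?E = "\<lambda>P. {\<psi> \<in> injections (\<Union>xs\<in>P. set xs) X.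
      \<forall>xs\<in>P. walk \<sigma> (map \<psi> xs) \<and> card (orbit \<sigma> (\<psi> (hd xs))) \<ge> R}"
  have fV: "finite ?V" using insert.hyps by auto
  have xs: "xs \<noteq> []" "distinct xs" "length xs \<le> R" using insert.prems(1) by auto
  have disj: "set xs \<inter> ?V = {}"
    using insert.prems(2) insert.hyps(2) by (fastforce simp: disjoint_family_on_def)
  have "R * card ?V \<le> R * card (\<Union>xs\<in>insert xs P. set xs)"
    using insert.hyps(1) by (intro mult_left_mono card_mono) auto
  then have KV: "R * card ?V \<le> K" using insert.prems(3) by linarith
  have "disjoint_family_on set P" using insert.prems(2) by (auto simp: disjoint_family_on_def)
  then have IH: "(card ?G - K) ^ card P \<le> card (?E P)"
    using insert.IH insert.prems(1) KV by auto
  \<comment> \<open>Heads whose list would run into a point that is already occupied.\<close>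
  define bad where "bad \<psi> = (\<Union>t<R. {x\<in>X. (\<sigma> ^^ t) x \<in> \<psi> ` ?V})" for \<psi>
  have card_bad: "card (bad \<psi>) \<le> K" for \<psi>
  proof -
    have "card {x\<in>X. (\<sigma> ^^ t) x \<in> \<psi> ` ?V} \<le> card ?V" for t
    proof -
      have "card {x\<in>X. (\<sigma> ^^ t) x \<in> \<psi> ` ?V} \<le> card (\<psi> ` ?V)"
        using inj_fn[OF permutes_inj[OF assms(1)], of t] fV
        by (intro card_inj_on_le[of "\<sigma> ^^ t"]) (auto intro: inj_on_subset)
      then show ?thesis using card_image_le[OF fV, of \<psi>] by linarith
    qed
    then have "card (bad \<psi>) \<le> (\<Sum>t<R. card ?V)"
      unfolding bad_def by (intro order.trans[OF card_UN_le] sum_mono) auto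
    then show ?thesis using KV by simp
  qed
  \<comment> \<open>The position of \<open>v\<close> in \<open>xs\<close>.\<close>
  define ix where "ix v = the_inv_into {..<length xs} ((!) xs) v" for v
  have inj_nth: "inj_on ((!) xs) {..<length xs}" using xs(2) by (simp add: inj_on_nth)
  have ix: "ix (xs ! t) = t" if "t < length xs" for t
    unfolding ix_def using the_inv_into_f_f[OF inj_nth] that by simp
  define ext where "ext = (\<lambda>(\<psi>, x) v. if v \<in> ?V then \<psi> v else if v \<in> set xs then (\<sigma> ^^ ix v) x else (undefined :: 'a))"
  have ext_xs: "ext (\<psi>, x) (xs ! t) = (\<sigma> ^^ t) x" if "t < length xs" for \<psi> x t
    using that disj ix[OF that] by (auto simp: ext_def dest: nth_mem)
  have ext_V: "ext (\<psi>, x) v = \<psi> v" if "v \<in> ?V" for \<psi> x v using that by (simp add: ext_def)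
  have hd: "hd xs = xs ! 0" "0 < length xs" using xs(1) by (auto simp: hd_conv_nth)
  let ?S = "Sigma (?E P) (\<lambda>\<psi>. ?G - bad \<psi>)"
  have inj: "inj_on ext ?S"
  proof (rule inj_onI)
    fix p q assume pq: "p \<in> ?S" "q \<in> ?S" "ext p = ext q"
    obtain \<psi> x \<psi>' x' where [simp]: "p = (\<psi>, x)" "q = (\<psi>', x')" by (cases p, cases q) auto
    have "x = x'" using fun_cong[OF pq(3), of "xs ! 0"] ext_xs[OF hd(2)] by simp
    moreover have "\<psi> v = \<psi>' v" for v
    proof (cases "v \<in> ?V")
      case True
      then show ?thesis using fun_cong[OF pq(3), of v] ext_V by simp
    next
      case False
      have "\<psi> \<in> ?V \<rightarrow>\<^sub>E X" "\<psi>' \<in> ?V \<rightarrow>\<^sub>E X" using pq(1,2) by (simp_all add: injections_def)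
      then show ?thesis using False by (metis PiE_arb)
    qed
    ultimately show "p = q" by auto
  qed
  have sub: "ext ` ?S \<subseteq> ?E (insert xs P)"
  proof (rule image_subsetI)
    fix p assume p: "p \<in> ?S"
    obtain \<psi> x where [simp]: "p = (\<psi>, x)" by (cases p)
    have \<psi>: "\<psi> \<in> ?V \<rightarrow>\<^sub>E X" "inj_on \<psi> ?V"
      "\<And>ys. ys \<in> P \<Longrightarrow> walk \<sigma> (map \<psi> ys) \<and> card (orbit \<sigma> (\<psi> (hd ys))) \<ge> R"
      and x: "x \<in> X" "card (orbit \<sigma> x) \<ge> R" "x \<notin> bad \<psi>"
      using p by (auto simp: injections_def)
    have ptX: "(\<sigma> ^^ t) x \<in> X" for t
      using permutes_in_image[OF permutes_funpow[OF assms(1)]] x(1) by metis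
    have inj_xs: "inj_on (ext p) (set xs)"
    proof (rule inj_onI)
      fix u v assume "u \<in> set xs" "v \<in> set xs" and eq: "ext p u = ext p v"
      then obtain a b where ab: "a < length xs" "b < length xs" "u = xs ! a" "v = xs ! b"
        by (auto simp: in_set_conv_nth)
      then have "(\<sigma> ^^ a) x = (\<sigma> ^^ b) x" using eq ext_xs by simp
      moreover have "a < card (orbit \<sigma> x)" "b < card (orbit \<sigma> x)" using ab x(2) xs(3) by linarith+
      ultimately have "a = b"
        using orbit_period(2)[OF assms(1,2), of x] by (simp add: inj_on_def)
      then show "u = v" using ab by simp
    qed
    have "inj_on (ext p) (set xs \<union> ?V)"
    proof (subst inj_on_Un, intro conjI)
      show "inj_on (ext p) (set xs)" by fact
      show "inj_on (ext p) ?V" using \<psi>(2) ext_V by (simp add: inj_on_def)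
      show "ext p ` (set xs - ?V) \<inter> ext p ` (?V - set xs) = {}"
      proof -
        have False if "t < length xs" "v \<in> ?V" "(\<sigma> ^^ t) x = \<psi> v" for t v
        proof -
          have "t < R" using that xs(3) by linarith
          then have "x \<in> bad \<psi>" using that x(1) unfolding bad_def by blast
          then show False using x(3) by simp
        qed
        then show ?thesis using ext_xs ext_V by (auto simp: in_set_conv_nth) blast
      qed
    qed
    moreover have "ext p \<in> (set xs \<union> ?V) \<rightarrow>\<^sub>E X"
    proof (rule PiE_I)
      fix v assume "v \<in> set xs \<union> ?V"
      then show "ext p v \<in> X" using \<psi>(1) ptX by (auto simp: ext_def)
    qed (auto simp: ext_def)
    moreover have "walk \<sigma> (map (ext p) xs)"
      using ext_xs by (auto simp: walk_def)
    moreover have "card (orbit \<sigma> (ext p (hd xs))) \<ge> R" using ext_xs[OF hd(2)] x(2) hd(1) by simp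
    moreover have "walk \<sigma> (map (ext p) ys) \<and> card (orbit \<sigma> (ext p (hd ys))) \<ge> R" if "ys \<in> P" for ys
    proof -
      have eq: "ext p v = \<psi> v" if "v \<in> set ys" for v
      proof -
        have "v \<in> ?V" using that \<open>ys \<in> P\<close> by blast
        then show ?thesis using ext_V by simp
      qed
      then have "map (ext p) ys = map \<psi> ys" by simp
      moreover have "ys \<noteq> []" using that insert.prems(1) by auto
      then have "ext p (hd ys) = \<psi> (hd ys)" by (intro eq) simp
      ultimately show ?thesis using \<psi>(3)[OF that] by (simp only:)
    qed
    ultimately show "ext p \<in> ?E (insert xs P)" by (auto simp: injections_def)
  qed
  have "(card ?G - K) ^ card (insert xs P) = (card ?G - K) ^ card P * (card ?G - K)"
    using insert.hyps by simp
  also have "\<dots> \<le> card (?E P) * (card ?G - K)" using IH by (rule mult_le_mono1)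
  also have "\<dots> = (\<Sum>\<psi>\<in>?E P. card ?G - K)" by simp
  also have "\<dots> \<le> (\<Sum>\<psi>\<in>?E P. card (?G - bad \<psi>))"
  proof (rule sum_mono)
    fix \<psi>
    have "card ?G - card (bad \<psi>) \<le> card (?G - bad \<psi>)"
      using assms(2) by (intro diff_card_le_card_Diff) (simp add: bad_def)
    then show "card ?G - K \<le> card (?G - bad \<psi>)" using card_bad[of \<psi>] by linarith
  qed
  also have "\<dots> = card ?S" 
    using assms(2) finite_injections[OF fV assms(2)] by (subst card_SigmaI) auto
  also have "\<dots> \<le> card (?E (insert xs P))"
    using finite_injections[of "\<Union>xs\<in>insert xs P. set xs" X] insert.hyps(1) assms(2)
    by (intro card_inj_on_le[OF inj sub]) auto
  finally show ?case .
qed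

lemma power_diff_nat_ge:
  fixes g K n c :: nat
  assumes "g \<le> n" "n \<ge> 1"
  shows "real ((g - K) ^ c) \<ge> real n ^ c * (1 - c * (real (n - g) + K) / n)"
proof (cases "n - g + K \<le> n")
  case True
  let ?x = "- (real (n - g) + K) / n"
  have x: "-1 \<le> ?x" using True assms(2) by (simp add: field_simps flip: of_nat_add)
  have "real (g - K) = real n * (1 + ?x)" using True assms by (simp add: field_simps of_nat_diff)
  then have "real ((g - K) ^ c) = real n ^ c * (1 + ?x) ^ c" by (simp add: power_mult_distrib)
  also have "\<dots> \<ge> real n ^ c * (1 + c * ?x)"
    by (intro mult_left_mono Bernoulli_inequality[OF x]) auto
  also have "1 + c * ?x = 1 - c * (real (n - g) + K) / n" using assms(2) by (simp add: field_simps)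
  finally show ?thesis .
next
  case False
  show ?thesis
  proof (cases "c = 0")
    case c: False
    have "real n \<le> 1 * (real (n - g) + K)" using False by simp
    also have "\<dots> \<le> c * (real (n - g) + K)" using c by (intro mult_right_mono) auto
    finally have "1 - c * (real (n - g) + K) / n \<le> 0" using assms(2) by (simp add: field_simps)
    then have "real n ^ c * (1 - c * (real (n - g) + K) / n) \<le> 0" by (simp add: mult_nonneg_nonpos)
    then show ?thesis by (meson of_nat_0_le_iff order_trans)
  qed simp
qed

text \<open>A component of maximal length \<open>d\<close> has to be a full cycle.\<close>

definition comp_walk :: "enat \<Rightarrow> ('a \<Rightarrow> 'a) \<Rightarrow> 'a list \<Rightarrow> bool" where
  "comp_walk d s ys \<longleftrightarrow> (if enat (length ys) = d then closed_walk s ys else walk s ys)"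

lemma comp_walk_infinity: "comp_walk \<infinity> s ys = walk s ys"
  by (simp add: comp_walk_def)

lemma walk_conj: "walk s (map \<psi> xs) \<Longrightarrow> inj h \<Longrightarrow> walk (h \<circ> s \<circ> finv h) (map (h \<circ> \<psi>) xs)"
  by (simp add: walk_def)

lemma closed_walk_conj:
  "closed_walk s (map \<psi> xs) \<Longrightarrow> inj h \<Longrightarrow> closed_walk (h \<circ> s \<circ> finv h) (map (h \<circ> \<psi>) xs)"
  by (cases "xs = []") (auto simp add: closed_walk_def)

lemma comp_walk_conj:
  "comp_walk d s (map \<psi> xs) \<Longrightarrow> inj h \<Longrightarrow> comp_walk d (h \<circ> s \<circ> finv h) (map (h \<circ> \<psi>) xs)"
  by (auto simp: comp_walk_def walk_conj closed_walk_conj simp del: map_map split: if_splits)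

text \<open>A permutation of \<open>X\<close> that carries \<open>\<psi>\<close> to \<open>\<phi>\<close> conjugates the permutations that respect the lists
under \<open>\<psi>\<close> into those that respect them under \<open>\<phi>\<close>.\<close>

lemma card_realizing_le:
  assumes "finite X" "\<psi> \<in> injections V X" "inj_on \<phi> V" "\<phi> ` V \<subseteq> X" "\<And>xs. xs \<in> P \<Longrightarrow> set xs \<subseteq> V"
  shows "card {\<sigma> \<in> cyc_perms X A. \<forall>xs\<in>P. comp_walk d \<sigma> (map \<psi> xs)} \<le>
    card {\<sigma> \<in> cyc_perms X A. \<forall>xs\<in>P. comp_walk d \<sigma> (map \<phi> xs)}"
proof -
  have "\<exists>h. h permutes X \<and> (\<forall>v\<in>V. h (\<psi> v) = \<phi> v)"
    using assms by (intro ex_permutes_extending) (auto simp: injections_def)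
  then obtain h where h: "h permutes X" "\<And>v. v \<in> V \<Longrightarrow> h (\<psi> v) = \<phi> v" by blast
  have bh: "bij h" and ih: "inj h" using h(1) by (auto intro: permutes_bij permutes_inj)
  show ?thesis
  proof (rule card_inj_on_le[where f = "\<lambda>\<sigma>. h \<circ> \<sigma> \<circ> finv h"])
    show "inj_on (\<lambda>\<sigma>. h \<circ> \<sigma> \<circ> finv h) {\<sigma> \<in> cyc_perms X A. \<forall>xs\<in>P. comp_walk d \<sigma> (map \<psi> xs)}"
      using ih by (rule inj_on_conj)
    show "(\<lambda>\<sigma>. h \<circ> \<sigma> \<circ> finv h) ` {\<sigma> \<in> cyc_perms X A. \<forall>xs\<in>P. comp_walk d \<sigma> (map \<psi> xs)} \<subseteq>
        {\<sigma> \<in> cyc_perms X A. \<forall>xs\<in>P. comp_walk d \<sigma> (map \<phi> xs)}"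
    proof (rule image_subsetI)
      fix \<sigma> assume s: "\<sigma> \<in> {\<sigma> \<in> cyc_perms X A. \<forall>xs\<in>P. comp_walk d \<sigma> (map \<psi> xs)}"
      have "map (h \<circ> \<psi>) xs = map \<phi> xs" if "xs \<in> P" for xs
        using h(2) assms(5)[OF that] by auto
      then have "comp_walk d (h \<circ> \<sigma> \<circ> finv h) (map \<phi> xs)" if "xs \<in> P" for xs
        using comp_walk_conj[OF _ ih] s that by (metis (mono_tags, lifting) mem_Collect_eq)
      moreover have "h \<circ> \<sigma> \<circ> finv h \<in> cyc_perms X A"
        using conj_mem_cyc_perms[OF _ bh assms(1)] s permutes_image[OF h(1)] by fastforce
      ultimately show "h \<circ> \<sigma> \<circ> finv h \<in> {\<sigma> \<in> cyc_perms X A. \<forall>xs\<in>P. comp_walk d \<sigma> (map \<phi> xs)}"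
        by blast
    qed
  qed (simp add: finite_cyc_perms assms(1))
qed

text \<open>If \<open>d\<close> is the largest cycle length and the cycle of the first point is at least that long, then a
path with \<open>d\<close> points closes up by itself.\<close>

lemma walk_imp_comp_walk:
  assumes "\<sigma> \<in> cyc_perms X A" "finite X" "\<And>j. j \<in> A \<Longrightarrow> enat j \<le> d"
    and "walk \<sigma> ys" "ys \<noteq> []" "hd ys \<in> X" "card (orbit \<sigma> (hd ys)) \<ge> R" "enat (length ys) = d \<Longrightarrow> length ys = R"
  shows "comp_walk d \<sigma> ys"
proof (cases "enat (length ys) = d")
  case True
  have p: "\<sigma> permutes X" using assms(1) by (rule cyc_perms_permutes)
  have "card (orbit \<sigma> (hd ys)) \<in> A" using assms(1,6) by (auto simp: cyc_perms_def)
  then have c: "card (orbit \<sigma> (hd ys)) = length ys"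
    using assms(3,7,8) True by (metis enat_ord_simps(1) order_antisym)
  have "closed_walk \<sigma> ys"
    unfolding closed_walk_def
  proof (intro allI impI)
    fix t assume t: "t < length ys"
    have hd: "hd ys = ys ! 0" using assms(5) by (simp add: hd_conv_nth)
    show "\<sigma> (ys ! t) = ys ! (Suc t mod length ys)"
    proof (cases "Suc t = length ys")
      case last: True
      have "ys ! t = (\<sigma> ^^ t) (hd ys)" using walk_funpow[OF assms(4), of 0 t] t hd by simp
      then have "\<sigma> (ys ! t) = (\<sigma> ^^ length ys) (hd ys)" by (simp flip: last)
      also have "\<dots> = hd ys" using orbit_period(1)[OF p assms(2), of "hd ys"] c by simp
      finally show ?thesis using last hd by simp
    qed (use assms(4) t in \<open>simp add: walk_def\<close>)
  qed
  then show ?thesis using True by (simp add: comp_walk_def)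
qed (use assms(4) in \<open>simp add: comp_walk_def\<close>)

text \<open>Double counting of the pairs of a permutation and an injection that respects the lists. For a fixed
permutation there are at least \<open>n ^ |P| (1 - |P| (b + K) / n)\<close> injections, by Bernoulli's inequality,
where \<open>b\<close> is the number of points in short cycles and has a small average. For a fixed injection the
number of permutations does not depend on the injection.\<close>

lemma realizing_density:
  fixes P :: "'b list set" and \<epsilon> :: real
  assumes A: "A \<subseteq> {1..}" "D \<in> A" "R \<le> D" "\<And>j. j \<in> A \<Longrightarrow> enat j \<le> d"
    and P: "finite P" "\<And>xs. xs \<in> P \<Longrightarrow> xs \<noteq> [] \<and> distinct xs \<and> length xs \<le> R"
      "\<And>xs. xs \<in> P \<Longrightarrow> enat (length xs) = d \<Longrightarrow> length xs = R"
      "disjoint_family_on set P" 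
    and V: "V = (\<Union>xs\<in>P. set xs)" and e: "\<epsilon> > 0"
  shows "\<exists>n0. \<forall>X :: nat set. \<forall>\<phi>. finite X \<longrightarrow> n0 \<le> card X \<longrightarrow> inj_on \<phi> V \<longrightarrow> \<phi> ` V \<subseteq> X \<longrightarrow>
    (1 - \<epsilon>) * real (card X) ^ card P * card (cyc_perms X A) \<le>
    real (card {\<sigma> \<in> cyc_perms X A. \<forall>xs\<in>P. comp_walk d \<sigma> (map \<phi> xs)}) * real (card X) ^ card V"
proof -
  define c where "c = card P"
  define K where "K = R * card V"
  have fV: "finite V" using P V by auto
  obtain n1 where n1: "\<And>X :: nat set. finite X \<Longrightarrow> n1 \<le> card X \<Longrightarrow>
    (\<Sum>\<sigma>\<in>cyc_perms X A. real (card {x\<in>X. card (orbit \<sigma> x) < R})) \<le>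
      (\<epsilon> / (2 * (c + 1))) * card X * card (cyc_perms X A)"
    using few_points_in_short_cycles[OF A(1-3), where \<epsilon> = "\<epsilon> / (2 * (c + 1))"] e by auto
  define n0 where "n0 = max (max n1 1) (nat \<lceil>2 * c * K / \<epsilon>\<rceil>)"
  show ?thesis
  proof (intro exI[of _ n0] allI impI)
    fix X :: "nat set" and \<phi> assume X: "finite X" "n0 \<le> card X" and phi: "inj_on \<phi> V" "\<phi> ` V \<subseteq> X"
    define n where "n = card X"
    have n: "n \<ge> n1" "n \<ge> 1" "2 * c * K / \<epsilon> \<le> n" using X(2) unfolding n0_def n_def by linarith+
    let ?S = "cyc_perms X A"
    let ?s = "\<lambda>\<sigma>. real (card {x\<in>X. card (orbit \<sigma> x) < R})"
    let ?Q = "card {\<sigma> \<in> ?S. \<forall>xs\<in>P. comp_walk d \<sigma> (map \<phi> xs)}"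
    have fS: "finite ?S" using X(1) by (rule finite_cyc_perms)
    have fI: "finite (injections V X)" using fV X(1) by (rule finite_injections)
    have lower: "real n ^ c * (1 - real c * (?s \<sigma> + real K) / n) \<le>
        real (card {\<psi> \<in> injections V X. \<forall>xs\<in>P. comp_walk d \<sigma> (map \<psi> xs)})" if \<sigma>: "\<sigma> \<in> ?S" for \<sigma>
    proof -
      have p: "\<sigma> permutes X" using \<sigma> by (rule cyc_perms_permutes)
      let ?g = "card {x\<in>X. card (orbit \<sigma> x) \<ge> R}"
      have "X = {x\<in>X. card (orbit \<sigma> x) \<ge> R} \<union> {x\<in>X. card (orbit \<sigma> x) < R}" by auto
      then have "n = card ({x\<in>X. card (orbit \<sigma> x) \<ge> R} \<union> {x\<in>X. card (orbit \<sigma> x) < R})"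
        by (simp add: n_def)
      also have "\<dots> = ?g + card {x\<in>X. card (orbit \<sigma> x) < R}"
        using X(1) by (intro card_Un_disjoint) auto
      finally have g: "?g \<le> n" "real (n - ?g) = ?s \<sigma>" by simp_all
      have "real n ^ c * (1 - real c * (?s \<sigma> + real K) / n) \<le> real ((?g - K) ^ c)"
        using power_diff_nat_ge[OF g(1) n(2), of c K] g(2) by simp
      also have "(?g - K) ^ c \<le> card {\<psi> \<in> injections V X.
          \<forall>xs\<in>P. walk \<sigma> (map \<psi> xs) \<and> card (orbit \<sigma> (\<psi> (hd xs))) \<ge> R}"
        unfolding c_def V using card_embeddings_ge[OF p X(1) P(1,2,4), of K] K_def V by simp
      also have "\<dots> \<le> card {\<psi> \<in> injections V X. \<forall>xs\<in>P. comp_walk d \<sigma> (map \<psi> xs)}"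
      proof (rule card_mono)
        show "{\<psi> \<in> injections V X. \<forall>xs\<in>P. walk \<sigma> (map \<psi> xs) \<and> card (orbit \<sigma> (\<psi> (hd xs))) \<ge> R} \<subseteq>
          {\<psi> \<in> injections V X. \<forall>xs\<in>P. comp_walk d \<sigma> (map \<psi> xs)}"
        proof safe
          fix \<psi> xs assume \<psi>: "\<psi> \<in> injections V X" "xs \<in> P"
            "\<forall>xs\<in>P. walk \<sigma> (map \<psi> xs) \<and> card (orbit \<sigma> (\<psi> (hd xs))) \<ge> R"
          have ne: "xs \<noteq> []" using P(2)[OF \<psi>(2)] by simp
          then have "hd xs \<in> V" using \<psi>(2) V hd_in_set[OF ne] by blast
          then have "\<psi> (hd xs) \<in> X" using \<psi>(1) by (auto simp: injections_def)
          then show "comp_walk d \<sigma> (map \<psi> xs)"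
            using \<psi>(2,3) ne P(3) by (intro walk_imp_comp_walk[OF \<sigma> X(1) A(4), where R = R]) (auto simp: hd_map)
        qed
      qed (use fI in simp)
      finally show ?thesis by simp
    qed
    have "real n ^ c * card ?S * (1 - \<epsilon>) \<le> real n ^ c * (\<Sum>\<sigma>\<in>?S. 1 - real c * (?s \<sigma> + real K) / n)"
    proof -
      have "(\<Sum>\<sigma>\<in>?S. 1 - real c * (?s \<sigma> + real K) / n) = (\<Sum>\<sigma>\<in>?S. (1 - real c * real K / n) - (c / n) * ?s \<sigma>)"
      proof (rule sum.cong[OF HOL.refl])
        fix \<sigma>
        have "real c * (?s \<sigma> + real K) / n = real c * real K / n + (c / n) * ?s \<sigma>"
          by (simp add: add_divide_distrib distrib_left)
        then show "1 - real c * (?s \<sigma> + real K) / n = (1 - real c * real K / n) - (c / n) * ?s \<sigma>"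
          by linarith
      qed
      also have "\<dots> = card ?S * (1 - real c * real K / n) - (c / n) * (\<Sum>\<sigma>\<in>?S. ?s \<sigma>)"
        by (simp add: sum_subtractf sum_distrib_left)
      also have "\<dots> \<ge> card ?S * (1 - \<epsilon> / 2) - (c / n) * ((\<epsilon> / (2 * (c + 1))) * n * card ?S)"
      proof (rule diff_mono; rule mult_left_mono)
        show "1 - \<epsilon> / 2 \<le> 1 - real c * real K / n" using n e by (simp add: field_simps)
        show "(\<Sum>\<sigma>\<in>?S. ?s \<sigma>) \<le> (\<epsilon> / (2 * (c + 1))) * n * card ?S"
          using n1[OF X(1)] n(1) by (simp add: n_def)
      qed simp_all
      also have "card ?S * (1 - \<epsilon> / 2) - (c / n) * ((\<epsilon> / (2 * (c + 1))) * n * card ?S) =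
          card ?S * (1 - \<epsilon> / 2 - (c / (c + 1)) * (\<epsilon> / 2))"
        using n(2) by (simp add: field_simps)
      also have "\<dots> \<ge> card ?S * (1 - \<epsilon>)"
      proof (rule mult_left_mono)
        have "(real c / (c + 1)) * (\<epsilon> / 2) \<le> 1 * (\<epsilon> / 2)" using e by (intro mult_right_mono) auto
        then show "1 - \<epsilon> \<le> 1 - \<epsilon> / 2 - (real c / (c + 1)) * (\<epsilon> / 2)" by simp
      qed simp
      finally show ?thesis by (simp add: mult.assoc mult_left_mono)
    qed
    also have "\<dots> \<le> (\<Sum>\<sigma>\<in>?S. real (card {\<psi> \<in> injections V X. \<forall>xs\<in>P. comp_walk d \<sigma> (map \<psi> xs)}))"
      unfolding sum_distrib_left by (rule sum_mono[OF lower])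
    also have "\<dots> = (\<Sum>\<psi>\<in>injections V X. real (card {\<sigma> \<in> ?S. \<forall>xs\<in>P. comp_walk d \<sigma> (map \<psi> xs)}))"
    proof -
      have "(\<Sum>\<sigma>\<in>?S. \<Sum>\<psi> | \<psi> \<in> injections V X \<and> (\<forall>xs\<in>P. comp_walk d \<sigma> (map \<psi> xs)). 1 :: real) =
          (\<Sum>\<psi>\<in>injections V X. \<Sum>\<sigma> | \<sigma> \<in> ?S \<and> (\<forall>xs\<in>P. comp_walk d \<sigma> (map \<psi> xs)). 1)"
        by (rule sum.swap_restrict[OF fS fI])
      then show ?thesis by simp
    qed
    also have "\<dots> \<le> (\<Sum>\<psi>\<in>injections V X. real ?Q)"
      using card_realizing_le[OF X(1) _ phi, of _ P A d] V by (intro sum_mono) auto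
    also have "\<dots> \<le> real n ^ card V * ?Q"
    proof -
      have "real (card (injections V X)) \<le> real (n ^ card V)"
        using card_injections_le[OF fV X(1)] unfolding n_def of_nat_le_iff .
      then have "real (card (injections V X)) * ?Q \<le> real (n ^ card V) * ?Q"
        by (rule mult_right_mono) simp
      then show ?thesis by simp
    qed
    finally show "(1 - \<epsilon>) * real (card X) ^ card P * card ?S \<le> real ?Q * real (card X) ^ card V"
      by (simp add: n_def c_def mult_ac)
  qed
qed

lemma fact_le_power_mult_fact: "j \<le> n \<Longrightarrow> fact n \<le> (real n) ^ j * fact (n - j)"
proof (induction j)
  case (Suc j)
  have "fact (n - j) = real (n - j) * fact (n - Suc j)"
    using Suc.prems by (subst fact_reduce) (auto simp: Suc_diff_Suc)
  also have "\<dots> \<le> real n * fact (n - Suc j)" by (intro mult_right_mono) auto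
  finally have "real n ^ j * fact (n - j) \<le> real n ^ j * (real n * fact (n - Suc j))"
    by (rule mult_left_mono) simp
  also have "\<dots> = real n ^ Suc j * fact (n - Suc j)" by simp
  finally have "real n ^ j * fact (n - j) \<le> real n ^ Suc j * fact (n - Suc j)" .
  moreover have "fact n \<le> real n ^ j * fact (n - j)" using Suc by simp
  ultimately show ?case by linarith
qed simp

text \<open>The quotient \<open>a\<^bsub>n - j\<^esub> / a\<^sub>n\<close> of the densities tends to \<open>1\<close>, and \<open>n! / (n - j)!\<close> is at most \<open>n ^ j\<close>.\<close>

lemma num_cyc_perms_remove_ge:
  fixes \<epsilon> :: real
  assumes "\<exists>L>0. cyc_density A \<longlonglongrightarrow> L" and e: "\<epsilon> > 0"
  shows "\<exists>n0. \<forall>n\<ge>n0. (1 - \<epsilon>) * num_cyc_perms A n \<le> num_cyc_perms A (n - j) * real n ^ j"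
proof -
  obtain L where L: "L > 0" "cyc_density A \<longlonglongrightarrow> L" using assms(1) by blast
  have "(\<lambda>n. cyc_density A (n - j)) \<longlonglongrightarrow> L"
    by (rule LIMSEQ_offset[where k = j]) (simp add: L(2))
  then have "(\<lambda>n. cyc_density A (n - j) - (1 - \<epsilon>) * cyc_density A n) \<longlonglongrightarrow> L - (1 - \<epsilon>) * L"
    by (intro tendsto_intros L(2))
  moreover have "L - (1 - \<epsilon>) * L > 0" using e L(1) by (simp add: algebra_simps)
  ultimately have "\<forall>\<^sub>F n in sequentially. cyc_density A (n - j) - (1 - \<epsilon>) * cyc_density A n > 0"
    by (rule order_tendstoD(1))
  then obtain n1 where n1: "\<And>n. n \<ge> n1 \<Longrightarrow> (1 - \<epsilon>) * cyc_density A n \<le> cyc_density A (n - j)"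
    unfolding eventually_sequentially by (force intro: less_imp_le)
  show ?thesis
  proof (intro exI[of _ "max n1 j"] allI impI)
    fix n assume n: "max n1 j \<le> n"
    have "(1 - \<epsilon>) * num_cyc_perms A n = fact n * ((1 - \<epsilon>) * cyc_density A n)"
      by (simp add: num_cyc_perms_conv)
    also have "\<dots> \<le> fact n * cyc_density A (n - j)" using n1[of n] n by (intro mult_left_mono) auto
    also have "\<dots> \<le> (real n ^ j * fact (n - j)) * cyc_density A (n - j)"
      using fact_le_power_mult_fact[of j n] n cyc_density_nonneg by (intro mult_right_mono) auto
    also have "\<dots> = num_cyc_perms A (n - j) * real n ^ j" by (simp add: num_cyc_perms_conv)
    finally show "(1 - \<epsilon>) * num_cyc_perms A n \<le> num_cyc_perms A (n - j) * real n ^ j" .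
  qed
qed

lemma card_le_card_Union_lists:
  assumes "finite P" "\<And>xs. xs \<in> P \<Longrightarrow> xs \<noteq> []" "disjoint_family_on set P"
  shows "card P \<le> card (\<Union>xs\<in>P. set xs)"
proof -
  have "card P = (\<Sum>xs\<in>P. 1)" by simp
  also have "\<dots> \<le> (\<Sum>xs\<in>P. card (set xs))"
    using assms(2) by (intro sum_mono) (simp add: Suc_le_eq card_gt_0_iff)
  also have "\<dots> = card (\<Union>xs\<in>P. set xs)"
    using assms(1,3) by (intro card_UN_disjoint[symmetric]) (auto simp: disjoint_family_on_def)
  finally show ?thesis .
qed

lemma walk_perm_restrict:
  assumes "set xs \<subseteq> Y" shows "walk (perm_restrict \<sigma> Y) xs = walk \<sigma> xs"
proof (rule walk_cong)
  fix t assume "Suc t < length xs"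
  then have "xs ! t \<in> Y" using assms nth_mem[of t xs] by auto
  then show "perm_restrict \<sigma> Y (xs ! t) = \<sigma> (xs ! t)" by (simp add: perm_restrict_simps)
qed

text \<open>Deleting the prescribed cycle \<open>zs\<close> reduces the claim to the lists in \<open>P\<close> and permutations of the
other points. In contrast to a path, a closed list does not count on the left-hand side: with
\<open>j\<close> points it has probability of order \<open>n powr (- j)\<close>.\<close>

lemma realizing_density_with_cycle:
  fixes P :: "'b list set" and \<epsilon> :: real
  assumes A: "A \<subseteq> {1..}" "D \<in> A" "R \<le> D" and L: "\<exists>L>0. cyc_density A \<longlonglongrightarrow> L"
    and P: "finite P" "\<And>xs. xs \<in> P \<Longrightarrow> xs \<noteq> [] \<and> distinct xs \<and> length xs \<le> R"
      "disjoint_family_on set P" 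
    and V: "V = (\<Union>xs\<in>P. set xs)" 
    and z: "distinct zs" "set zs \<inter> V = {}" "length zs \<in> A" and e: "\<epsilon> > 0"
  shows "\<exists>n0. \<forall>X :: nat set. \<forall>\<phi>. finite X \<longrightarrow> n0 \<le> card X \<longrightarrow> inj_on \<phi> (V \<union> set zs) \<longrightarrow> \<phi> ` (V \<union> set zs) \<subseteq> X \<longrightarrow>
    (1 - \<epsilon>) * real (card X) ^ card P * card (cyc_perms X A) \<le>
    real (card {\<sigma> \<in> cyc_perms X A. (\<forall>xs\<in>P. walk \<sigma> (map \<phi> xs)) \<and> closed_walk \<sigma> (map \<phi> zs)}) *
      real (card X) ^ card (V \<union> set zs)"
proof (cases "\<epsilon> < 1")
  case True
  let ?j = "length zs"
  have "\<exists>n0. \<forall>X :: nat set. \<forall>\<phi>. finite X \<longrightarrow> n0 \<le> card X \<longrightarrow> inj_on \<phi> V \<longrightarrow> \<phi> ` V \<subseteq> X \<longrightarrow>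
    (1 - \<epsilon> / 2) * real (card X) ^ card P * card (cyc_perms X A) \<le>
    real (card {\<sigma> \<in> cyc_perms X A. \<forall>xs\<in>P. comp_walk \<infinity> \<sigma> (map \<phi> xs)}) * real (card X) ^ card V"
    using e by (intro realizing_density[OF A _ P(1,2) _ P(3) V]) auto
  then obtain n1 where n1: "\<And>X \<phi>. finite X \<Longrightarrow> n1 \<le> card X \<Longrightarrow> inj_on \<phi> V \<Longrightarrow> \<phi> ` V \<subseteq> (X :: nat set) \<Longrightarrow>
    (1 - \<epsilon> / 2) * real (card X) ^ card P * card (cyc_perms X A) \<le>
    real (card {\<sigma> \<in> cyc_perms X A. \<forall>xs\<in>P. walk \<sigma> (map \<phi> xs)}) * real (card X) ^ card V"
    unfolding comp_walk_infinity by blast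
  obtain n2 where n2: "\<And>n. n \<ge> n2 \<Longrightarrow> (1 - \<epsilon> / 2) * num_cyc_perms A n \<le> num_cyc_perms A (n - ?j) * real n ^ ?j"
    using num_cyc_perms_remove_ge[OF L, of "\<epsilon> / 2" ?j] e by auto
  have PV: "card P \<le> card V" unfolding V using P by (intro card_le_card_Union_lists) auto
  have fV: "finite V" using P V by auto
  show ?thesis
  proof (intro exI[of _ "max (n1 + ?j + 1) n2"] allI impI)
    fix X :: "nat set" and \<phi>
    assume X: "finite X" "max (n1 + ?j + 1) n2 \<le> card X"
      and phi: "inj_on \<phi> (V \<union> set zs)" "\<phi> ` (V \<union> set zs) \<subseteq> X"
    let ?ys = "map \<phi> zs" and ?n = "card X"
    let ?Y = "X - set ?ys" and ?m = "card X - ?j"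
    have ys: "distinct ?ys" "set ?ys \<subseteq> X" "length ?ys \<in> A"
      using phi z by (auto simp: distinct_map inj_on_Un)
    have cY: "card ?Y = ?m" "finite ?Y" using X ys distinct_card[OF ys(1)] by (auto simp: card_Diff_subset)
    have sub: "\<phi> ` V \<subseteq> ?Y" using phi z(2) by (fastforce simp: inj_on_def)
    have bij: "bij_betw (\<lambda>\<sigma>. perm_restrict \<sigma> ?Y) {\<sigma> \<in> {\<sigma> \<in> cyc_perms X A. closed_walk \<sigma> ?ys}. \<forall>xs\<in>P. walk \<sigma> (map \<phi> xs)}
      {\<tau> \<in> cyc_perms ?Y A. \<forall>xs\<in>P. walk \<tau> (map \<phi> xs)}"
    proof (rule bij_betw_Collect[OF remove_cycle_bij[OF X(1) ys]])
      fix \<sigma>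
      have "walk (perm_restrict \<sigma> ?Y) (map \<phi> xs) = walk \<sigma> (map \<phi> xs)" if "xs \<in> P" for xs
        using that sub V by (intro walk_perm_restrict) auto
      then show "(\<forall>xs\<in>P. walk (perm_restrict \<sigma> ?Y) (map \<phi> xs)) \<longleftrightarrow> (\<forall>xs\<in>P. walk \<sigma> (map \<phi> xs))" by simp
    qed
    let ?Q = "card {\<sigma> \<in> cyc_perms X A. (\<forall>xs\<in>P. walk \<sigma> (map \<phi> xs)) \<and> closed_walk \<sigma> ?ys}"
    have Q: "?Q = card {\<tau> \<in> cyc_perms ?Y A. \<forall>xs\<in>P. walk \<tau> (map \<phi> xs)}"
      using bij_betw_same_card[OF bij] by (simp add: conj_ac)
    have m: "?m \<ge> 1" "n1 \<le> ?m" "?n \<ge> n2" using X(2) by linarith+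
    have 1: "(1 - \<epsilon> / 2) * real ?m ^ card P * num_cyc_perms A ?m \<le> ?Q * real ?m ^ card V"
      using n1[of ?Y \<phi>] cY m phi(1) sub unfolding Q by (simp add: inj_on_Un card_cyc_perms)
    have "real ?m ^ card V = real ?m ^ card P * real ?m ^ (card V - card P)"
      using PV by (simp flip: power_add)
    with 1 have "real ?m ^ card P * ((1 - \<epsilon> / 2) * num_cyc_perms A ?m) \<le>
        real ?m ^ card P * (?Q * real ?m ^ (card V - card P))" by (simp add: mult_ac)
    then have "(1 - \<epsilon> / 2) * num_cyc_perms A ?m \<le> ?Q * real ?m ^ (card V - card P)"
      using m(1) by (simp only: mult_le_cancel_left_pos zero_less_power of_nat_0_less_iff)
    also have "\<dots> \<le> ?Q * real ?n ^ (card V - card P)"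
      by (intro mult_left_mono power_mono) auto
    finally have 2: "(1 - \<epsilon> / 2) * num_cyc_perms A ?m \<le> ?Q * real ?n ^ (card V - card P)" .
    have "(1 - \<epsilon>) * num_cyc_perms A ?n \<le> ((1 - \<epsilon> / 2) * (1 - \<epsilon> / 2)) * num_cyc_perms A ?n"
      by (intro mult_right_mono) (simp_all add: algebra_simps)
    also have "\<dots> = (1 - \<epsilon> / 2) * ((1 - \<epsilon> / 2) * num_cyc_perms A ?n)" by simp
    also have "\<dots> \<le> (1 - \<epsilon> / 2) * (num_cyc_perms A ?m * real ?n ^ ?j)"
      using n2[OF m(3)] True by (intro mult_left_mono) auto
    also have "\<dots> = ((1 - \<epsilon> / 2) * num_cyc_perms A ?m) * real ?n ^ ?j" by simp
    also have "\<dots> \<le> (?Q * real ?n ^ (card V - card P)) * real ?n ^ ?j"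
      using 2 by (intro mult_right_mono) auto
    finally have "real ?n ^ card P * ((1 - \<epsilon>) * num_cyc_perms A ?n) \<le>
        real ?n ^ card P * ((?Q * real ?n ^ (card V - card P)) * real ?n ^ ?j)"
      by (rule mult_left_mono) simp
    also have "\<dots> = ?Q * (real ?n ^ card P * real ?n ^ (card V - card P) * real ?n ^ ?j)"
      by (simp add: mult_ac)
    also have "real ?n ^ card P * real ?n ^ (card V - card P) * real ?n ^ ?j = real ?n ^ card (V \<union> set zs)"
      using PV fV z by (simp add: card_Un_disjoint Int_commute distinct_card flip: power_add)
    finally show "(1 - \<epsilon>) * real (card X) ^ card P * card (cyc_perms X A) \<le>
      ?Q * real (card X) ^ card (V \<union> set zs)"
      using card_cyc_perms[OF X(1), of A] by (simp add: mult_ac)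
  qed
next
  case False
  have "(1 - \<epsilon>) * real a * real b \<le> real q * real r" for a b q r :: nat
  proof -
    have "(1 - \<epsilon>) * (real a * real b) \<le> 0" using False by (intro mult_nonpos_nonneg) auto
    also have "\<dots> \<le> real q * real r" by simp
    finally show ?thesis by simp
  qed
  note nonpos = this
  show ?thesis
  proof (intro exI[of _ 0] allI impI)
    fix X :: "nat set" and \<phi>
    show "(1 - \<epsilon>) * real (card X) ^ card P * card (cyc_perms X A) \<le>
      real (card {\<sigma> \<in> cyc_perms X A. (\<forall>xs\<in>P. walk \<sigma> (map \<phi> xs)) \<and> closed_walk \<sigma> (map \<phi> zs)}) *
      real (card X) ^ card (V \<union> set zs)"
      using nonpos[of "card X ^ card P" _ _ "card X ^ card (V \<union> set zs)"] unfolding of_nat_power .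
  qed
qed

section \<open>Words acting on points\<close>

lemma comp_walk_imp_walk: "comp_walk d s ys \<Longrightarrow> walk s ys"
  by (auto simp: comp_walk_def closed_walk_imp_walk split: if_splits)

lemma walk_eqI:
  assumes "walk s ys" "walk s zs" "inj s" "length ys = length zs" "p < length ys" "ys ! p = zs ! p"
  shows "ys = zs"
proof (rule nth_equalityI)
  fix q assume q: "q < length ys"
  show "ys ! q = zs ! q"
  proof (cases "p \<le> q")
    case True
    then show ?thesis
      using walk_funpow[OF assms(1), of p "q - p"] walk_funpow[OF assms(2), of p "q - p"] assms q by simp
  next
    case False
    then have "(s ^^ (p - q)) (ys ! q) = (s ^^ (p - q)) (zs ! q)"
      using walk_funpow[OF assms(1), of q "p - q"] walk_funpow[OF assms(2), of q "p - q"] assms q by simp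
    then show ?thesis using inj_fn[OF assms(3), of "p - q"] by (simp add: inj_eq)
  qed
qed fact

lemma eval_word_Nil [simp]: "eval_word s [] = id"
  by (simp add: eval_word_def)

lemma eval_word_Cons: "eval_word s (x # u) = eval_letter s x \<circ> eval_word s u"
  by (simp add: eval_word_def)

lemma eval_word_append: "eval_word s (u @ v) = eval_word s u \<circ> eval_word s v"
  by (induction u) (simp_all add: eval_word_Cons comp_assoc)

lemma words_simps [simp]:
  "[] \<in> words k" "x # u \<in> words k \<longleftrightarrow> fst x \<in> {1..k} \<and> u \<in> words k"
  "u @ v \<in> words k \<longleftrightarrow> u \<in> words k \<and> v \<in> words k"
  by (auto simp: words_def mem_Times_iff)

lemma gpow_in_words: "i \<in> {1..k} \<Longrightarrow> gpow i a \<in> words k"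
  by (auto simp: words_def gpow_def)

lemma eval_word_replicate: "eval_word s (replicate n x) = eval_letter s x ^^ n"
  by (induction n) (simp_all add: eval_word_Cons)

lemma eval_word_gpow:
  "eval_word s (gpow i a) = (if 0 \<le> a then s i ^^ nat a else finv (s i) ^^ nat (- a))"
  by (simp add: gpow_def eval_word_replicate eval_letter_def)

lemma permutation_eval_word:
  assumes "\<And>i. i \<in> {1..k} \<Longrightarrow> permutation (s i)" "u \<in> words k"
  shows "permutation (eval_word s u)"
  using assms(2)
proof (induction u)
  case (Cons x u)
  then have "permutation (eval_letter s x)"
    using assms(1) permutation_inverse by (auto simp: eval_letter_def)
  moreover have "permutation (eval_word s u)" using Cons by simp
  ultimately show ?case unfolding eval_word_Cons by (rule permutation_compose)
qed simp

lemma eval_word_permutes: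
  assumes "\<And>i. i \<in> {1..k} \<Longrightarrow> s i permutes X" "u \<in> words k"
  shows "eval_word s u permutes X"
  using assms(2)
proof (induction u)
  case Nil
  then show ?case by (simp add: permutes_id id_def[symmetric])
next
  case (Cons x u)
  then have "eval_letter s x permutes X"
    using assms(1) permutes_inv by (auto simp: eval_letter_def)
  moreover have "eval_word s u permutes X" using Cons by simp
  ultimately show ?case unfolding eval_word_Cons by (rule permutes_compose[rotated])
qed

lemma eval_word_inv_word:
  assumes "\<And>i. i \<in> {1..k} \<Longrightarrow> bij (s i)" "u \<in> words k"
  shows "eval_word s u (eval_word s (inv_word u) x) = x"
  using assms(2)
proof (induction u arbitrary: x)
  case (Cons a u)
  have b: "bij (s (fst a))" using assms(1) Cons.prems by simp
  have "eval_letter s a (eval_letter s (inv_letter a) y) = y" for y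
    using b by (simp add: eval_letter_def inv_letter_def surj_f_inv_f bij_is_surj inv_f_f bij_is_inj)
  moreover have "inv_word (a # u) = inv_word u @ [inv_letter a]" by (simp add: inv_word_def)
  ultimately show ?case using Cons by (simp add: eval_word_append eval_word_Cons)
qed (simp add: inv_word_def)

lemma eval_word_cong:
  assumes "\<And>i. i \<in> {1..k} \<Longrightarrow> s i = s' i" "u \<in> words k"
  shows "eval_word s u = eval_word s' u"
  using assms(2) by (induction u) (simp_all add: eval_word_Cons eval_letter_def assms(1))

lemma finv_funpow_fixed:
  fixes f :: "'a \<Rightarrow> 'a"
  assumes "bij f" "(f ^^ n) x = y"
  shows "(finv f ^^ n) y = x"
  using assms(2)
proof (induction n arbitrary: y)
  case (Suc n)
  have "finv f y = (f ^^ n) x"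
    unfolding Suc.prems[symmetric] by (simp add: inv_f_f[OF bij_is_inj[OF assms(1)]])
  then have "(finv f ^^ n) (finv f y) = x"
    using Suc.IH by simp
  then show ?case by (simp add: funpow_swap1)
qed simp

lemma walk_gpow:
  assumes "walk (s i) ys" "bij (s i)" "p < length ys" "q < length ys"
  shows "eval_word s (gpow i (int q - int p)) (ys ! p) = ys ! q"
proof (cases "p \<le> q")
  case True
  then show ?thesis using walk_funpow[OF assms(1), of p "q - p"] assms by (simp add: eval_word_gpow nat_diff_distrib)
next
  case False
  then have "(s i ^^ (p - q)) (ys ! q) = ys ! p" using walk_funpow[OF assms(1), of q "p - q"] assms by simp
  from finv_funpow_fixed[OF assms(2) this] show ?thesis
    using False by (simp add: eval_word_gpow nat_diff_distrib)
qed

lemma closed_walk_gpow: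
  assumes "closed_walk (s i) ys" "bij (s i)" "y \<in> set ys"
  shows "eval_word s (gpow i (a * int (length ys))) y = y"
proof -
  obtain t where t: "t < length ys" "y = ys ! t" using assms(3) by (auto simp: in_set_conv_nth)
  have f: "(s i ^^ (n * length ys)) y = y" for n
    using closed_walk_funpow[OF assms(1) t(1)] t by simp
  have "nat \<bar>a * int (length ys)\<bar> = nat \<bar>a\<bar> * length ys" by (simp add: abs_mult nat_mult_distrib)
  then have *: "(s i ^^ nat \<bar>a * int (length ys)\<bar>) y = y" using f by simp
  then show ?thesis using finv_funpow_fixed[OF assms(2) *] by (auto simp: eval_word_gpow abs_if split: if_splits)
qed

section \<open>Coloured graphs\<close>

text \<open>The list \<open>Z i\<close>, if nonempty, is a distinguished cycle of a colour with unbounded cycle lengths. It is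
needed when the word reduces to a power of one generator, and empty otherwise.\<close>

locale coloured =
  fixes k :: nat and d :: "nat \<Rightarrow> enat" and Z :: "nat \<Rightarrow> nat list"
  assumes d_ge_2: "i \<in> {1..k} \<Longrightarrow> 2 \<le> d i"
    and Z_infinite: "i \<in> {1..k} \<Longrightarrow> Z i \<noteq> [] \<Longrightarrow> d i = \<infinity>"
    and distinct_Z: "i \<in> {1..k} \<Longrightarrow> distinct (Z i)"
begin

text \<open>A coloured graph: for each colour \<open>i\<close>, the vertices outside \<open>Z i\<close> are partitioned into
the lists in \<open>C i\<close>. A list of length \<open>1\<close> is a vertex without edges of colour \<open>i\<close>; if \<open>d i\<close> is finite,
every other list is a full cycle, so that \<open>d i\<close> steps of colour \<open>i\<close> along it return to the start.\<close>

definition graph :: "nat set \<Rightarrow> (nat \<Rightarrow> nat list set) \<Rightarrow> bool" where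
  "graph V C \<longleftrightarrow> finite V \<and> (\<forall>i\<in>{1..k}. finite (C i) \<and> set (Z i) \<subseteq> V \<and>
    (\<forall>xs\<in>C i. xs \<noteq> [] \<and> distinct xs \<and> (length xs = 1 \<or> d i = \<infinity> \<or> enat (length xs) = d i)) \<and>
    disjoint_family_on set (C i) \<and> (\<Union>xs\<in>C i. set xs) = V - set (Z i))"

text \<open>The exponent of \<open>n\<close> in the expected number of embeddings into the graph of random permutations. A
distinguished cycle \<open>Z i\<close> is not counted as a component.\<close>

definition euler :: "nat set \<Rightarrow> (nat \<Rightarrow> nat list set) \<Rightarrow> int" where
  "euler V C = int (card V) + (\<Sum>i\<in>{1..k}. int (card (C i)) - int (card V))"

text \<open>The injection \<open>\<phi>\<close> embeds the coloured graph into the graph of the permutations \<open>s i\<close>.\<close>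

definition model :: "nat set \<Rightarrow> (nat \<Rightarrow> nat list set) \<Rightarrow> (nat \<Rightarrow> nat \<Rightarrow> nat) \<Rightarrow> (nat \<Rightarrow> nat) \<Rightarrow> bool" where
  "model V C s \<phi> \<longleftrightarrow> inj_on \<phi> V \<and> (\<forall>i\<in>{1..k}. permutation (s i) \<and>
    (\<forall>xs\<in>C i. comp_walk (d i) (s i) (map \<phi> xs)) \<and> closed_walk (s i) (map \<phi> (Z i)))"

text \<open>Reading \<open>u\<close> from right to left, as for composition of functions, leads from \<open>x\<close> to \<open>y\<close> in every
embedding.\<close>

definition reach :: "nat set \<Rightarrow> (nat \<Rightarrow> nat list set) \<Rightarrow> nat \<Rightarrow> word \<Rightarrow> nat \<Rightarrow> bool" where
  "reach V C x u y \<longleftrightarrow> x \<in> V \<and> y \<in> V \<and> (\<forall>s \<phi>. model V C s \<phi> \<longrightarrow> eval_word s u (\<phi> x) = \<phi> y)"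

text \<open>A substitute for connectedness: an embedding is determined by the image of \<open>b\<close>.\<close>

definition determined :: "nat set \<Rightarrow> (nat \<Rightarrow> nat list set) \<Rightarrow> nat \<Rightarrow> bool" where
  "determined V C b \<longleftrightarrow> b \<in> V \<and>
    (\<forall>s \<phi> \<phi>'. model V C s \<phi> \<longrightarrow> model V C s \<phi>' \<longrightarrow> \<phi> b = \<phi>' b \<longrightarrow> (\<forall>v\<in>V. \<phi> v = \<phi>' v))"

definition extends :: "nat set \<Rightarrow> (nat \<Rightarrow> nat list set) \<Rightarrow> nat set \<Rightarrow> (nat \<Rightarrow> nat list set) \<Rightarrow> bool" where
  "extends V C V' C' \<longleftrightarrow> graph V' C' \<and> V \<subseteq> V' \<and>
    (\<forall>s \<phi>. model V' C' s \<phi> \<longrightarrow> model V C s \<phi>) \<and> (\<forall>b. determined V C b \<longrightarrow> determined V' C' b)"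

lemma extends_refl: "graph V C \<Longrightarrow> extends V C V C"
  by (simp add: extends_def)

lemma extends_trans: "extends V C V' C' \<Longrightarrow> extends V' C' V'' C'' \<Longrightarrow> extends V C V'' C''"
  by (auto simp: extends_def)

lemma extends_graph: "extends V C V' C' \<Longrightarrow> graph V' C'"
  by (simp add: extends_def)

lemma reach_extends: "reach V C x u y \<Longrightarrow> extends V C V' C' \<Longrightarrow> reach V' C' x u y"
  by (auto simp: extends_def reach_def)

lemma reach_append: "reach V C x u y \<Longrightarrow> reach V C y v z \<Longrightarrow> reach V C x (v @ u) z"
  by (auto simp: reach_def eval_word_append)

lemma model_bij: "model V C s \<phi> \<Longrightarrow> i \<in> {1..k} \<Longrightarrow> bij (s i)"
  by (auto simp: model_def permutation_bijective)

lemma model_walk: "model V C s \<phi> \<Longrightarrow> i \<in> {1..k} \<Longrightarrow> xs \<in> C i \<Longrightarrow> walk (s i) (map \<phi> xs)"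
  unfolding model_def using comp_walk_imp_walk by blast

lemma model_closed_walk:
  assumes "model V C s \<phi>" "i \<in> {1..k}" "xs \<in> C i" "enat (length xs) = d i"
  shows "closed_walk (s i) (map \<phi> xs)"
proof -
  have "comp_walk (d i) (s i) (map \<phi> xs)" using assms(1-3) unfolding model_def by blast
  then show ?thesis using assms(4) by (simp add: comp_walk_def)
qed

lemma graphD:
  assumes "graph V C" "i \<in> {1..k}"
  shows "finite (C i)" "set (Z i) \<subseteq> V" "disjoint_family_on set (C i)"
    "(\<Union>ys\<in>C i. set ys) = V - set (Z i)"
    "ys \<in> C i \<Longrightarrow> ys \<noteq> []" "ys \<in> C i \<Longrightarrow> distinct ys" "ys \<in> C i \<Longrightarrow> set ys \<subseteq> V"
    "ys \<in> C i \<Longrightarrow> length ys = 1 \<or> d i = \<infinity> \<or> enat (length ys) = d i"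
proof -
  note D = bspec[OF conjunct2[OF assms(1)[unfolded graph_def]] assms(2)]
  then show "finite (C i)" "set (Z i) \<subseteq> V" "disjoint_family_on set (C i)"
    and U: "(\<Union>ys\<in>C i. set ys) = V - set (Z i)" by (simp_all only:)
  show "ys \<in> C i \<Longrightarrow> ys \<noteq> []" "ys \<in> C i \<Longrightarrow> distinct ys"
    "ys \<in> C i \<Longrightarrow> length ys = 1 \<or> d i = \<infinity> \<or> enat (length ys) = d i"
    using D by blast+
  show "ys \<in> C i \<Longrightarrow> set ys \<subseteq> V" using U by blast
qed

lemma reach_component:
  assumes "graph V C" "i \<in> {1..k}" "xs \<in> C i" "p < length xs" "q < length xs"
  shows "reach V C (xs ! p) (gpow i (int q - int p)) (xs ! q)"
proof -
  have "set xs \<subseteq> V" using graphD(7)[OF assms(1-3)] .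
  moreover have "eval_word s (gpow i (int q - int p)) (\<phi> (xs ! p)) = \<phi> (xs ! q)" if "model V C s \<phi>" for s \<phi>
    using walk_gpow[where s = s and i = i, OF model_walk[OF that assms(2,3)] model_bij[OF that assms(2)], of p q]
      assms(4,5) by simp
  ultimately show ?thesis using assms(4,5) nth_mem by (fastforce simp: reach_def)
qed

text \<open>The only way in which graphs are modified: the components in \<open>Q\<close> are replaced by one longer
component, which may have new vertices. A new vertex counts once for itself, is isolated in the other
\<open>k - 1\<close> colours, and enlarges \<open>|V|\<close> in all \<open>k\<close> colours, so that the Euler characteristic only
changes by the merging. An old vertex on the new component determines the new vertices.\<close>

lemma merge_components:
  assumes G: "graph V C" and i: "i \<in> {1..k}" and Q: "Q \<subseteq> C i" "Q \<noteq> {}"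
    and xs: "distinct xs" "set xs \<inter> V = (\<Union>ys\<in>Q. set ys)"
      "d i = \<infinity> \<or> enat (length xs) = d i"
    and sub: "\<And>(s :: nat \<Rightarrow> nat) (\<phi> :: nat \<Rightarrow> nat) ys. comp_walk (d i) s (map \<phi> xs) \<Longrightarrow> ys \<in> Q \<Longrightarrow> comp_walk (d i) s (map \<phi> ys)"
  obtains V' C' where "extends V C V' C'" "euler V' C' = euler V C + 1 - int (card Q)"
    "V' = V \<union> set xs" "xs \<in> C' i" "C i - Q \<subseteq> C' i"
    "\<And>j. j \<in> {1..k} \<Longrightarrow> j \<noteq> i \<Longrightarrow> C j \<union> (\<lambda>v. [v]) ` (set xs - V) \<subseteq> C' j"
proof -
  define V' where "V' = V \<union> set xs"
  define N where "N = set xs - V"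
  define C' where "C' j = (if j = i then insert xs (C i - Q) else C j \<union> (\<lambda>v. [v]) ` N)" for j
  have fV: "finite V" using G by (simp add: graph_def)
  note Gi = graphD(1)[OF G] graphD(2)[OF G] graphD(3)[OF G] graphD(4)[OF G]
  note Gc = graphD(5,6,8)[OF G]
  obtain ys0 where ys0: "ys0 \<in> Q" using Q(2) by blast
  have "ys0 \<noteq> []" using Gc(1)[OF i] ys0 Q(1) by blast
  then have "hd ys0 \<in> set xs \<inter> V" using xs(2) ys0 hd_in_set by blast
  then obtain p where p: "p < length xs" "xs ! p \<in> V" by (metis IntE in_set_conv_nth)
  have ne: "xs \<noteq> []" using p by auto
  have disjQ: "set ys \<inter> set zs = {}" if "ys \<in> C i - Q" "zs \<in> Q" for ys zs
    using disjoint_family_onD[OF Gi(3)[OF i], of ys zs] that Q(1) by auto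
  have disjxs: "set ys \<inter> set xs = {}" if "ys \<in> C i - Q" for ys
  proof -
    have "set ys \<subseteq> V" using graphD(7)[OF G i, of ys] that by simp
    then have "set ys \<inter> set xs = set ys \<inter> (set xs \<inter> V)" by blast
    then have "set ys \<inter> set xs = set ys \<inter> (\<Union>zs\<in>Q. set zs)" unfolding xs(2) .
    then show ?thesis using disjQ[OF that] by blast
  qed
  have xsnot: "xs \<notin> C i - Q" using disjxs ne by (metis Int_absorb set_empty)
  have graph': "graph V' C'"
    unfolding graph_def
  proof (intro conjI ballI)
    show "finite V'" using fV by (simp add: V'_def)
    fix j assume j: "j \<in> {1..k}"
    show "finite (C' j)" using Gi(1)[OF j] by (auto simp: C'_def N_def)
    show "set (Z j) \<subseteq> V'" using Gi(2)[OF j] by (auto simp: V'_def)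
    show "disjoint_family_on set (C' j)"
    proof (cases "j = i")
      case True
      have "disjoint_family_on set (C i - Q)" using Gi(3)[OF i] by (auto simp: disjoint_family_on_def)
      then show ?thesis using True disjxs by (auto simp: C'_def disjoint_family_on_def Int_commute)
    next
      case False
      have "set ys \<inter> N = {}" if "ys \<in> C j" for ys using Gi(4)[OF j] that by (auto simp: N_def)
      show ?thesis
        unfolding disjoint_family_on_def
      proof (intro ballI impI)
        fix ys zs assume "ys \<in> C' j" "zs \<in> C' j" and ne: "ys \<noteq> zs"
        then have "ys \<in> C j \<or> (\<exists>v\<in>N. ys = [v])" "zs \<in> C j \<or> (\<exists>v\<in>N. zs = [v])"
          using False by (auto simp: C'_def)
        then show "set ys \<inter> set zs = {}"
          using disjoint_family_onD[OF Gi(3)[OF j] _ _ ne] \<open>\<And>ys. ys \<in> C j \<Longrightarrow> set ys \<inter> N = {}\<close>[of ys]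
            \<open>\<And>ys. ys \<in> C j \<Longrightarrow> set ys \<inter> N = {}\<close>[of zs] ne by auto
      qed
    qed
    show "(\<Union>ys\<in>C' j. set ys) = V' - set (Z j)"
    proof (cases "j = i")
      case True
      have split: "(\<Union>ys\<in>C i. set ys) = (\<Union>ys\<in>C i - Q. set ys) \<union> (\<Union>ys\<in>Q. set ys)" using Q(1) by blast
      have xsZ: "set xs \<inter> set (Z i) = {}"
      proof -
        have "set xs \<inter> set (Z i) \<subseteq> set xs \<inter> V" using Gi(2)[OF i] by blast
        moreover have "(\<Union>ys\<in>Q. set ys) \<subseteq> (\<Union>ys\<in>C i. set ys)" using Q(1) by (rule UN_mono) simp
        ultimately show ?thesis unfolding Gi(4)[OF i] xs(2) by blast
      qed
      have "U \<union> X = (V \<union> X) - Y" if "T = U \<union> W" "X \<inter> Y = {}" "T = V - Y" "X \<inter> V = W"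
        for U X Y W T :: "nat set"
        using that by auto
      from this[OF split xsZ Gi(4)[OF i] xs(2)]
      have "(\<Union>ys\<in>C i - Q. set ys) \<union> set xs = (V \<union> set xs) - set (Z i)" .
      then show ?thesis using True by (auto simp: C'_def V'_def)
    next
      case False
      have "N \<inter> set (Z j) = {}" using Gi(2)[OF j] by (auto simp: N_def)
      then have "(\<Union>ys\<in>C j. set ys) \<union> N = V \<union> set xs - set (Z j)"
        using Gi(4)[OF j] by (auto simp: N_def)
      then show ?thesis using False by (auto simp: C'_def V'_def)
    qed
    fix ys assume ys: "ys \<in> C' j"
    have "ys = xs \<and> j = i \<or> ys \<in> C j \<or> (\<exists>v. ys = [v])" using ys by (auto simp: C'_def split: if_splits)
    then have "ys \<noteq> [] \<and> distinct ys \<and> (length ys = 1 \<or> d j = \<infinity> \<or> enat (length ys) = d j)"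
      using xs(1,3) ne Gc[OF j, of ys] by auto
    then show "ys \<noteq> []" "distinct ys" "length ys = 1 \<or> d j = \<infinity> \<or> enat (length ys) = d j" by blast+
  qed
  have mod: "model V C s \<phi>" if m: "model V' C' s \<phi>" for s \<phi>
  proof -
    have "comp_walk (d j) (s j) (map \<phi> ys)" if "j \<in> {1..k}" "ys \<in> C j" for j ys
    proof (cases "j = i \<and> ys \<in> Q")
      case True
      have "comp_walk (d i) (s i) (map \<phi> xs)" using m i by (auto simp: model_def C'_def)
      from sub[OF this] show ?thesis using True by simp
    next
      case False
      then have "ys \<in> C' j" using that by (auto simp: C'_def)
      then show ?thesis using m that(1) by (auto simp: model_def)
    qed
    moreover have "inj_on \<phi> V" using m by (auto simp: model_def V'_def intro: inj_on_subset)
    ultimately show ?thesis using m by (auto simp: model_def)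
  qed
  have det: "determined V' C' b" if D: "determined V C b" for b
    unfolding determined_def
  proof (intro conjI allI impI ballI)
    show "b \<in> V'" using D by (simp add: determined_def V'_def)
    fix s \<phi> \<phi>' v assume m: "model V' C' s \<phi>" "model V' C' s \<phi>'" "\<phi> b = \<phi>' b" and v: "v \<in> V'"
    have old: "\<phi> u = \<phi>' u" if "u \<in> V" for u
      using D mod[OF m(1)] mod[OF m(2)] m(3) that by (auto simp: determined_def)
    have xsC: "xs \<in> C' i" by (simp add: C'_def)
    have "map \<phi> xs = map \<phi>' xs"
      using p old by (intro walk_eqI[OF model_walk[OF m(1) i xsC] model_walk[OF m(2) i xsC], of p]
        bij_is_inj[OF model_bij[OF m(1) i]]) auto
    then show "\<phi> v = \<phi>' v" using v old by (auto simp: V'_def)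
  qed
  have ext: "extends V C V' C'" using graph' mod det by (auto simp: extends_def V'_def)
  have cardV: "card V' = card V + card N"
  proof -
    have "card (V \<union> N) = card V + card N" by (rule card_Un_disjoint) (use fV in \<open>auto simp: N_def\<close>)
    moreover have "V' = V \<union> N" by (auto simp: V'_def N_def)
    ultimately show ?thesis by (simp only:)
  qed
  have finQ: "finite Q" using Q(1) Gi(1)[OF i] finite_subset by blast
  have ci: "int (card (C' i)) = int (card (C i)) + 1 - int (card Q)"
  proof -
    have "card Q \<le> card (C i)" using Q(1) Gi(1)[OF i] by (rule card_mono[rotated])
    then show ?thesis
      using Gi(1)[OF i] xsnot Q(1) finQ by (simp add: C'_def card_Diff_subset of_nat_diff)
  qed
  have cj: "card (C' j) = card (C j) + card N" if "j \<in> {1..k}" "j \<noteq> i" for j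
  proof -
    have "C j \<inter> (\<lambda>v. [v]) ` N = {}" using graphD(7)[OF G that(1)] by (fastforce simp: N_def)
    moreover have "card ((\<lambda>v. [v]) ` N) = card N" by (rule card_image) (simp add: inj_on_def)
    ultimately show ?thesis using that(2) Gi(1)[OF that(1)] by (simp add: C'_def card_Un_disjoint N_def)
  qed
  have eul: "euler V' C' = euler V C + 1 - int (card Q)"
  proof -
    have rem: "sum f {1..k} = f i + sum f ({1..k} - {i})" for f :: "nat \<Rightarrow> int"
      using i by (intro sum.remove) auto
    have "(\<Sum>j\<in>{1..k}. int (card (C' j)) - int (card V')) =
        (int (card (C' i)) - int (card V')) + (\<Sum>j\<in>{1..k} - {i}. int (card (C' j)) - int (card V'))"
      by (rule rem)
    also have "(\<Sum>j\<in>{1..k} - {i}. int (card (C' j)) - int (card V')) =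
        (\<Sum>j\<in>{1..k} - {i}. int (card (C j)) - int (card V))"
      using cj cardV by (intro sum.cong) auto
    also have "(int (card (C' i)) - int (card V')) + \<dots> =
        (int (card (C i)) - int (card V)) + (\<Sum>j\<in>{1..k} - {i}. int (card (C j)) - int (card V)) +
          1 - int (card Q) - int (card N)"
      using ci cardV by simp
    also have "(int (card (C i)) - int (card V)) + (\<Sum>j\<in>{1..k} - {i}. int (card (C j)) - int (card V)) =
        (\<Sum>j\<in>{1..k}. int (card (C j)) - int (card V))"
      by (rule rem[symmetric])
    finally show ?thesis by (simp add: euler_def cardV)
  qed
  show ?thesis
    by (rule that[of V' C', OF ext eul]) (auto simp: V'_def C'_def N_def)
qed

end

section \<open>Following a word in a coloured graph\<close>

lemma fresh_list:
  assumes "finite (V :: nat set)"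
  obtains F where "length F = L" "distinct F" "set F \<inter> V = {}"
proof -
  obtain m where "\<forall>v\<in>V. v < m" using assms finite_nat_set_iff_bounded by auto
  then have "set [m..<m + L] \<inter> V = {}" by auto
  then show ?thesis using that[of "[m..<m + L]"] by simp
qed

lemma walk_append_left:
  assumes "walk s (ys @ zs)"
  shows "walk s ys"
  unfolding walk_def
proof (intro allI impI)
  fix t assume "Suc t < length ys"
  then show "s (ys ! t) = ys ! Suc t"
    using assms[unfolded walk_def, rule_format, of t] by (simp add: nth_append)
qed

lemma walk_tl: "walk s (z # ys) \<Longrightarrow> walk s ys"
  unfolding walk_def by (metis Suc_less_eq length_Cons nth_Cons_Suc)

lemma comp_walk_singleton: "d \<noteq> enat 1 \<Longrightarrow> comp_walk d s [y]"
  by (auto simp: comp_walk_def walk_def one_enat_def)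

lemma card_orbit_eqI:
  assumes "permutation f" "l > 0" "(f ^^ l) x = x" "\<And>t. 0 < t \<Longrightarrow> t < l \<Longrightarrow> (f ^^ t) x \<noteq> x"
  shows "card (orbit f x) = l"
proof -
  obtain S where S: "f permutes S" "finite S" using assms(1) permutation_permutes by blast
  let ?c = "card (orbit f x)"
  have "orbit f x = (\<lambda>m. (f ^^ m) x) ` {..<l}" using orbit_altdef_bounded[OF assms(3,2)] by auto
  then have "?c \<le> l" using card_image_le[of "{..<l}" "\<lambda>m. (f ^^ m) x"] by simp
  moreover have "?c > 0"
    using orbit_nonempty finite_orbit[OF permutation_self_in_orbit[OF assms(1)]] by (simp add: card_gt_0_iff)
  ultimately show ?thesis using orbit_period(1)[OF S, of x] assms(4)[of ?c] by force
qed

context coloured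
begin

lemma d_neq_1: "i \<in> {1..k} \<Longrightarrow> d i \<noteq> enat 1"
proof
  assume i: "i \<in> {1..k}" and "d i = enat 1"
  then have "enat 2 \<le> enat 1" using d_ge_2[OF i] by (simp add: numeral_eq_enat)
  then show False by simp
qed

lemma vertex_in_component:
  assumes "graph V C" "i \<in> {1..k}" "x \<in> V" "x \<notin> set (Z i)"
  obtains xs p where "xs \<in> C i" "p < length xs" "x = xs ! p"
proof -
  have "x \<in> (\<Union>ys\<in>C i. set ys)" using graphD(4)[OF assms(1,2)] assms(3,4) by simp
  then show ?thesis using that by (auto simp: in_set_conv_nth)
qed

text \<open>Hanging a full cycle of length \<open>d i\<close> on a vertex without edges of colour \<open>i\<close> adds \<open>d i - 1\<close> vertices and
no loop of components, so the Euler characteristic stays the same.\<close>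

lemma complete_component:
  assumes G: "graph V C" and i: "i \<in> {1..k}" and m: "d i = enat m" and x: "x \<in> V"
  shows "\<exists>V' C' xs. extends V C V' C' \<and> euler V' C' = euler V C \<and> xs \<in> C' i \<and> x \<in> set xs \<and> length xs = m"
proof -
  have "Z i = []" using Z_infinite[OF i] m by auto
  then obtain xs p where xs: "xs \<in> C i" "p < length xs" "x = xs ! p"
    using vertex_in_component[OF G i x] by auto
  show ?thesis
  proof (cases "length xs = m")
    case True
    then show ?thesis using xs extends_refl[OF G] nth_mem by blast
  next
    case False
    then have "length xs = 1" using graphD(8)[OF G i xs(1)] m by auto
    then have x1: "xs = [x]" using xs by (cases xs) auto
    have xC: "[x] \<in> C i" using xs(1) unfolding x1 .
    have m2: "m \<ge> 2" using d_ge_2[OF i] m by (simp add: numeral_eq_enat)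
    obtain F where F: "length F = m - 1" "distinct F" "set F \<inter> V = {}"
      using fresh_list[of V "m - 1"] G by (auto simp: graph_def)
    obtain V' C' where "extends V C V' C'" "euler V' C' = euler V C + 1 - int (card {[x]})" "x # F \<in> C' i"
    proof (rule merge_components[OF G i, of "{[x]}" "x # F"])
      show "comp_walk (d i) s (map \<phi> ys)" if "ys \<in> {[x]}" for s ys and \<phi> :: "nat \<Rightarrow> nat"
        using that comp_walk_singleton[OF d_neq_1[OF i]] by auto
    qed (use xC F x m m2 in auto)
    then show ?thesis using F(1) m2 by (intro exI[of _ V'] exI[of _ C'] exI[of _ "x # F"]) auto
  qed
qed

lemma reach_letter_closed:
  assumes "i \<in> {1..k}" "set ys \<subseteq> V" "\<And>s \<phi>. model V C s \<phi> \<Longrightarrow> closed_walk (s i) (map \<phi> ys)"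
    and "x \<in> set ys"
  shows "\<exists>y. reach V C x [(i, b)] y"
proof -
  let ?m = "length ys"
  obtain p where p: "p < ?m" "x = ys ! p" using assms(4) by (auto simp: in_set_conv_nth)
  show ?thesis
  proof (cases b)
    case True
    have "s i (\<phi> x) = \<phi> (ys ! (Suc p mod ?m))" if "model V C s \<phi>" for s \<phi>
      using assms(3)[OF that] p unfolding closed_walk_def by (metis length_map mod_less_divisor nth_map order_less_trans neq0_conv not_less_zero)
    moreover have "Suc p mod ?m < ?m" using p by (intro mod_less_divisor) auto
    ultimately have "reach V C x [(i, b)] (ys ! (Suc p mod ?m))"
      using assms(2,4) True nth_mem[of "Suc p mod ?m" ys] by (auto simp: reach_def eval_word_Cons eval_letter_def)
    then show ?thesis ..
  next
    case False
    \<comment> \<open>The predecessor of \<open>p\<close> in the cyclic order.\<close>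
    define q where "q = (p + ?m - 1) mod ?m"
    have q: "q < ?m" using p unfolding q_def by (intro mod_less_divisor) auto
    have "Suc q mod ?m = Suc (p + ?m - 1) mod ?m" unfolding q_def by (simp add: mod_Suc_eq)
    also have "Suc (p + ?m - 1) = p + ?m" using p by linarith
    also have "(p + ?m) mod ?m = p" using p by simp
    finally have sq: "Suc q mod ?m = p" .
    have "finv (s i) (\<phi> x) = \<phi> (ys ! q)" if m: "model V C s \<phi>" for s \<phi>
    proof -
      have "s i (\<phi> (ys ! q)) = \<phi> x"
        using assms(3)[OF m] p q sq unfolding closed_walk_def by (metis length_map nth_map)
      then show ?thesis using inv_f_f[OF bij_is_inj[OF model_bij[OF m assms(1)]]] by metis
    qed
    then have "reach V C x [(i, b)] (ys ! q)"
      using assms(2,4) False nth_mem[OF q] by (auto simp: reach_def eval_word_Cons eval_letter_def)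
    then show ?thesis ..
  qed
qed

lemma gpow_1: "gpow i 1 = [(i, True)]" and gpow_neg_1: "gpow i (- 1) = [(i, False)]"
  by (simp_all add: gpow_def)

lemma reach_letter:
  assumes G: "graph V C" and i: "i \<in> {1..k}" and x: "x \<in> V"
  shows "\<exists>V' C' y. extends V C V' C' \<and> euler V' C' = euler V C \<and> reach V' C' x [(i, b)] y"
proof (cases "d i")
  case (enat m)
  obtain V' C' xs where *: "extends V C V' C'" "euler V' C' = euler V C" "xs \<in> C' i" "x \<in> set xs" "length xs = m"
    using complete_component[OF G i enat x] by blast
  have "\<exists>y. reach V' C' x [(i, b)] y"
    using model_closed_walk[where C = C' and xs = xs, OF _ i *(3)] *(5) enat
    by (intro reach_letter_closed[OF i graphD(7)[OF extends_graph[OF *(1)] i *(3)] _ *(4)]) auto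
  then show ?thesis using * by blast
next
  case infinity
  show ?thesis
  proof (cases "x \<in> set (Z i)")
    case True
    have "\<exists>y. reach V C x [(i, b)] y"
      using i by (intro reach_letter_closed[OF i graphD(2)[OF G i] _ True]) (auto simp: model_def)
    then show ?thesis using extends_refl[OF G] by blast
  next
    case False
    then obtain xs p where xs: "xs \<in> C i" "p < length xs" "x = xs ! p"
      using vertex_in_component[OF G i x] by blast
    have xsV: "set xs \<subseteq> V" "distinct xs" using graphD(7,6)[OF G i xs(1)] .
    obtain F where F: "length F = 1" "distinct F" "set F \<inter> V = {}"
      using fresh_list[of V 1] G by (auto simp: graph_def)
    then obtain z where z: "z \<notin> V" by (cases F) auto
    show ?thesis
    proof (cases b)
      case True
      show ?thesis
      proof (cases "Suc p < length xs")
        case lt: True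
        then have "reach V C x [(i, b)] (xs ! Suc p)"
          using reach_component[OF G i xs(1), of p "Suc p"] True xs by (simp add: gpow_1)
        then show ?thesis using extends_refl[OF G] by blast
      next
        case False
        obtain V' C' where *: "extends V C V' C'" "euler V' C' = euler V C + 1 - int (card {xs})" "xs @ [z] \<in> C' i"
        proof (rule merge_components[OF G i, of "{xs}" "xs @ [z]"])
          show "comp_walk (d i) s (map \<phi> ys)" if "comp_walk (d i) s (map \<phi> (xs @ [z]))" "ys \<in> {xs}" for s ys and \<phi> :: "nat \<Rightarrow> nat"
            using that walk_append_left[of s "map \<phi> xs" "[\<phi> z]"]
            by (simp add: infinity comp_walk_infinity)
        qed (use xs xsV z infinity in auto)
        have "reach V' C' x (gpow i (int (Suc p) - int p)) z"
          using reach_component[OF extends_graph[OF *(1)] i *(3), of p "Suc p"] xs False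
          by (simp add: nth_append split: if_splits)
        then have "reach V' C' x [(i, b)] z" using True by (simp add: gpow_1)
        then show ?thesis using * by auto
      qed
    next
      case b: False
      show ?thesis
      proof (cases "p > 0")
        case True
        then have "reach V C x (gpow i (int (p - 1) - int p)) (xs ! (p - 1))"
          using reach_component[OF G i xs(1), of p "p - 1"] xs by simp
        then have "reach V C x [(i, b)] (xs ! (p - 1))"
          using True b by (simp add: of_nat_diff gpow_neg_1)
        then show ?thesis using extends_refl[OF G] by blast
      next
        case False
        obtain V' C' where *: "extends V C V' C'" "euler V' C' = euler V C + 1 - int (card {xs})" "z # xs \<in> C' i"
        proof (rule merge_components[OF G i, of "{xs}" "z # xs"])
          show "comp_walk (d i) s (map \<phi> ys)" if "comp_walk (d i) s (map \<phi> (z # xs))" "ys \<in> {xs}" for s ys and \<phi> :: "nat \<Rightarrow> nat"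
            using that walk_tl[of s "\<phi> z" "map \<phi> xs"] by (simp add: infinity comp_walk_infinity)
        qed (use xs xsV z infinity in auto)
        have "reach V' C' x (gpow i (int 0 - int 1)) z"
          using reach_component[OF extends_graph[OF *(1)] i *(3), of 1 0] xs False by simp
        then have "reach V' C' x [(i, b)] z" using b by (simp add: gpow_neg_1)
        then show ?thesis using * by auto
      qed
    qed
  qed
qed

text \<open>Following a word along new edges does not change the Euler characteristic.\<close>

lemma reach_word:
  assumes "graph V C" "x \<in> V" "u \<in> words k"
  shows "\<exists>V' C' y. extends V C V' C' \<and> euler V' C' = euler V C \<and> reach V' C' x u y"
  using assms(3)
proof (induction u)
  case Nil
  have "reach V C x [] x" using assms(2) by (simp add: reach_def)
  then show ?case using extends_refl[OF assms(1)] by blast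
next
  case (Cons a u)
  then obtain V' C' y where 1: "extends V C V' C'" "euler V' C' = euler V C" "reach V' C' x u y" by auto
  have "y \<in> V'" using 1(3) by (simp add: reach_def)
  then obtain V'' C'' z where 2: "extends V' C' V'' C''" "euler V'' C'' = euler V' C'" "reach V'' C'' y [(fst a, snd a)] z"
    using reach_letter[OF extends_graph[OF 1(1)], of "fst a" y "snd a"] Cons.prems by auto
  have "reach V'' C'' y [a] z" using 2(3) by simp
  from reach_append[OF reach_extends[OF 1(3) 2(1)] this] have "reach V'' C'' x ([a] @ u) z" .
  then show ?case using extends_trans[OF 1(1) 2(1)] 1(2) 2(2) by auto
qed

lemma reach_torsion:
  assumes "graph V C" "i \<in> {1..k}" "d i = enat m" "x \<in> V"
  shows "\<exists>V' C'. extends V C V' C' \<and> euler V' C' = euler V C \<and> reach V' C' x (gpow i (a * int m)) x"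
proof -
  obtain V' C' xs where *: "extends V C V' C'" "euler V' C' = euler V C" "xs \<in> C' i" "x \<in> set xs" "length xs = m"
    using complete_component[OF assms] by blast
  have "eval_word s (gpow i (a * int m)) (\<phi> x) = \<phi> x" if M: "model V' C' s \<phi>" for s \<phi>
  proof -
    have "closed_walk (s i) (map \<phi> xs)" using model_closed_walk[OF M assms(2) *(3)] *(5) assms(3) by simp
    from closed_walk_gpow[where s = s and i = i, OF this model_bij[OF M assms(2)], of "\<phi> x" a] show ?thesis using *(4,5) by simp
  qed
  moreover have "x \<in> V'" using * assms(4) by (auto simp: extends_def)
  ultimately have "reach V' C' x (gpow i (a * int m)) x" by (simp add: reach_def)
  then show ?thesis using * by blast
qed

end

section \<open>Graphs of words in syllables\<close>

definition syllable_word :: "(nat \<times> int) list \<Rightarrow> word" where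
  "syllable_word ts = concat (map (\<lambda>(i, a). gpow i a) ts)"

lemma syllable_word_simps [simp]:
  "syllable_word [] = []" "syllable_word ((i, a) # ts) = gpow i a @ syllable_word ts"
  "syllable_word (ts @ us) = syllable_word ts @ syllable_word us"
  by (simp_all add: syllable_word_def)

text \<open>Two positions at signed distance \<open>a\<close> in a list that is allowed as a component: a full cycle if \<open>d\<close>
is finite, a path with \<open>|a|\<close> edges otherwise.\<close>

lemma syllable_position:
  fixes a :: int
  assumes "a \<noteq> 0" "enat (nat \<bar>a\<bar>) < d"
  obtains L p q where "p < L" "q < L" "p \<noteq> q" "int q - int p = a" "d = \<infinity> \<or> enat L = d"
proof -
  define L where "L = (case d of enat m \<Rightarrow> m | \<infinity> \<Rightarrow> nat \<bar>a\<bar> + 1)"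
  have L: "nat \<bar>a\<bar> < L" "d = \<infinity> \<or> enat L = d" using assms by (auto simp: L_def split: enat.splits)
  show ?thesis
  proof (cases "a > 0")
    case True
    then show ?thesis using L by (intro that[of 0 L "nat a"]) auto
  next
    case False
    then show ?thesis using L assms(1) by (intro that[of "nat (- a)" L 0]) auto
  qed
qed

context coloured
begin

text \<open>A syllable that starts at a vertex without edges of its colour gets a new component and ends at a
new vertex, which has edges of this colour only.\<close>

lemma attach_syllable:
  assumes G: "graph V C" and i: "i \<in> {1..k}" and x: "[x] \<in> C i" and a: "a \<noteq> 0" "enat (nat \<bar>a\<bar>) < d i"
  shows "\<exists>V' C' y. extends V C V' C' \<and> euler V' C' = euler V C \<and> y \<notin> V \<and> reach V' C' x (gpow i a) y \<and>
    C i - {[x]} \<subseteq> C' i \<and> (\<forall>j\<in>{1..k}. j \<noteq> i \<longrightarrow> C j \<subseteq> C' j \<and> [y] \<in> C' j)"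
proof -
  obtain L p q where L: "p < L" "q < L" "p \<noteq> q" "int q - int p = a" "d i = \<infinity> \<or> enat L = d i"
    using syllable_position[OF a] by metis
  obtain F where F: "length F = L" "distinct F" "set F \<inter> V = {}"
    using fresh_list[of V L] G by (auto simp: graph_def)
  define xs where "xs = F[p := x]"
  have xV: "x \<in> V" using graphD(7)[OF G i x] by simp
  have F_out: "F ! t \<notin> V" if "t < L" for t using F that nth_mem by blast
  have xs: "distinct xs" "length xs = L" "xs ! p = x" "xs ! q = F ! q" "set xs = insert x (set F - {F ! p})"
    unfolding xs_def using F L xV
    by (auto simp: set_update_distinct intro!: distinct_list_update)
  obtain V' C' where *: "extends V C V' C'" "euler V' C' = euler V C + 1 - int (card {[x]})" "xs \<in> C' i"
    "C i - {[x]} \<subseteq> C' i" "\<And>j. j \<in> {1..k} \<Longrightarrow> j \<noteq> i \<Longrightarrow> C j \<union> (\<lambda>v. [v]) ` (set xs - V) \<subseteq> C' j"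
  proof (rule merge_components[OF G i, of "{[x]}" xs])
    show "comp_walk (d i) s (map \<phi> ys)" if "ys \<in> {[x]}" for s ys and \<phi> :: "nat \<Rightarrow> nat"
      using that comp_walk_singleton[OF d_neq_1[OF i]] by auto
    show "set xs \<inter> V = (\<Union>ys\<in>{[x]}. set ys)" using xs(5) F(3) xV by auto
  qed (use x xs L in auto)
  have y: "F ! q \<notin> V" using F_out L(2) .
  have "reach V' C' x (gpow i a) (F ! q)"
    using reach_component[OF extends_graph[OF *(1)] i *(3), of p q] xs L by simp
  moreover have "F ! q \<in> set xs - V" using xs(2,4) L(2) y nth_mem by (metis DiffI)
  then have "C j \<subseteq> C' j \<and> [F ! q] \<in> C' j" if "j \<in> {1..k}" "j \<noteq> i" for j using *(5)[OF that] by blast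
  ultimately show ?thesis
    using *(1-4) y by (intro exI[of _ V'] exI[of _ C'] exI[of _ "F ! q"]) simp
qed

text \<open>A new component through two old vertices that have no edges of its colour closes a loop, and the
Euler characteristic drops by \<open>1\<close>.\<close>

lemma close_syllable:
  assumes G: "graph V C" and i: "i \<in> {1..k}" and x: "[x] \<in> C i" "[y] \<in> C i" "x \<noteq> y"
    and a: "a \<noteq> 0" "enat (nat \<bar>a\<bar>) < d i"
  shows "\<exists>V' C'. extends V C V' C' \<and> euler V' C' = euler V C - 1 \<and> reach V' C' x (gpow i a) y"
proof -
  obtain L p q where L: "p < L" "q < L" "p \<noteq> q" "int q - int p = a" "d i = \<infinity> \<or> enat L = d i"
    using syllable_position[OF a] by metis
  obtain F where F: "length F = L" "distinct F" "set F \<inter> V = {}"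
    using fresh_list[of V L] G by (auto simp: graph_def)
  define ys where "ys = F[p := x]"
  define xs where "xs = ys[q := y]"
  have xV: "x \<in> V" "y \<in> V" using graphD(7)[OF G i x(1)] graphD(7)[OF G i x(2)] by simp_all
  have ys: "distinct ys" "length ys = L" "ys ! p = x" "ys ! q = F ! q" "set ys = insert x (set F - {F ! p})"
    unfolding ys_def using F L xV
    by (auto simp: set_update_distinct intro!: distinct_list_update)
  have "F ! q \<noteq> x" using F(1,3) L(2) xV(1) nth_mem by blast
  have xs: "distinct xs" "length xs = L" "xs ! p = x" "xs ! q = y" "set xs = insert y (set ys - {F ! q})"
    unfolding xs_def using ys F L xV x(3)
    by (auto simp: set_update_distinct intro!: distinct_list_update)
  obtain V' C' where *: "extends V C V' C'" "euler V' C' = euler V C + 1 - int (card {[x], [y]})" "xs \<in> C' i"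
  proof (rule merge_components[OF G i, of "{[x], [y]}" xs])
    show "comp_walk (d i) s (map \<phi> zs)" if "zs \<in> {[x], [y]}" for s zs and \<phi> :: "nat \<Rightarrow> nat"
      using that comp_walk_singleton[OF d_neq_1[OF i]] by auto
    show "set xs \<inter> V = (\<Union>ys\<in>{[x], [y]}. set ys)" using xs(5) ys(5) F(3) xV \<open>F ! q \<noteq> x\<close> by auto
  qed (use x xs L in auto)
  have "reach V' C' x (gpow i a) y"
    using reach_component[OF extends_graph[OF *(1)] i *(3), of p q] xs L by simp
  then show ?thesis using * x(3) by auto
qed

definition valid_syllables :: "(nat \<times> int) list \<Rightarrow> bool" where
  "valid_syllables ts \<longleftrightarrow> (\<forall>(i, a)\<in>set ts. i \<in> {1..k} \<and> a \<noteq> 0 \<and> enat (nat \<bar>a\<bar>) < d i) \<and>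
    successively (\<lambda>p q. fst p \<noteq> fst q) ts"

text \<open>The tree of components that belongs to a word with alternating colours. The conditions on \<open>[q]\<close> and
\<open>[b]\<close> make it possible to attach a further syllable at the end of the walk and to return to its
start.\<close>

lemma path_graph:
  assumes "ts \<noteq> []" "valid_syllables ts" and Z: "\<And>i. i \<in> {1..k} \<Longrightarrow> Z i = []"
  shows "\<exists>V C b q. graph V C \<and> euler V C = 1 \<and> determined V C b \<and> q \<noteq> b \<and> reach V C b (syllable_word ts) q \<and>
    (\<forall>pre us. ts = pre @ us \<longrightarrow> us \<noteq> [] \<longrightarrow> (\<exists>y. y \<noteq> b \<and> reach V C b (syllable_word us) y)) \<and>
    (\<forall>j\<in>{1..k}. j \<noteq> fst (hd ts) \<longrightarrow> [q] \<in> C j) \<and> (\<forall>j\<in>{1..k}. j \<noteq> fst (last ts) \<longrightarrow> [b] \<in> C j)"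
  using assms(1,2)
proof (induction ts)
  case (Cons s ts)
  obtain i a where s: "s = (i, a)" by (cases s)
  have i: "i \<in> {1..k}" and a: "a \<noteq> 0" "enat (nat \<bar>a\<bar>) < d i"
    using Cons.prems(2) s by (auto simp: valid_syllables_def)
  show ?case
  proof (cases "ts = []")
    case True
    define V where "V = {0 :: nat}"
    define C where "C = (\<lambda>i :: nat. {[0 :: nat]})"
    have G: "graph V C" using Z by (auto simp: graph_def V_def C_def disjoint_family_on_def)
    have D: "determined V C 0" by (auto simp: determined_def V_def)
    have E: "euler V C = 1" by (simp add: euler_def V_def C_def)
    obtain V' C' y where *: "extends V C V' C'" "euler V' C' = euler V C" "y \<notin> V" "reach V' C' 0 (gpow i a) y"
      "\<forall>j\<in>{1..k}. j \<noteq> i \<longrightarrow> C j \<subseteq> C' j \<and> [y] \<in> C' j"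
      using attach_syllable[OF G i _ a, of 0] by (auto simp: C_def)
    have "y \<noteq> 0" using *(3) by (auto simp: V_def)
    moreover have "\<exists>y. y \<noteq> 0 \<and> reach V' C' 0 (syllable_word us) y" if "s # ts = pre @ us" "us \<noteq> []" for pre us
      using that True s *(4) \<open>y \<noteq> 0\<close> by (auto simp: Cons_eq_append_conv)
    moreover have "determined V' C' 0" using *(1) D by (simp add: extends_def)
    ultimately show ?thesis
      using * E True s extends_graph[OF *(1)]
      by (intro exI[of _ V'] exI[of _ C'] exI[of _ 0] exI[of _ y]) (auto simp: C_def)
  next
    case False
    have v: "valid_syllables ts" and ne: "fst (hd ts) \<noteq> i"
      using Cons.prems(2) False s by (auto simp: valid_syllables_def successively_Cons)
    obtain V C b q where G: "graph V C" "euler V C = 1" "determined V C b" "q \<noteq> b" "reach V C b (syllable_word ts) q"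
      and suf: "\<And>pre us. ts = pre @ us \<Longrightarrow> us \<noteq> [] \<Longrightarrow> \<exists>y. y \<noteq> b \<and> reach V C b (syllable_word us) y"
      and q: "\<And>j. j \<in> {1..k} \<Longrightarrow> j \<noteq> fst (hd ts) \<Longrightarrow> [q] \<in> C j"
      and b: "\<And>j. j \<in> {1..k} \<Longrightarrow> j \<noteq> fst (last ts) \<Longrightarrow> [b] \<in> C j"
      using Cons.IH[OF False v] by blast
    obtain V' C' y where *: "extends V C V' C'" "euler V' C' = euler V C" "y \<notin> V" "reach V' C' q (gpow i a) y"
      "C i - {[q]} \<subseteq> C' i" "\<forall>j\<in>{1..k}. j \<noteq> i \<longrightarrow> C j \<subseteq> C' j \<and> [y] \<in> C' j"
      using attach_syllable[OF G(1) i q[OF i] a] ne by auto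
    have yb: "y \<noteq> b" using *(3) G(5) by (auto simp: reach_def)
    have ry: "reach V' C' b (syllable_word (s # ts)) y"
      using reach_append[OF reach_extends[OF G(5) *(1)] *(4)] s by simp
    have "\<exists>y. y \<noteq> b \<and> reach V' C' b (syllable_word us) y" if "s # ts = pre @ us" "us \<noteq> []" for pre us
    proof (cases pre)
      case Nil
      then show ?thesis using that ry yb by auto
    next
      case (Cons p pre')
      then show ?thesis using that suf[of pre' us] reach_extends[OF _ *(1)] by auto
    qed
    moreover have "[b] \<in> C' j" if "j \<in> {1..k}" "j \<noteq> fst (last ts)" for j
      using b[OF that] *(5,6) that G(4) by (cases "j = i") auto
    moreover have "determined V' C' b" using *(1) G(3) by (simp add: extends_def)
    ultimately show ?thesis
      using extends_graph[OF *(1)] *(2,6) G(2) yb ry s False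
      by (intro exI[of _ V'] exI[of _ C'] exI[of _ b] exI[of _ y]) auto
  qed
qed simp

text \<open>The last syllable of the walk is the first one of \<open>ts\<close>. As its colour differs from those of its two cyclic
neighbours, it can join the end of the walk to its start.\<close>

lemma cycle_graph:
  assumes "2 \<le> length ts" "valid_syllables ts" "fst (last ts) \<noteq> fst (hd ts)"
    and Z: "\<And>i. i \<in> {1..k} \<Longrightarrow> Z i = []"
  shows "\<exists>V C b. graph V C \<and> euler V C = 0 \<and> determined V C b \<and> reach V C b (syllable_word ts) b \<and>
    (\<forall>pre us. ts = pre @ us \<longrightarrow> pre \<noteq> [] \<longrightarrow> us \<noteq> [] \<longrightarrow> (\<exists>y. y \<noteq> b \<and> reach V C b (syllable_word us) y))"
proof -
  obtain i a ts' where ts: "ts = (i, a) # ts'" "ts' \<noteq> []" using assms(1) by (cases ts) (auto simp: Suc_le_eq)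
  have i: "i \<in> {1..k}" and a: "a \<noteq> 0" "enat (nat \<bar>a\<bar>) < d i" and v: "valid_syllables ts'"
    and ne: "i \<noteq> fst (hd ts')" "i \<noteq> fst (last ts')"
    using assms(2,3) ts by (auto simp: valid_syllables_def successively_Cons)
  obtain V C b q where G: "graph V C" "euler V C = 1" "determined V C b" "q \<noteq> b" "reach V C b (syllable_word ts') q"
    and suf: "\<And>pre us. ts' = pre @ us \<Longrightarrow> us \<noteq> [] \<Longrightarrow> \<exists>y. y \<noteq> b \<and> reach V C b (syllable_word us) y"
    and q: "\<And>j. j \<in> {1..k} \<Longrightarrow> j \<noteq> fst (hd ts') \<Longrightarrow> [q] \<in> C j"
    and b: "\<And>j. j \<in> {1..k} \<Longrightarrow> j \<noteq> fst (last ts') \<Longrightarrow> [b] \<in> C j"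
    using path_graph[OF ts(2) v Z] by blast
  obtain V' C' where *: "extends V C V' C'" "euler V' C' = euler V C - 1" "reach V' C' q (gpow i a) b"
    using close_syllable[OF G(1) i q[OF i ne(1)] b[OF i ne(2)] G(4) a] by blast
  have r: "reach V' C' b (syllable_word ts) b"
    using reach_append[OF reach_extends[OF G(5) *(1)] *(3)] ts by simp
  have "\<exists>y. y \<noteq> b \<and> reach V' C' b (syllable_word us) y" if "ts = pre @ us" "pre \<noteq> []" "us \<noteq> []" for pre us
  proof -
    obtain p pre' where "pre = p # pre'" using \<open>pre \<noteq> []\<close> by (cases pre) auto
    then show ?thesis using that ts suf[of pre' us] reach_extends[OF _ *(1)] by auto
  qed
  moreover have "determined V' C' b" using *(1) G(3) by (simp add: extends_def)
  ultimately show ?thesis using r * G(2) extends_graph[OF *(1)] by auto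
qed

text \<open>The number of embeddings of such a graph is a lower bound for the number of points in \<open>l\<close>-cycles, and
its expectation does not tend to zero.\<close>

definition realizable :: "nat \<Rightarrow> word \<Rightarrow> bool" where
  "realizable l w \<longleftrightarrow> (\<exists>V C b. graph V C \<and> euler V C = 0 \<and> determined V C b \<and>
    (\<forall>s \<phi>. model V C s \<phi> \<longrightarrow> card (orbit (eval_word s w) (\<phi> b)) = l))"

lemma syllable_word_replicate:
  "eval_word s (syllable_word (concat (replicate n ss))) = eval_word s (syllable_word ss) ^^ n"
  by (induction n) (simp_all add: eval_word_append)

lemma successively_concat_replicate:
  assumes "successively P ss" "ss \<noteq> []" "P (last ss) (hd ss)"
  shows "successively P (concat (replicate n ss))"
proof (induction n)
  case (Suc n)
  have "hd (concat (replicate n ss)) = hd ss" if "n > 0" using that assms(2) by (cases n) auto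
  then show ?case using Suc assms by (cases "n = 0") (auto simp: successively_append_iff)
qed simp

lemma syllable_word_in_words: "valid_syllables ts \<Longrightarrow> syllable_word ts \<in> words k"
proof (induction ts)
  case (Cons s ts)
  obtain i a where "s = (i, a)" by (cases s)
  then show ?case using Cons gpow_in_words by (auto simp: valid_syllables_def successively_Cons)
qed simp

text \<open>The walk along \<open>l\<close> copies of the word is a single loop, so that it returns to its start after the last
copy only.\<close>

lemma realizable_syllables:
  assumes "2 \<le> length ss" "valid_syllables ss" "fst (last ss) \<noteq> fst (hd ss)"
    and Z: "\<And>i. i \<in> {1..k} \<Longrightarrow> Z i = []" and l: "l \<ge> 1"
  shows "realizable l (syllable_word ss)"
proof -
  let ?ts = "concat (replicate l ss)"
  have ne: "ss \<noteq> []" using assms(1) by auto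
  obtain l' where l': "l = Suc l'" using l by (cases l) auto
  have ts: "hd ?ts = hd ss" "2 \<le> length ?ts" using ne assms(1) l' by auto
  have lastts: "last ?ts = last ss"
  proof -
    have "?ts = concat (replicate l' ss) @ ss" using l' by (simp flip: replicate_append_same)
    then show ?thesis using ne by simp
  qed
  have "valid_syllables ?ts"
    using assms(2,3) successively_concat_replicate[of "\<lambda>p q. fst p \<noteq> fst q" ss l] ne
    by (auto simp: valid_syllables_def)
  then obtain V C b where G: "graph V C" "euler V C = 0" "determined V C b" "reach V C b (syllable_word ?ts) b"
    and suf: "\<And>pre us. ?ts = pre @ us \<Longrightarrow> pre \<noteq> [] \<Longrightarrow> us \<noteq> [] \<Longrightarrow> \<exists>y. y \<noteq> b \<and> reach V C b (syllable_word us) y"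
    using cycle_graph[OF ts(2) _ _ Z] ts(1) lastts assms(3) by metis
  have "card (orbit (eval_word s (syllable_word ss)) (\<phi> b)) = l" if M: "model V C s \<phi>" for s \<phi>
  proof (rule card_orbit_eqI)
    show "permutation (eval_word s (syllable_word ss))"
      using M syllable_word_in_words[OF assms(2)] by (intro permutation_eval_word[where k = k]) (auto simp: model_def)
    show "(eval_word s (syllable_word ss) ^^ l) (\<phi> b) = \<phi> b"
      using G(4) M by (simp add: reach_def syllable_word_replicate)
    fix t assume t: "0 < t" "t < l"
    have "?ts = concat (replicate (l - t) ss) @ concat (replicate t ss)"
      using t by (simp flip: concat_append replicate_add)
    moreover have "concat (replicate (l - t) ss) \<noteq> []" "concat (replicate t ss) \<noteq> []" using t ne by auto
    ultimately obtain y where y: "y \<noteq> b" "reach V C b (syllable_word (concat (replicate t ss))) y"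
      using suf by blast
    then have "(eval_word s (syllable_word ss) ^^ t) (\<phi> b) = \<phi> y" "y \<in> V" "b \<in> V"
      using M by (auto simp: reach_def syllable_word_replicate)
    moreover have "inj_on \<phi> V" using M by (simp add: model_def)
    ultimately show "(eval_word s (syllable_word ss) ^^ t) (\<phi> b) \<noteq> \<phi> b"
      using y(1) by (metis inj_on_def)
  qed (use l in simp)
  then show ?thesis using G unfolding realizable_def by blast
qed

lemma model_permutation_eval:
  "model V C s \<phi> \<Longrightarrow> u \<in> words k \<Longrightarrow> permutation (eval_word s u)"
  by (rule permutation_eval_word[where k = k]) (auto simp: model_def)

text \<open>The marked vertex moves along \<open>u\<close>.\<close>

lemma realizable_rotate:
  assumes "realizable l (v @ u)" "u \<in> words k" "v \<in> words k"
  shows "realizable l (u @ v)"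
proof -
  obtain V C b where G: "graph V C" "euler V C = 0" "determined V C b"
    "\<And>s \<phi>. model V C s \<phi> \<Longrightarrow> card (orbit (eval_word s (v @ u)) (\<phi> b)) = l"
    using assms(1) unfolding realizable_def by blast
  have "b \<in> V" using G(3) by (simp add: determined_def)
  then obtain V' C' c where *: "extends V C V' C'" "euler V' C' = euler V C" "reach V' C' b u c"
    using reach_word[OF G(1) _ assms(2)] by blast
  have model: "model V C s \<phi>" "eval_word s u (\<phi> b) = \<phi> c" "bij (eval_word s u)" if "model V' C' s \<phi>" for s \<phi>
    using * that model_permutation_eval[OF that assms(2)] by (auto simp: extends_def reach_def permutation_bijective)
  have "determined V' C' c"
    unfolding determined_def
  proof (intro conjI allI impI)
    show "c \<in> V'" using *(3) by (simp add: reach_def)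
    fix s \<phi> \<phi>' assume m: "model V' C' s \<phi>" "model V' C' s \<phi>'" "\<phi> c = \<phi>' c"
    then have "eval_word s u (\<phi> b) = eval_word s u (\<phi>' b)" using model(2) by simp
    then have "\<phi> b = \<phi>' b" using model(3)[OF m(1)] by (simp add: bij_is_inj inj_eq)
    moreover have "determined V' C' b" using *(1) G(3) by (simp add: extends_def)
    ultimately show "\<forall>x\<in>V'. \<phi> x = \<phi>' x" using m by (auto simp: determined_def)
  qed
  moreover have "card (orbit (eval_word s (u @ v)) (\<phi> c)) = l" if m: "model V' C' s \<phi>" for s \<phi>
  proof -
    let ?U = "eval_word s u" and ?f = "eval_word s (v @ u)"
    have "permutation ?f" using assms by (intro model_permutation_eval[OF m]) auto
    then have "?U ` orbit ?f (\<phi> b) = orbit (eval_word s (u @ v)) (?U (\<phi> b))"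
      by (intro orbit_inverse permutation_self_in_orbit) (simp_all add: eval_word_append)
    moreover have "card (?U ` orbit ?f (\<phi> b)) = card (orbit ?f (\<phi> b))"
      using model(3)[OF m] by (intro card_image) (metis bij_is_inj inj_on_subset subset_UNIV)
    ultimately show ?thesis using G(4)[OF model(1)[OF m]] model(2)[OF m] by simp
  qed
  ultimately show ?thesis using extends_graph[OF *(1)] *(2) G(2) unfolding realizable_def by auto
qed

text \<open>The graph is extended so that for each of the \<open>l\<close> points of the cycle there is a full cycle of colour
\<open>i\<close> at the place where the torsion element acts. Then the longer word acts on these points
like \<open>v\<close>.\<close>

lemma realizable_insert_torsion:
  assumes "realizable l v" "u \<in> words k" "v \<in> words k" "i \<in> {1..k}" "d i = enat m"
  shows "realizable l (u @ gpow i (a * int m) @ inv_word u @ v)"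
proof -
  let ?g = "gpow i (a * int m)"
  let ?vt = "\<lambda>t. concat (replicate t v)"
  obtain V C b where G: "graph V C" "euler V C = 0" "determined V C b"
    "\<And>s \<phi>. model V C s \<phi> \<Longrightarrow> card (orbit (eval_word s v) (\<phi> b)) = l"
    using assms(1) unfolding realizable_def by blast
  have bV: "b \<in> V" using G(3) by (simp add: determined_def)
  have vt: "?vt t \<in> words k" for t using assms(3) by (induction t) auto
  have iu: "inv_word u \<in> words k" using assms(2) by (rule inv_word_words)
  have evt: "eval_word s (?vt t) = eval_word s v ^^ t" for s t
    by (induction t) (simp_all add: eval_word_append)
  have "\<exists>V' C'. extends V C V' C' \<and> euler V' C' = 0 \<and>
      (\<forall>t<n. \<exists>y. reach V' C' b (inv_word u @ v @ ?vt t) y \<and> reach V' C' y ?g y)" for n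
  proof (induction n)
    case 0
    then show ?case using extends_refl[OF G(1)] G(2) by auto
  next
    case (Suc n)
    then obtain V1 C1 where 1: "extends V C V1 C1" "euler V1 C1 = 0"
      "\<forall>t<n. \<exists>y. reach V1 C1 b (inv_word u @ v @ ?vt t) y \<and> reach V1 C1 y ?g y" by blast
    have "b \<in> V1" using 1(1) bV by (auto simp: extends_def)
    then obtain V2 C2 y where 2: "extends V1 C1 V2 C2" "euler V2 C2 = euler V1 C1"
      "reach V2 C2 b (inv_word u @ v @ ?vt n) y"
      using reach_word[OF extends_graph[OF 1(1)], of b "inv_word u @ v @ ?vt n"] vt iu assms(3) by auto
    have "y \<in> V2" using 2(3) by (simp add: reach_def)
    then obtain V3 C3 where 3: "extends V2 C2 V3 C3" "euler V3 C3 = euler V2 C2" "reach V3 C3 y ?g y"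
      using reach_torsion[OF extends_graph[OF 2(1)] assms(4,5)] by blast
    have e13: "extends V1 C1 V3 C3" using 2(1) 3(1) by (rule extends_trans)
    have "\<exists>y. reach V3 C3 b (inv_word u @ v @ ?vt t) y \<and> reach V3 C3 y ?g y" if "t < Suc n" for t
    proof (cases "t = n")
      case True
      then show ?thesis using reach_extends[OF 2(3) 3(1)] 3(3) by blast
    next
      case False
      then show ?thesis using 1(3) that reach_extends[OF _ e13] by (metis less_SucE)
    qed
    then show ?case using extends_trans[OF 1(1) e13] 1(2) 2(2) 3(2) by auto
  qed
  then obtain V' C' where E: "extends V C V' C'" "euler V' C' = 0"
    "\<And>t. t < l \<Longrightarrow> \<exists>y. reach V' C' b (inv_word u @ v @ ?vt t) y \<and> reach V' C' y ?g y" by blast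
  have "card (orbit (eval_word s (u @ ?g @ inv_word u @ v)) (\<phi> b)) = l" if M: "model V' C' s \<phi>" for s \<phi>
  proof -
    let ?f = "eval_word s v" and ?w = "eval_word s (u @ ?g @ inv_word u @ v)"
    have M0: "model V C s \<phi>" using E(1) M by (simp add: extends_def)
    have pf: "permutation ?f" using model_permutation_eval[OF M assms(3)] .
    obtain S where S: "?f permutes S" "finite S" using pf permutation_permutes by blast
    have cl: "card (orbit ?f (\<phi> b)) = l" using G(4)[OF M0] .
    have "?w y = ?f y" if "y \<in> orbit ?f (\<phi> b)" for y
    proof -
      have "y \<in> (\<lambda>m. (?f ^^ m) (\<phi> b)) ` {..<l}"
        using that orbit_period(3)[OF S, of "\<phi> b"] unfolding cl by blast
      then obtain t where t: "t < l" "y = (?f ^^ t) (\<phi> b)" by blast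
      obtain z where z: "reach V' C' b (inv_word u @ v @ ?vt t) z" "reach V' C' z ?g z" using E(3)[OF t(1)] by blast
      have "eval_word s (inv_word u) (?f y) = \<phi> z"
        using z(1) M t(2) by (simp add: reach_def eval_word_append evt)
      moreover have "eval_word s ?g (\<phi> z) = \<phi> z" using z(2) M by (simp add: reach_def)
      ultimately have "?w y = eval_word s u (eval_word s (inv_word u) (?f y))"
        by (simp add: eval_word_append)
      also have "\<dots> = ?f y" using model_bij[OF M] assms(2) by (intro eval_word_inv_word[where k = k]) auto
      finally show ?thesis .
    qed
    then have "orbit ?w (\<phi> b) = orbit ?f (\<phi> b)"
      by (intro orbit_cong permutation_self_in_orbit[OF pf]) auto
    then show ?thesis using cl by simp
  qed
  moreover have "determined V' C' b" using E(1) G(3) by (simp add: extends_def)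
  ultimately show ?thesis using extends_graph[OF E(1)] E(2) unfolding realizable_def by blast
qed

lemma realizable_cyc_step:
  assumes "cyc_step k d w v" "realizable l v"
  shows "realizable l w"
  using assms
proof cases
  case (rotate u v')
  then show ?thesis using assms(2) realizable_rotate by blast
next
  case (conj i m a u)
  then show ?thesis using assms(2) realizable_insert_torsion by simp
next
  case (power i m a b v')
  then have "v \<in> words k" using gpow_in_words by simp
  then show ?thesis
    using realizable_insert_torsion[OF assms(2), of "[]" i m a] power by (simp add: inv_word_def)
qed

lemma realizable_partial_cyc_reduction:
  "partial_cyc_reduction k d w v \<Longrightarrow> realizable l v \<Longrightarrow> realizable l w"
  unfolding partial_cyc_reduction_def
  by (induction rule: converse_rtranclp_induct) (auto intro: realizable_cyc_step)

text \<open>All vertices lie on the distinguished cycle of length \<open>l |a|\<close>, on which the \<open>a\<close>-th power has cycles of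
length \<open>l\<close>.\<close>

lemma realizable_gpow:
  assumes "i \<in> {1..k}" "a \<noteq> 0" "Z i = [0..<l * nat \<bar>a\<bar>]" "\<And>j. j \<in> {1..k} \<Longrightarrow> j \<noteq> i \<Longrightarrow> Z j = []" "l \<ge> 1"
  shows "realizable l (gpow i a)"
proof -
  let ?n = "nat \<bar>a\<bar>"
  let ?j = "l * ?n"
  define V where "V = {..<?j}"
  define C where "C j = (if j = i then {} else (\<lambda>v. [v]) ` V)" for j
  have n: "?n > 0" using assms(2) by simp
  then have jpos: "?j > 0" using assms(5) by simp
  have G: "graph V C"
    using assms(1,3,4) by (auto simp: graph_def V_def C_def disjoint_family_on_def)
  have "(\<Sum>j\<in>{1..k}. int (card (C j)) - int (card V)) = (\<Sum>j\<in>{i}. - int (card V))"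
    using assms(1) by (intro sum.mono_neutral_cong_right) (auto simp: C_def card_image inj_on_def)
  then have E: "euler V C = 0" by (simp add: euler_def)
  have main: "(s i ^^ m) (\<phi> 0) = \<phi> (m mod ?j)" if M: "model V C s \<phi>" for s \<phi> m
  proof -
    have "closed_walk (s i) (map \<phi> (Z i))" using M assms(1) unfolding model_def by blast
    then have "closed_walk (s i) (map \<phi> [0..<?j])" unfolding assms(3) .
    from closed_walk_funpow[OF this, of 0 m] jpos show ?thesis by simp
  qed
  have D: "determined V C 0"
    unfolding determined_def
  proof (intro conjI allI impI ballI)
    show "0 \<in> V" using jpos by (simp add: V_def)
    fix s \<phi> \<phi>' v assume "model V C s \<phi>" "model V C s \<phi>'" "\<phi> 0 = \<phi>' 0" "v \<in> V"
    then show "\<phi> v = \<phi>' v" using main[of s \<phi> v] main[of s \<phi>' v] by (simp add: V_def)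
  qed
  have "card (orbit (eval_word s (gpow i a)) (\<phi> 0)) = l" if M: "model V C s \<phi>" for s \<phi>
  proof -
    have p: "permutation (s i)" using M assms(1) by (simp add: model_def)
    have pn: "permutation (s i ^^ ?n)" using p by (rule permutation_funpow)
    have "card (orbit (s i ^^ ?n) (\<phi> 0)) = l"
    proof (rule card_orbit_eqI[OF pn])
      show "((s i ^^ ?n) ^^ l) (\<phi> 0) = \<phi> 0"
        using main[OF M, of "?n * l"] by (simp add: funpow_mult mult.commute)
      fix t assume t: "0 < t" "t < l"
      have "((s i ^^ ?n) ^^ t) (\<phi> 0) = \<phi> (?n * t)"
        using main[OF M, of "?n * t"] t n by (simp add: funpow_mult mult.commute)
      moreover have "?n * t < ?j" using t n by (subst mult.commute) (rule mult_strict_right_mono)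
      then have "?n * t \<in> V" "0 \<in> V" by (simp_all add: V_def)
      moreover have "?n * t \<noteq> 0" using t(1) n by simp
      moreover have "inj_on \<phi> V" using M by (simp add: model_def)
      ultimately show "((s i ^^ ?n) ^^ t) (\<phi> 0) \<noteq> \<phi> 0" by (metis inj_on_def)
    qed (use assms(5) in simp)
    moreover have "orbit (eval_word s (gpow i a)) (\<phi> 0) = orbit (s i ^^ ?n) (\<phi> 0)"
    proof (cases "0 \<le> a")
      case False
      have "finv (s i) ^^ ?n = finv (s i ^^ ?n)"
      proof
        fix y
        have "(s i ^^ ?n) (finv (s i ^^ ?n) y) = y"
          by (rule surj_f_inv_f[OF bij_is_surj[OF permutation_bijective[OF pn]]])
        then show "(finv (s i) ^^ ?n) y = finv (s i ^^ ?n) y"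
          by (rule finv_funpow_fixed[OF permutation_bijective[OF p]])
      qed
      then show ?thesis using False orbit_inv_eq[OF pn] by (simp add: eval_word_gpow)
    qed (simp add: eval_word_gpow)
    ultimately show ?thesis by simp
  qed
  then show ?thesis using G E D unfolding realizable_def by blast
qed

end

section \<open>Infinite order in the quotient group\<close>

lemma quot_elem_append:
  assumes "u \<in> words k" "v \<in> words k"
  shows "quot_elem k d (u @ v) = quot_elem k d u \<otimes>\<^bsub>quot_group k d\<^esub> quot_elem k d v"
proof -
  have "word_class k u \<in> carrier (free_group k)" "word_class k v \<in> carrier (free_group k)"
    using assms by (auto simp: carrier_free_group)
  from normal.rcos_sum[OF normal_relators this, of d] show ?thesis
    using assms by (simp add: quot_elem_def quot_group_def FactGroup_def mult_free_group)
qed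

lemma quot_elem_eq:
  "(u, v) \<in> free_equiv k \<Longrightarrow> quot_elem k d u = quot_elem k d v"
  using word_class_eq_iff free_equiv_words by (metis quot_elem_def)

lemma quot_elem_Nil: "quot_elem k d [] = \<one>\<^bsub>quot_group k d\<^esub>"
proof -
  interpret G: group "quot_group k d" by (rule group_quot_group)
  have "quot_elem k d [] \<otimes>\<^bsub>quot_group k d\<^esub> quot_elem k d [] = quot_elem k d []"
    using quot_elem_append[of "[]" k "[]" d] by simp
  moreover have "quot_elem k d [] \<in> carrier (quot_group k d)" by (rule quot_elem_carrier) simp
  ultimately show ?thesis by (metis G.l_cancel_one')
qed

lemma quot_elem_inv_word:
  assumes "u \<in> words k"
  shows "quot_elem k d (inv_word u) \<otimes>\<^bsub>quot_group k d\<^esub> quot_elem k d u = \<one>\<^bsub>quot_group k d\<^esub>"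
  using quot_elem_append[OF inv_word_words[OF assms] assms, of d] quot_elem_eq[OF inv_word_cancel[OF assms]]
  by (simp add: quot_elem_Nil)

lemma concat_replicate_words: "u \<in> words k \<Longrightarrow> concat (replicate n u) \<in> words k"
  by (induction n) auto

lemma quot_elem_pow:
  assumes "u \<in> words k"
  shows "quot_elem k d u [^]\<^bsub>quot_group k d\<^esub> (n :: nat) = quot_elem k d (concat (replicate n u))"
proof (induction n)
  case 0
  then show ?case by (simp add: quot_elem_Nil)
next
  case (Suc n)
  have "concat (replicate (Suc n) u) = concat (replicate n u) @ u"
    by (simp flip: replicate_append_same)
  then show ?case
    using Suc quot_elem_append[OF concat_replicate_words[OF assms] assms] by simp
qed

lemma word_class_pow:
  assumes "u \<in> words k"
  shows "word_class k u [^]\<^bsub>free_group k\<^esub> (n :: nat) = word_class k (concat (replicate n u))"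
proof (induction n)
  case 0
  then show ?case by (simp add: free_group_def)
next
  case (Suc n)
  have "concat (replicate (Suc n) u) = concat (replicate n u) @ u"
    by (simp flip: replicate_append_same)
  then show ?case
    using Suc mult_free_group[OF concat_replicate_words[OF assms] assms] by simp
qed

lemma quot_elem_torsion:
  assumes i: "i \<in> {1..k}" "d i = enat m"
  shows "quot_elem k d (gpow i (a * int m)) = \<one>\<^bsub>quot_group k d\<^esub>"
proof -
  interpret G: group "quot_group k d" by (rule group_quot_group)
  let ?N = "normal_closure (free_group k) (relators k d)"
  have wr: "replicate n (i, b) \<in> words k" for n b using i(1) by (auto simp: words_def)
  have pos: "quot_elem k d (replicate m (i, True)) = \<one>\<^bsub>quot_group k d\<^esub>"
  proof -
    have w1: "[(i, True)] \<in> words k" using i(1) by simp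
    have "concat (replicate m [(i, True)]) = replicate m (i, True)" by (induction m) auto
    then have "word_class k (replicate m (i, True)) = word_class k [(i, True)] [^]\<^bsub>free_group k\<^esub> m"
      using word_class_pow[OF w1] by simp
    then have "word_class k (replicate m (i, True)) \<in> relators k d"
      using i by (auto simp: relators_def)
    then have "word_class k (replicate m (i, True)) \<in> ?N" by (auto simp: normal_closure_def)
    then have "?N #>\<^bsub>free_group k\<^esub> word_class k (replicate m (i, True)) = ?N"
      by (intro subgroup.rcos_const[OF normal_imp_subgroup[OF normal_relators] group_free_group])
    then show ?thesis by (simp add: quot_elem_def quot_group_def FactGroup_def)
  qed
  have c: "quot_elem k d (replicate m (i, False)) \<in> carrier (quot_group k d)"
    by (rule quot_elem_carrier[OF wr])
  have "inv_word (replicate m (i, True)) = replicate m (i, False)"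
    by (simp add: inv_word_def inv_letter_def)
  then have neg: "quot_elem k d (replicate m (i, False)) = \<one>\<^bsub>quot_group k d\<^esub>"
    using quot_elem_inv_word[where d = d and u = "replicate m (i, True)", OF wr] c pos by simp
  have "quot_elem k d (replicate m (i, b)) = \<one>\<^bsub>quot_group k d\<^esub>" for b
    using pos neg by (cases b) auto
  moreover have "quot_elem k d (concat (replicate n (replicate m (i, b)))) =
      quot_elem k d (replicate m (i, b)) [^]\<^bsub>quot_group k d\<^esub> n" for n :: nat and b
    by (rule quot_elem_pow[OF wr, symmetric])
  ultimately have "quot_elem k d (concat (replicate n (replicate m (i, b)))) = \<one>\<^bsub>quot_group k d\<^esub>" for n b
    by simp
  moreover have "concat (replicate n (replicate m (i, b))) = replicate (n * m) (i, b)" for n b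
    by (induction n) (simp_all add: replicate_add)
  ultimately have "quot_elem k d (replicate (n * m) (i, b)) = \<one>\<^bsub>quot_group k d\<^esub>" for n b
    by metis
  moreover have "gpow i (a * int m) = replicate (nat \<bar>a\<bar> * m) (i, 0 \<le> a * int m)"
    by (simp add: gpow_def abs_mult nat_mult_distrib)
  ultimately show ?thesis by simp
qed

lemma quot_elem_insert_torsion:
  assumes "i \<in> {1..k}" "d i = enat m" "u \<in> words k" "v \<in> words k"
  shows "quot_elem k d (u @ gpow i (a * int m) @ inv_word u @ v) = quot_elem k d v"
proof -
  interpret G: group "quot_group k d" by (rule group_quot_group)
  let ?q = "quot_elem k d"
  note iu = inv_word_words[OF assms(3)]
  have c: "?q u \<in> carrier (quot_group k d)" "?q (inv_word u) \<in> carrier (quot_group k d)" "?q v \<in> carrier (quot_group k d)"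
    using assms iu by (auto intro: quot_elem_carrier)
  have "?q (u @ gpow i (a * int m) @ inv_word u @ v) =
      ?q u \<otimes>\<^bsub>quot_group k d\<^esub> (?q (gpow i (a * int m)) \<otimes>\<^bsub>quot_group k d\<^esub> (?q (inv_word u) \<otimes>\<^bsub>quot_group k d\<^esub> ?q v))"
    using assms iu gpow_in_words[OF assms(1)] by (simp add: quot_elem_append)
  also have "\<dots> = (?q u \<otimes>\<^bsub>quot_group k d\<^esub> ?q (inv_word u)) \<otimes>\<^bsub>quot_group k d\<^esub> ?q v"
    using c by (simp add: quot_elem_torsion[where d = d, OF assms(1,2)] G.m_assoc)
  also have "?q u \<otimes>\<^bsub>quot_group k d\<^esub> ?q (inv_word u) = \<one>\<^bsub>quot_group k d\<^esub>"
    using quot_elem_inv_word[OF assms(3)] c G.inv_comm by blast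
  finally show ?thesis using c by simp
qed

lemma infinite_order_cong:
  "quot_elem k d u = quot_elem k d v \<Longrightarrow> infinite_order k d u \<longleftrightarrow> infinite_order k d v"
  by (simp add: infinite_order_def)

text \<open>From \<open>(xy) ^ m x = x (yx) ^ m\<close>, torsion of \<open>yx\<close> implies torsion of \<open>xy\<close>.\<close>

lemma infinite_order_rotate:
  assumes "u \<in> words k" "v \<in> words k" "infinite_order k d (u @ v)"
  shows "infinite_order k d (v @ u)"
proof -
  interpret G: group "quot_group k d" by (rule group_quot_group)
  let ?x = "quot_elem k d u" and ?y = "quot_elem k d v"
  have c: "?x \<in> carrier (quot_group k d)" "?y \<in> carrier (quot_group k d)"
    using assms by (auto intro: quot_elem_carrier)
  have swap: "(?x \<otimes>\<^bsub>quot_group k d\<^esub> ?y) [^]\<^bsub>quot_group k d\<^esub> (m :: nat) \<otimes>\<^bsub>quot_group k d\<^esub> ?x =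
    ?x \<otimes>\<^bsub>quot_group k d\<^esub> (?y \<otimes>\<^bsub>quot_group k d\<^esub> ?x) [^]\<^bsub>quot_group k d\<^esub> m" for m
  proof (induction m)
    case (Suc m)
    have "(?x \<otimes>\<^bsub>quot_group k d\<^esub> ?y) [^]\<^bsub>quot_group k d\<^esub> Suc m \<otimes>\<^bsub>quot_group k d\<^esub> ?x =
        ((?x \<otimes>\<^bsub>quot_group k d\<^esub> ?y) [^]\<^bsub>quot_group k d\<^esub> m \<otimes>\<^bsub>quot_group k d\<^esub> ?x) \<otimes>\<^bsub>quot_group k d\<^esub> (?y \<otimes>\<^bsub>quot_group k d\<^esub> ?x)"
      using c by (simp add: G.m_assoc)
    then show ?case using Suc c by (simp add: G.m_assoc)
  qed (use c in simp)
  have "(?x \<otimes>\<^bsub>quot_group k d\<^esub> ?y) [^]\<^bsub>quot_group k d\<^esub> m = \<one>\<^bsub>quot_group k d\<^esub>"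
    if "(?y \<otimes>\<^bsub>quot_group k d\<^esub> ?x) [^]\<^bsub>quot_group k d\<^esub> (m :: nat) = \<one>\<^bsub>quot_group k d\<^esub>" for m
    using swap[of m] that c by (simp add: G.l_cancel_one')
  moreover have "\<forall>m::nat. m \<noteq> 0 \<longrightarrow> (?x \<otimes>\<^bsub>quot_group k d\<^esub> ?y) [^]\<^bsub>quot_group k d\<^esub> m \<noteq> \<one>\<^bsub>quot_group k d\<^esub>"
    using assms infinite_order_iff[of "u @ v" k d] by (simp add: quot_elem_append)
  ultimately have "\<forall>m::nat. m \<noteq> 0 \<longrightarrow> (?y \<otimes>\<^bsub>quot_group k d\<^esub> ?x) [^]\<^bsub>quot_group k d\<^esub> m \<noteq> \<one>\<^bsub>quot_group k d\<^esub>"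
    by blast
  then show ?thesis
    using assms infinite_order_iff[of "v @ u" k d] by (simp add: quot_elem_append)
qed

lemma cyc_step_infinite_order:
  assumes "cyc_step k d w v" "infinite_order k d w"
  shows "w \<in> words k \<and> v \<in> words k \<and> infinite_order k d v"
  using assms
proof cases
  case (rotate u v')
  then show ?thesis using assms infinite_order_rotate by auto
next
  case (conj i m a u)
  then show ?thesis
    using assms infinite_order_cong[OF quot_elem_insert_torsion[of i k d m u v a]] gpow_in_words inv_word_words
    by auto
next
  case (power i m a b v')
  then have "v \<in> words k" using gpow_in_words by simp
  then show ?thesis
    using assms power infinite_order_cong[OF quot_elem_insert_torsion[of i k d m "[]" v a]] gpow_in_words
    by (auto simp: inv_word_def)
qed

lemma infinite_order_partial_cyc_reduction:
  assumes "partial_cyc_reduction k d w v" "infinite_order k d w"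
  shows "infinite_order k d v"
  using assms unfolding partial_cyc_reduction_def
  by (induction rule: rtranclp_induct) (auto dest: cyc_step_infinite_order)

lemma not_infinite_order_gpow:
  assumes "i \<in> {1..k}" "d i = enat m" "m \<noteq> 0"
  shows "\<not> infinite_order k d (gpow i a)"
proof -
  have "concat (replicate m (gpow i a)) = gpow i (a * int m)"
  proof -
    have "concat (replicate n (replicate c x)) = replicate (n * c) x" for n c and x :: letter
      by (induction n) (simp_all add: replicate_add)
    then show ?thesis using assms(3)
      by (simp add: gpow_def abs_mult nat_mult_distrib mult.commute zero_le_mult_iff)
  qed
  then have "quot_elem k d (gpow i a) [^]\<^bsub>quot_group k d\<^esub> m = \<one>\<^bsub>quot_group k d\<^esub>"
    using quot_elem_pow[OF gpow_in_words[OF assms(1)]] quot_elem_torsion[where d = d, OF assms(1,2)] by simp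
  then show ?thesis using infinite_order_iff[OF gpow_in_words[OF assms(1)]] assms(3) by blast
qed

lemma gpow_0 [simp]: "gpow i 0 = []"
  by (simp add: gpow_def)

lemma not_infinite_order_Nil: "\<not> infinite_order k d []"
proof -
  interpret G: group "quot_group k d" by (rule group_quot_group)
  show ?thesis using infinite_order_iff[of "[]" k d] by (auto simp: quot_elem_Nil intro: exI[of _ 1])
qed

section \<open>Existence of cyclic reductions\<close>

lemma gpow_Cons:
  assumes "a \<noteq> 0" "b \<longleftrightarrow> 0 \<le> a"
  shows "(i, b) # gpow i a = gpow i (if b then a + 1 else a - 1)"
proof (cases b)
  case True
  then have "nat \<bar>a + 1\<bar> = Suc (nat \<bar>a\<bar>)" using assms by auto
  then show ?thesis using True assms by (simp add: gpow_def)
next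
  case False
  then have "nat \<bar>a - 1\<bar> = Suc (nat \<bar>a\<bar>)" using assms by auto
  then show ?thesis using False assms by (simp add: gpow_def)
qed

lemma gpow_append:
  assumes "0 \<le> a \<and> 0 \<le> b \<or> a \<le> 0 \<and> b \<le> 0"
  shows "gpow i a @ gpow i b = gpow i (a + b)"
proof -
  have *: "nat \<bar>a + b\<bar> = nat \<bar>a\<bar> + nat \<bar>b\<bar>" using assms by auto
  show ?thesis
  proof (cases "a = 0 \<or> b = 0")
    case False
    then have "(0 \<le> a) = (0 \<le> a + b)" "(0 \<le> b) = (0 \<le> a + b)" using assms by auto
    then show ?thesis unfolding gpow_def * replicate_add by simp
  qed auto
qed

text \<open>In a reduced word, consecutive letters with the same index have the same sign.\<close>

lemma reduced_syllables:
  assumes "reduced w" "w \<in> words k"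
  shows "\<exists>ss. w = syllable_word ss \<and> (\<forall>(i, a)\<in>set ss. i \<in> {1..k} \<and> a \<noteq> 0) \<and>
    successively (\<lambda>p q. fst p \<noteq> fst q) ss"
  using assms
proof (induction w)
  case Nil
  then show ?case by (intro exI[of _ "[]"]) simp
next
  case (Cons x w)
  obtain i b where x: "x = (i, b)" by (cases x)
  have i: "i \<in> {1..k}" using Cons.prems x by simp
  have "reduced w" "w \<in> words k" using Cons.prems by (auto simp: reduced_def successively_Cons)
  then obtain ss where ss: "w = syllable_word ss" "\<forall>(i, a)\<in>set ss. i \<in> {1..k} \<and> a \<noteq> 0"
    "successively (\<lambda>p q. fst p \<noteq> fst q) ss" using Cons.IH by blast
  have single: "gpow i (if b then 1 else - 1) = [x]" by (simp add: gpow_def x)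
  show ?case
  proof (cases ss)
    case Nil
    then show ?thesis using ss i single by (intro exI[of _ "[(i, if b then 1 else - 1)]"]) auto
  next
    case (Cons s ss')
    obtain j a where s: "s = (j, a)" by (cases s)
    have a: "a \<noteq> 0" using ss(2) Cons s by auto
    show ?thesis
    proof (cases "j = i")
      case False
      then show ?thesis using ss i single Cons s
        by (intro exI[of _ "(i, if b then 1 else - 1) # ss"]) (auto simp: successively_Cons)
    next
      case True
      obtain n where n: "nat \<bar>a\<bar> = Suc n" using a by (cases "nat \<bar>a\<bar>") auto
      have "hd w = (i, 0 \<le> a)" "w \<noteq> []" using ss(1) Cons s True n by (auto simp: gpow_def)
      moreover have "w \<noteq> [] \<Longrightarrow> hd w \<noteq> inv_letter x"
        using Cons.prems(1) by (auto simp: reduced_def successively_Cons)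
      ultimately have b: "b \<longleftrightarrow> 0 \<le> a" using x by (auto simp: inv_letter_def)
      have "x # w = syllable_word ((i, if b then a + 1 else a - 1) # ss')"
        using gpow_Cons[OF a b, of i] ss(1) Cons s True x by simp
      moreover have "(if b then a + 1 else a - 1) \<noteq> 0" using a b by auto
      ultimately show ?thesis using ss Cons s True i
        by (intro exI[of _ "(i, if b then a + 1 else a - 1) # ss'"]) (auto simp: successively_Cons)
    qed
  qed
qed

lemma hd_gpow: "a \<noteq> 0 \<Longrightarrow> hd (gpow i a) = (i, 0 \<le> a)" 
  and last_gpow: "a \<noteq> 0 \<Longrightarrow> last (gpow i a) = (i, 0 \<le> a)"
  and gpow_eq_Nil: "gpow i a = [] \<longleftrightarrow> a = 0"
  by (auto simp: gpow_def)

lemma syllable_word_ends: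
  assumes "ss \<noteq> []" "\<forall>(i, a)\<in>set ss. a \<noteq> 0"
  shows "syllable_word ss \<noteq> []" "fst (hd (syllable_word ss)) = fst (hd ss)"
    "fst (last (syllable_word ss)) = fst (last ss)"
proof -
  obtain i a ss' where 1: "ss = (i, a) # ss'" "a \<noteq> 0" using assms by (cases ss) auto
  then show "syllable_word ss \<noteq> []" "fst (hd (syllable_word ss)) = fst (hd ss)"
    by (simp_all add: gpow_eq_Nil hd_gpow)
  obtain j b ss'' where 2: "ss = ss'' @ [(j, b)]" "b \<noteq> 0"
    using assms by (cases ss rule: rev_cases) auto
  then show "fst (last (syllable_word ss)) = fst (last ss)"
    by (simp add: gpow_eq_Nil last_gpow)
qed

lemma inv_letter_eq_iff: "y = inv_letter x \<longleftrightarrow> x = inv_letter y"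
  by (auto simp: inv_letter_def prod_eq_iff)

lemma cyclically_reduced_rotate:
  assumes "cyclically_reduced (u @ v)"
  shows "cyclically_reduced (v @ u)"
  using assms by (cases "u = []"; cases "v = []")
    (auto simp: cyclically_reduced_def reduced_def successively_append_iff inv_letter_eq_iff)

text \<open>If the first and the last syllable have the same index, then they have the same sign, and a rotation
merges them.\<close>

lemma cyclic_syllables:
  assumes "cyclically_reduced w" "w \<in> words k"
  shows "\<exists>u v ss. w = u @ v \<and> v @ u = syllable_word ss \<and> (\<forall>(i, a)\<in>set ss. i \<in> {1..k} \<and> a \<noteq> 0) \<and>
    successively (\<lambda>p q. fst p \<noteq> fst q) ss \<and> (2 \<le> length ss \<longrightarrow> fst (last ss) \<noteq> fst (hd ss))"
proof -
  obtain ss where ss: "w = syllable_word ss" "\<forall>(i, a)\<in>set ss. i \<in> {1..k} \<and> a \<noteq> 0"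
    "successively (\<lambda>p q. fst p \<noteq> fst q) ss"
    using reduced_syllables[of w k] assms by (auto simp: cyclically_reduced_def)
  show ?thesis
  proof (cases "2 \<le> length ss \<and> fst (last ss) = fst (hd ss)")
    case False
    then show ?thesis using ss by (intro exI[of _ "[]"] exI[of _ w] exI[of _ ss]) auto
  next
    case True
    obtain i a ss1 where s1': "ss = (i, a) # ss1" using True by (cases ss) auto
    then have s1: "ss = (i, a) # ss1" "ss1 \<noteq> []" using True by auto
    obtain j b ss2 where s2: "ss1 = ss2 @ [(j, b)]" using s1(2) by (cases ss1 rule: rev_cases) auto
    have j: "j = i" using True s1 s2 by simp
    have ne: "ss2 \<noteq> []" using ss(3) s1 s2 j by auto
    have ab: "a \<noteq> 0" "b \<noteq> 0" "i \<in> {1..k}" using ss(2) s1 s2 by auto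
    have w: "w = gpow i a @ syllable_word ss2 @ gpow i b" using ss(1) s1 s2 j by simp
    have "w \<noteq> []" "hd w = (i, 0 \<le> a)" "last w = (i, 0 \<le> b)"
      unfolding w using ab by (simp_all add: gpow_eq_Nil hd_gpow last_gpow)
    then have "(0 \<le> a) = (0 \<le> b)"
      using assms(1) by (auto simp: cyclically_reduced_def inv_letter_def)
    then have "gpow i b @ gpow i a = gpow i (b + a)" "b + a \<noteq> 0"
      using ab by (auto intro!: gpow_append)
    moreover have "fst (last ss2) \<noteq> i" "fst (hd ss2) \<noteq> i" "successively (\<lambda>p q. fst p \<noteq> fst q) ss2"
      using ss(3) s1 s2 j ne by (auto simp: successively_append_iff successively_Cons)
    ultimately show ?thesis
      using w ss(2) s1 s2 ab ne
      by (intro exI[of _ "gpow i a @ syllable_word ss2"] exI[of _ "gpow i b"] exI[of _ "(i, b + a) # ss2"])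
        (auto simp: successively_Cons)
  qed
qed

lemma inv_word_simps [simp]: "inv_word [] = []" "inv_word (u @ v) = inv_word v @ inv_word u"
  "inv_word (inv_word u) = u"
  by (simp_all add: inv_word_def rev_map inv_letter_def comp_def)

lemma reduced_conj_decomposition:
  assumes "reduced v"
  shows "\<exists>u x. v = u @ x @ inv_word u \<and> cyclically_reduced x"
  using assms
proof (induction v rule: length_induct)
  case (1 v)
  show ?case
  proof (cases "cyclically_reduced v")
    case True
    then show ?thesis by (intro exI[of _ "[]"] exI[of _ v]) simp
  next
    case False
    then have v: "v \<noteq> []" "last v = inv_letter (hd v)" using 1(2) by (auto simp: cyclically_reduced_def)
    obtain y v1 where v1: "v = y # v1" using v(1) by (cases v) auto
    have "v1 \<noteq> []"
    proof
      assume "v1 = []"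
      then have "y = inv_letter y" using v v1 by simp
      then show False by (simp add: inv_letter_def prod_eq_iff)
    qed
    then obtain z v2 where v2: "v1 = v2 @ [z]" by (cases v1 rule: rev_cases) auto
    have z: "z = inv_letter y" using v v1 v2 by simp
    have "reduced v2" using 1(2) v1 v2 by (auto simp: reduced_def successively_Cons successively_append_iff)
    then obtain u x where "v2 = u @ x @ inv_word u" "cyclically_reduced x"
      using 1(1)[rule_format, of v2] v1 v2 by auto
    then show ?thesis using v1 v2 z
      by (intro exI[of _ "y # u"] exI[of _ x]) (simp add: inv_word_def)
  qed
qed

lemma cyc_reductions_step:
  "(cyc_step k d)\<^sup>*\<^sup>* w v \<Longrightarrow> x \<in> cyc_reductions k d v \<Longrightarrow> x \<in> cyc_reductions k d w"
  by (auto simp: cyc_reductions_def partial_cyc_reduction_def)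

text \<open>Induction on the length, through cyclically reduced words. Rotate a syllable \<open>g ^ a\<close> with
\<open>|a| \<ge> d\<close> to the front and write \<open>a = cd + \<beta>\<close> with \<open>|\<beta>| < d\<close>, where \<open>cd\<close> and \<open>\<beta>\<close> do not
have opposite signs. If \<open>\<beta> \<noteq> 0\<close>, or if nothing else is left, deleting \<open>g ^ (cd)\<close> leaves a cyclically
reduced word. If \<open>\<beta> = 0\<close>, the rest is \<open>u x u\<inverse>\<close> with \<open>x\<close> cyclically reduced, and a rotation
exhibits a conjugate of \<open>g ^ (cd)\<close> in front of \<open>x\<close>.\<close>

lemma cyc_reduction_exists:
  assumes "\<And>i. i \<in> {1..k} \<Longrightarrow> d i \<noteq> 0" "w \<in> words k" "cyclically_reduced w"
  shows "cyc_reductions k d w \<noteq> {}"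
  using assms(2,3)
proof (induction w rule: length_induct)
  case (1 w)
  obtain u v ss where w: "w = u @ v" and ss: "v @ u = syllable_word ss" "\<forall>(i, a)\<in>set ss. i \<in> {1..k} \<and> a \<noteq> 0"
    "successively (\<lambda>p q. fst p \<noteq> fst q) ss" "2 \<le> length ss \<longrightarrow> fst (last ss) \<noteq> fst (hd ss)"
    using cyclic_syllables[OF 1(3,2)] by blast
  have uv: "u \<in> words k" "v \<in> words k" using 1(2) w by auto
  have rot: "cyc_step k d w (v @ u)" unfolding w by (rule cyc_step.rotate[OF uv])
  show ?case
  proof (cases "\<forall>(i, a)\<in>set ss. enat (nat \<bar>a\<bar>) < d i")
    case True
    have "d_cyclically_reduced k d (v @ u)"
      unfolding d_cyclically_reduced_def
      using ss True by (intro exI[of _ ss]) (auto simp: syllable_word_def)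
    then have "v @ u \<in> cyc_reductions k d w"
      using rot by (auto simp: cyc_reductions_def partial_cyc_reduction_def)
    then show ?thesis by blast
  next
    case False
    then obtain i a where ia: "(i, a) \<in> set ss" "\<not> enat (nat \<bar>a\<bar>) < d i" by auto
    then have i: "i \<in> {1..k}" "a \<noteq> 0" using ss(2) by auto
    obtain m where m: "d i = enat m" using ia(2) by (cases "d i") auto
    have m0: "m > 0" using assms(1)[OF i(1)] m by (auto simp: enat_0_iff)
    have ma: "m \<le> nat \<bar>a\<bar>" using ia(2) m by simp
    obtain pre post where pp: "ss = pre @ (i, a) # post" using split_list[OF ia(1)] by blast
    define v' where "v' = syllable_word (post @ pre)"
    have ends: "fst (hd v') \<noteq> i \<and> fst (last v') \<noteq> i" if "v' \<noteq> []"
    proof -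
      have ne: "post @ pre \<noteq> []" using that by (auto simp: v'_def)
      have nz: "\<forall>(i, a)\<in>set (post @ pre). a \<noteq> 0" using ss(2) pp by auto
      have "2 \<le> length ss" using ne pp by (cases pre; cases post) auto
      then have lh: "fst (last ss) \<noteq> fst (hd ss)" using ss(4) by simp
      have "fst (hd (post @ pre)) \<noteq> i"
        using ss(3) pp lh ne by (cases "post = []") (auto simp: successively_append_iff successively_Cons)
      moreover have "fst (last (post @ pre)) \<noteq> i"
        using ss(3) pp lh ne by (cases "pre = []") (auto simp: successively_append_iff successively_Cons)
      ultimately show ?thesis using syllable_word_ends[OF ne nz] by (simp add: v'_def)
    qed
    have w1: "v @ u = syllable_word pre @ (gpow i a @ syllable_word post)" using ss(1) pp by simp
    have "cyclically_reduced (v @ u)" using 1(3) cyclically_reduced_rotate unfolding w by blast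
    then have cr2: "cyclically_reduced (gpow i a @ v')"
      using cyclically_reduced_rotate[of "syllable_word pre" "gpow i a @ syllable_word post"] w1
      by (simp add: v'_def)
    have wpp: "syllable_word pre \<in> words k" "gpow i a @ syllable_word post \<in> words k"
      using uv w1 by (metis words_simps(3))+
    then have v'w: "v' \<in> words k" by (simp add: v'_def)
    have len: "length w = length (gpow i a) + length v'"
      using arg_cong[OF w1, of length] w by (simp add: v'_def)
    have to2: "(cyc_step k d)\<^sup>*\<^sup>* w (gpow i a @ v')"
    proof -
      have "cyc_step k d (v @ u) (gpow i a @ v')"
        using cyc_step.rotate[OF wpp, of d] w1 by (simp add: v'_def)
      then show ?thesis using rot by (meson r_into_rtranclp rtranclp.rtrancl_into_rtrancl)
    qed
    define c where "c = sgn a * int (nat \<bar>a\<bar> div m)"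
    define \<beta> where "\<beta> = sgn a * int (nat \<bar>a\<bar> mod m)"
    have q: "nat \<bar>a\<bar> div m \<ge> 1" using ma m0 by (simp add: Suc_le_eq div_greater_zero_iff)
    have "int (nat \<bar>a\<bar>) = int (nat \<bar>a\<bar> div m * m + nat \<bar>a\<bar> mod m)" by (simp only: div_mult_mod_eq)
    then have abs: "\<bar>a\<bar> = int (nat \<bar>a\<bar> div m) * int m + int (nat \<bar>a\<bar> mod m)"
      unfolding of_nat_add of_nat_mult nat_0_le[OF abs_ge_zero] .
    have a: "a = c * int m + \<beta>"
    proof -
      have "a = sgn a * \<bar>a\<bar>" by (simp add: sgn_mult_abs)
      also have "\<dots> = c * int m + \<beta>" unfolding c_def \<beta>_def by (subst abs) (simp add: algebra_simps)
      finally show ?thesis .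
    qed
    have c0: "c \<noteq> 0" using q i(2) by (auto simp: c_def sgn_if)
    have b: "\<bar>\<beta>\<bar> < int m" using m0 by (simp add: \<beta>_def abs_mult sgn_if)
    have ga: "gpow i a = gpow i (c * int m) @ gpow i \<beta>"
      unfolding a by (rule gpow_append[symmetric]) (auto simp: c_def \<beta>_def sgn_if)
    have short: "length (gpow i \<beta>) < length (gpow i a)"
  proof -
      have "nat \<bar>\<beta>\<bar> < nat \<bar>a\<bar>" using b ma by linarith
      then show ?thesis unfolding gpow_def length_replicate .
    qed
    show ?thesis
    proof (cases "\<beta> = 0 \<and> v' \<noteq> []")
      case False
      have "cyclically_reduced (gpow i \<beta> @ v')"
        unfolding cyclically_reduced_def
      proof (intro conjI impI)
        show "reduced (gpow i \<beta> @ v')"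
          using cr2 unfolding ga by (auto simp: cyclically_reduced_def reduced_def successively_append_iff)
        assume ne: "gpow i \<beta> @ v' \<noteq> []"
        then have b0: "\<beta> \<noteq> 0" using False by auto
        show "last (gpow i \<beta> @ v') \<noteq> inv_letter (hd (gpow i \<beta> @ v'))"
        proof (cases "v' = []")
          case True
          then show ?thesis using b0 by (simp add: hd_gpow last_gpow inv_letter_def)
        next
          case False
          then show ?thesis using b0 ends by (auto simp: hd_gpow gpow_eq_Nil inv_letter_def)
        qed
      qed
      moreover have "cyc_step k d (gpow i (c * int m) @ gpow i \<beta> @ v') (gpow i \<beta> @ v')"
        using cyc_step.power[where d = d, OF i(1) m c0 b v'w _ HOL.refl] ends by blast
      moreover have "gpow i \<beta> @ v' \<in> words k" using v'w gpow_in_words[OF i(1)] by simp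
      ultimately obtain x where "x \<in> cyc_reductions k d (gpow i \<beta> @ v')"
        "cyc_step k d (gpow i a @ v') (gpow i \<beta> @ v')"
        using 1(1)[rule_format, of "gpow i \<beta> @ v'"] len short ga by auto
      then show ?thesis using cyc_reductions_step to2 by (metis empty_iff rtranclp.rtrancl_into_rtrancl)
    next
      case True
      have g: "gpow i a = gpow i (c * int m)" using ga True by simp
      have "reduced v'" using cr2 by (auto simp: cyclically_reduced_def reduced_def successively_append_iff)
      then obtain u1 x where ux: "v' = u1 @ x @ inv_word u1" "cyclically_reduced x"
        using reduced_conj_decomposition by blast
      have wx: "u1 \<in> words k" "x \<in> words k" "inv_word u1 \<in> words k" using v'w ux(1) by auto
      have "length x \<le> length v'" using ux(1) by simp
      then have "length x < length w" using len short by linarith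
      then obtain y where y: "y \<in> cyc_reductions k d x" using 1(1) wx(2) ux(2) by blast
      have "(cyc_step k d)\<^sup>*\<^sup>* (gpow i a @ v') x"
      proof (cases "u1 = []")
        case u1: True
        have "cyc_step k d (gpow i (c * int m) @ v') v'"
          using cyc_step.power[where d = d and b = 0, OF i(1) m c0 _ v'w] ends m0 by simp
        then show ?thesis using g ux(1) u1 by auto
      next
        case False
        then have ne: "inv_word u1 \<noteq> []" by (simp add: inv_word_def)
        have "cyc_step k d ((gpow i a @ u1 @ x) @ inv_word u1) (inv_word u1 @ gpow i a @ u1 @ x)"
          using wx gpow_in_words[OF i(1)] by (intro cyc_step.rotate) auto
        moreover have "cyc_step k d (inv_word u1 @ gpow i (c * int m) @ inv_word (inv_word u1) @ x) x"
          using wx ne ux(2) by (intro cyc_step.conj[where d = d, OF i(1) m c0])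
        ultimately show ?thesis using ux(1) g by auto
      qed
      then show ?thesis using y to2 cyc_reductions_step by (metis empty_iff rtranclp_trans)
    qed
  qed
qed

section \<open>Expected number of cycles\<close>

text \<open>This is the count of embeddings of isolated vertices into the graph of the identity.\<close>

lemma card_injections_ge:
  assumes "finite (V :: 'b set)" "finite (X :: nat set)" "card X \<ge> 1"
  shows "real (card (injections V X)) \<ge> real (card X) ^ card V * (1 - real (card V) * real (card V) / card X)"
proof -
  let ?P = "(\<lambda>v. [v]) ` V"
  have U: "(\<Union>xs\<in>?P. set xs) = V" by auto
  have cP: "card ?P = card V" by (rule card_image) (simp add: inj_on_def)
  have G: "{x\<in>X. card (orbit id x) \<ge> 1} = X"
  proof -
    have "orbit id x = {x}" for x :: nat by (simp add: orbit_eq_singleton_iff)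
    then show ?thesis by simp
  qed
  have "(card {x\<in>X. card (orbit id x) \<ge> 1} - card V) ^ card ?P \<le>
    card {\<psi> \<in> injections (\<Union>xs\<in>?P. set xs) X. \<forall>xs\<in>?P. walk id (map \<psi> xs) \<and> card (orbit id (\<psi> (hd xs))) \<ge> 1}"
    by (rule card_embeddings_ge) (use assms in \<open>auto simp: disjoint_family_on_def permutes_id[unfolded id_def] U id_def\<close>)
  also have "\<dots> \<le> card (injections V X)"
    unfolding U using assms by (intro card_mono finite_injections) auto
  finally have "(card X - card V) ^ card V \<le> card (injections V X)" unfolding G cP .
  then have "real ((card X - card V) ^ card V) \<le> real (card (injections V X))" by (rule of_nat_mono)
  moreover have "real (card X) ^ card V * (1 - card V * (real (card X - card X) + card V) / card X) \<le> real ((card X - card V) ^ card V)"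
    using assms(3) by (intro power_diff_nat_ge) auto
  ultimately have "real (card X) ^ card V * (1 - card V * (real (card X - card X) + card V) / card X) \<le>
      real (card (injections V X))" by (rule order_trans[rotated])
  then show ?thesis by simp
qed

lemma Sup_enat_attained:
  assumes "B \<noteq> {}" "enat R \<le> (SUP j\<in>B. enat j)"
  shows "\<exists>D\<in>B. R \<le> D"
proof (rule ccontr)
  assume "\<not> ?thesis"
  then have less: "\<And>D. D \<in> B \<Longrightarrow> D < R" by force
  then have R: "R > 0" using assms(1) by (metis ex_in_conv gr_zeroI not_less_zero)
  have "(SUP j\<in>B. enat j) \<le> enat (R - 1)" using less R by (intro SUP_least) fastforce
  then have "enat R \<le> enat (R - 1)" using assms(2) by (rule order_trans[rotated])
  then show False using R by simp
qed

context coloured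
begin

text \<open>The part of \<open>model\<close> that concerns colour \<open>i\<close>.\<close>

definition realizes :: "(nat \<Rightarrow> nat list set) \<Rightarrow> nat \<Rightarrow> (nat \<Rightarrow> nat) \<Rightarrow> (nat \<Rightarrow> nat) \<Rightarrow> bool" where
  "realizes C i \<phi> \<sigma> \<longleftrightarrow> (\<forall>xs\<in>C i. comp_walk (d i) \<sigma> (map \<phi> xs)) \<and> closed_walk \<sigma> (map \<phi> (Z i))"

definition colour_sets :: "(nat \<Rightarrow> nat set) \<Rightarrow> bool" where
  "colour_sets A \<longleftrightarrow> (\<forall>i\<in>{1..k}. A i \<noteq> {} \<and> A i \<subseteq> {1..} \<and> d i = (SUP j\<in>A i. enat j) \<and>
    (Z i \<noteq> [] \<longrightarrow> length (Z i) \<in> A i \<and> (\<exists>L>0. cyc_density (A i) \<longlonglongrightarrow> L)))"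

lemma realizes_density:
  fixes \<epsilon> :: real
  assumes G: "graph V C" and i: "i \<in> {1..k}" and A: "colour_sets A" and e: "\<epsilon> > 0"
  shows "\<exists>n0. \<forall>X :: nat set. \<forall>\<phi>. finite X \<longrightarrow> n0 \<le> card X \<longrightarrow> inj_on \<phi> V \<longrightarrow> \<phi> ` V \<subseteq> X \<longrightarrow>
    (1 - \<epsilon>) * real (card X) ^ card (C i) * card (cyc_perms X (A i)) \<le>
    real (card {\<sigma> \<in> cyc_perms X (A i). realizes C i \<phi> \<sigma>}) * real (card X) ^ card V"
proof -
  have Ai: "A i \<noteq> {}" "A i \<subseteq> {1..}" "d i = (SUP j\<in>A i. enat j)"
    "Z i \<noteq> [] \<Longrightarrow> length (Z i) \<in> A i \<and> (\<exists>L>0. cyc_density (A i) \<longlonglongrightarrow> L)"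
    using A i unfolding colour_sets_def by blast+
  have le_d: "enat j \<le> d i" if "j \<in> A i" for j unfolding Ai(3) using that by (rule SUP_upper)
  \<comment> \<open>A full cycle needs points in cycles of length \<open>d i\<close>; a path only needs a cycle that is not shorter.\<close>
  define R where "R = (case d i of enat m \<Rightarrow> m | \<infinity> \<Rightarrow> Max (insert 0 (length ` C i)))"
  have fC: "finite (C i)" using graphD(1)[OF G i] .
  have "enat R \<le> d i" by (simp add: R_def split: enat.splits)
  then obtain D where D: "D \<in> A i" "R \<le> D" using Sup_enat_attained[OF Ai(1)] Ai(3) by metis
  have len: "length xs \<le> R" if "xs \<in> C i" for xs
  proof (cases "d i")
    case (enat m)
    then show ?thesis using graphD(8)[OF G i that] d_ge_2[OF i] by (auto simp: R_def numeral_eq_enat)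
  next
    case infinity
    then show ?thesis using fC that by (auto simp: R_def)
  qed
  have lenR: "length xs = R" if "enat (length xs) = d i" for xs :: "nat list"
    using that by (auto simp: R_def split: enat.splits)
  have P: "xs \<noteq> [] \<and> distinct xs \<and> length xs \<le> R" if "xs \<in> C i" for xs
    using graphD(5,6)[OF G i that] len[OF that] by simp
  note U = graphD(4)[OF G i] and disj = graphD(3)[OF G i]
  show ?thesis
  proof (cases "Z i = []")
    case True
    have "V = (\<Union>xs\<in>C i. set xs)" using U True by simp
    from realizing_density[OF Ai(2) D le_d fC P lenR disj this e] show ?thesis
      using True by (simp add: realizes_def closed_walk_def)
  next
    case False
    have inf: "d i = \<infinity>" using Z_infinite[OF i False] .
    have V: "V = (V - set (Z i)) \<union> set (Z i)" using graphD(2)[OF G i] by blast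
    have "\<exists>n0. \<forall>X :: nat set. \<forall>\<phi>. finite X \<longrightarrow> n0 \<le> card X \<longrightarrow>
      inj_on \<phi> ((V - set (Z i)) \<union> set (Z i)) \<longrightarrow> \<phi> ` ((V - set (Z i)) \<union> set (Z i)) \<subseteq> X \<longrightarrow>
      (1 - \<epsilon>) * real (card X) ^ card (C i) * card (cyc_perms X (A i)) \<le>
      real (card {\<sigma> \<in> cyc_perms X (A i). (\<forall>xs\<in>C i. walk \<sigma> (map \<phi> xs)) \<and> closed_walk \<sigma> (map \<phi> (Z i))}) *
        real (card X) ^ card ((V - set (Z i)) \<union> set (Z i))"
      using Ai(4)[OF False] distinct_Z[OF i]
      by (intro realizing_density_with_cycle[OF Ai(2) D _ fC P disj U[symmetric] _ _ _ e]) auto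
    then show ?thesis unfolding V[symmetric] realizes_def inf comp_walk_infinity .
  qed
qed

text \<open>The powers of \<open>n\<close> cancel because the Euler characteristic is zero. There are \<open>k + 1\<close> error factors
\<open>1 - \<delta>\<close>: one for each colour and one for the number of injections.\<close>

lemma expected_models_ge:
  fixes \<epsilon> :: real
  assumes G: "graph V C" "euler V C = 0" and A: "colour_sets A" and e: "0 < \<epsilon>" "\<epsilon> < 1"
  shows "\<exists>n0. \<forall>n\<ge>n0. (\<forall>i\<in>{1..k}. cyc_perms {1..n} (A i) \<noteq> {}) \<longrightarrow>
    1 - \<epsilon> \<le> (\<Sum>\<phi>\<in>injections V {1..n}. \<Prod>i\<in>{1..k}.
      real (card {\<sigma> \<in> cyc_perms {1..n} (A i). realizes C i \<phi> \<sigma>}) / card (cyc_perms {1..n} (A i)))"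
proof -
  define \<delta> where "\<delta> = \<epsilon> / (k + 1)"
  have d: "0 < \<delta>" "\<delta> < 1" using e by (auto simp: \<delta>_def field_simps)
  have fV: "finite V" using G(1) by (simp add: graph_def)
  define Q where "Q i m \<longleftrightarrow> (\<forall>X :: nat set. \<forall>\<phi>. finite X \<longrightarrow> m \<le> card X \<longrightarrow> inj_on \<phi> V \<longrightarrow> \<phi> ` V \<subseteq> X \<longrightarrow>
      (1 - \<delta>) * real (card X) ^ card (C i) * card (cyc_perms X (A i)) \<le>
      real (card {\<sigma> \<in> cyc_perms X (A i). realizes C i \<phi> \<sigma>}) * real (card X) ^ card V)" for i m
  have "\<exists>m. Q i m" if "i \<in> {1..k}" for i
    unfolding Q_def by (rule realizes_density[OF G(1) that A d(1)])
  then obtain N where N': "\<And>i. i \<in> {1..k} \<Longrightarrow> Q i (N i)" by metis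
  have N: "(1 - \<delta>) * real (card X) ^ card (C i) * card (cyc_perms X (A i)) \<le>
      real (card {\<sigma> \<in> cyc_perms X (A i). realizes C i \<phi> \<sigma>}) * real (card X) ^ card V"
    if "i \<in> {1..k}" "finite X" "N i \<le> card X" "inj_on \<phi> V" "\<phi> ` V \<subseteq> X" for i \<phi> and X :: "nat set"
    using N'[OF that(1), unfolded Q_def, rule_format, OF that(2-5)] .
  define n0 where "n0 = max (Max (insert 1 (N ` {1..k}))) (nat \<lceil>real (card V) * real (card V) / \<delta>\<rceil>)"
  have bal: "card V + (\<Sum>i\<in>{1..k}. card (C i)) = k * card V"
  proof -
    have "int (card V) + (\<Sum>i\<in>{1..k}. int (card (C i))) = int k * int (card V)"
      using G(2) by (simp add: euler_def sum_subtractf)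
    then show ?thesis by (metis of_nat_add of_nat_eq_iff of_nat_mult of_nat_sum)
  qed
  show ?thesis
  proof (intro exI[of _ n0] allI impI)
    fix n assume n: "n0 \<le> n" and ne: "\<forall>i\<in>{1..k}. cyc_perms {1..n} (A i) \<noteq> {}"
    have "Max (insert 1 (N ` {1..k})) \<le> n" using n by (simp add: n0_def)
    then have n1: "n \<ge> 1" "\<And>i. i \<in> {1..k} \<Longrightarrow> N i \<le> n" by simp_all
    have n2: "real (card V) * real (card V) / \<delta> \<le> n" using n unfolding n0_def by linarith
    let ?I = "injections V {1..n}"
    let ?q = "\<lambda>\<phi> i. real (card {\<sigma> \<in> cyc_perms {1..n} (A i). realizes C i \<phi> \<sigma>}) / card (cyc_perms {1..n} (A i))"
    have q: "(1 - \<delta>) * (real n ^ card (C i) / real n ^ card V) \<le> ?q \<phi> i" if "i \<in> {1..k}" "\<phi> \<in> ?I" for i \<phi>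
    proof -
      have "\<phi> ` V \<subseteq> {1..n}" "inj_on \<phi> V" using that(2) by (auto simp: injections_def)
      then have "(1 - \<delta>) * real n ^ card (C i) * card (cyc_perms {1..n} (A i)) \<le>
        real (card {\<sigma> \<in> cyc_perms {1..n} (A i). realizes C i \<phi> \<sigma>}) * real n ^ card V"
        using N[OF that(1), of "{1..n}" \<phi>] n1(2)[OF that(1)] by simp
      moreover have "card (cyc_perms {1..n} (A i)) > 0"
        using ne that(1) finite_cyc_perms[of "{1..n}"] by (simp add: card_gt_0_iff)
      moreover have "real n ^ card V > 0" using n1(1) by simp
      ultimately show ?thesis by (simp add: divide_simps mult_ac)
    qed
    have prod: "(1 - \<delta>) ^ k * (real n ^ (\<Sum>i\<in>{1..k}. card (C i)) / real n ^ (k * card V)) \<le> (\<Prod>i\<in>{1..k}. ?q \<phi> i)"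
      if "\<phi> \<in> ?I" for \<phi>
    proof -
      have "(\<Prod>i\<in>{1..k}. (1 - \<delta>) * (real n ^ card (C i) / real n ^ card V)) \<le> (\<Prod>i\<in>{1..k}. ?q \<phi> i)"
        using q that d by (intro prod_mono conjI) auto
      moreover have "(\<Prod>i\<in>{1..k}. (1 - \<delta>) * (real n ^ card (C i) / real n ^ card V)) =
          (1 - \<delta>) ^ k * (real n ^ (\<Sum>i\<in>{1..k}. card (C i)) / real n ^ (k * card V))"
        by (simp add: prod.distrib prod_dividef power_sum power_mult mult.commute[of k])
      ultimately show ?thesis by simp
    qed
    have "1 - \<epsilon> = 1 + real (k + 1) * (- \<delta>)" by (simp add: \<delta>_def)
    also have "\<dots> \<le> (1 + (- \<delta>)) ^ (k + 1)" using d by (intro Bernoulli_inequality) simp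
    also have "\<dots> = (1 - \<delta>) * (1 - \<delta>) ^ k" by simp
    also have "\<dots> = (real n ^ card V * (1 - \<delta>)) *
        ((1 - \<delta>) ^ k * (real n ^ (\<Sum>i\<in>{1..k}. card (C i)) / real n ^ (k * card V)))"
    proof -
      have "real n ^ card V * real n ^ (\<Sum>i\<in>{1..k}. card (C i)) = real n ^ (k * card V)"
        unfolding bal[symmetric] by (rule power_add[symmetric])
      then have "real n ^ card V * (real n ^ (\<Sum>i\<in>{1..k}. card (C i)) / real n ^ (k * card V)) = 1"
        using n1(1) by simp
      then have "(1 - \<delta>) * (1 - \<delta>) ^ k = ((1 - \<delta>) * (1 - \<delta>) ^ k) *
          (real n ^ card V * (real n ^ (\<Sum>i\<in>{1..k}. card (C i)) / real n ^ (k * card V)))" by (simp only: mult_1_right)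
      also have "\<dots> = (real n ^ card V * (1 - \<delta>)) *
        ((1 - \<delta>) ^ k * (real n ^ (\<Sum>i\<in>{1..k}. card (C i)) / real n ^ (k * card V)))" by (simp only: mult_ac)
      finally show ?thesis .
    qed
    also have "\<dots> \<le> real (card ?I) * ((1 - \<delta>) ^ k * (real n ^ (\<Sum>i\<in>{1..k}. card (C i)) / real n ^ (k * card V)))"
    proof (rule mult_right_mono)
      have "real (card V) * real (card V) / n \<le> \<delta>" using n2 n1(1) d(1) by (simp add: field_simps)
      then have "real n ^ card V * (1 - \<delta>) \<le> real n ^ card V * (1 - real (card V) * real (card V) / n)"
        by (intro mult_left_mono) auto
      also have "\<dots> \<le> real (card ?I)" using card_injections_ge[OF fV, of "{1..n}"] n1(1) by simp
      finally show "real n ^ card V * (1 - \<delta>) \<le> real (card ?I)" .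
    qed (use d in simp)
    also have "\<dots> = (\<Sum>\<phi>\<in>?I. (1 - \<delta>) ^ k * (real n ^ (\<Sum>i\<in>{1..k}. card (C i)) / real n ^ (k * card V)))"
      by simp
    also have "\<dots> \<le> (\<Sum>\<phi>\<in>?I. \<Prod>i\<in>{1..k}. ?q \<phi> i)" by (intro sum_mono prod)
    finally show "1 - \<epsilon> \<le> (\<Sum>\<phi>\<in>?I. \<Prod>i\<in>{1..k}. ?q \<phi> i)" .
  qed
qed

end

lemma num_cycles_times:
  assumes "\<sigma> permutes {1..n}"
  shows "l * num_cycles n l \<sigma> = card {x\<in>{1..n}. card (orbit \<sigma> x) = l}"
proof -
  let ?C = "{c \<in> cycles_on n \<sigma>. card c = l}"
  have self: "x \<in> orbit \<sigma> x" for x using self_in_orbit[OF assms] by simp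
  have U: "\<Union>?C = {x\<in>{1..n}. card (orbit \<sigma> x) = l}"
  proof (intro equalityI subsetI)
    fix y assume "y \<in> \<Union>?C"
    then obtain x where x: "x \<in> {1..n}" "card (orbit \<sigma> x) = l" "y \<in> orbit \<sigma> x" by (auto simp: cycles_on_def)
    have "orbit \<sigma> y = orbit \<sigma> x" using cyclic_on_orbit[OF assms] x(3) by (intro orbit_cyclic_eq3) auto
    then show "y \<in> {x\<in>{1..n}. card (orbit \<sigma> x) = l}"
      using x permutes_orbit_subset[OF assms x(1)] by auto
  next
    fix x assume "x \<in> {x\<in>{1..n}. card (orbit \<sigma> x) = l}"
    then show "x \<in> \<Union>?C" using self by (auto simp: cycles_on_def)
  qed
  have "l * card ?C = card (\<Union>?C)"
  proof (rule card_partition)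
    show "finite ?C" by (simp add: cycles_on_def)
    show "finite (\<Union>?C)" unfolding U by simp
    fix c1 c2 assume c: "c1 \<in> ?C" "c2 \<in> ?C" "c1 \<noteq> c2"
    show "c1 \<inter> c2 = {}"
    proof (rule ccontr)
      assume "c1 \<inter> c2 \<noteq> {}"
      then obtain z where "z \<in> c1" "z \<in> c2" by blast
      moreover have "orbit \<sigma> z = c" if "c \<in> ?C" "z \<in> c" for c
      proof -
        from that(1) obtain x where "c = orbit \<sigma> x" by (auto simp: cycles_on_def)
        then show ?thesis using orbit_cyclic_eq3[OF cyclic_on_orbit[OF assms] that(2)[unfolded \<open>c = orbit \<sigma> x\<close>]] by simp
      qed
      ultimately show False using c by metis
    qed
  qed auto
  then show ?thesis by (simp add: num_cycles_def U)
qed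

lemma num_cycles_le: "num_cycles n l \<sigma> \<le> n"
proof -
  have "card {c \<in> cycles_on n \<sigma>. card c = l} \<le> card (cycles_on n \<sigma>)"
    by (intro card_mono) (auto simp: cycles_on_def)
  also have "\<dots> \<le> card {1..n}" unfolding cycles_on_def by (rule card_image_le) simp
  finally show ?thesis by (simp add: num_cycles_def)
qed

context coloured
begin

text \<open>An embedding is determined by the image of the marked vertex, which lies in an \<open>l\<close>-cycle.\<close>

lemma card_models_le:
  assumes "determined V C b" "w \<in> words k"
    and orb: "\<And>s \<phi>. model V C s \<phi> \<Longrightarrow> card (orbit (eval_word s w) (\<phi> b)) = l"
    and s: "\<And>i. i \<in> {1..k} \<Longrightarrow> s i permutes {1..n}"
  shows "card {\<phi> \<in> injections V {1..n}. \<forall>i\<in>{1..k}. realizes C i \<phi> (s i)} \<le> l * num_cycles n l (eval_word s w)"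
proof -
  have p: "eval_word s w permutes {1..n}" using s assms(2) by (rule eval_word_permutes)
  let ?M = "{\<phi> \<in> injections V {1..n}. \<forall>i\<in>{1..k}. realizes C i \<phi> (s i)}"
  have m: "model V C s \<phi>" if "\<phi> \<in> ?M" for \<phi>
  proof -
    have "permutation (s i)" if "i \<in> {1..k}" for i using s[OF that] by (rule permutes_imp_permutation[rotated]) simp
    then show ?thesis using that by (auto simp: model_def injections_def realizes_def)
  qed
  have bV: "b \<in> V" using assms(1) by (simp add: determined_def)
  have "card ?M \<le> card {x\<in>{1..n}. card (orbit (eval_word s w) x) = l}"
  proof (rule card_inj_on_le[where f = "\<lambda>\<phi>. \<phi> b"])
    show "inj_on (\<lambda>\<phi>. \<phi> b) ?M"
    proof (rule inj_onI)
      fix \<phi> \<phi>' assume a: "\<phi> \<in> ?M" "\<phi>' \<in> ?M" "\<phi> b = \<phi>' b"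
      have eq: "\<phi> v = \<phi>' v" if "v \<in> V" for v
        using assms(1) m[OF a(1)] m[OF a(2)] a(3) that by (auto simp: determined_def)
      have "\<phi> \<in> V \<rightarrow>\<^sub>E {1..n}" "\<phi>' \<in> V \<rightarrow>\<^sub>E {1..n}" using a by (auto simp: injections_def)
      then show "\<phi> = \<phi>'" using eq by (rule PiE_ext)
    qed
    show "(\<lambda>\<phi>. \<phi> b) ` ?M \<subseteq> {x\<in>{1..n}. card (orbit (eval_word s w) x) = l}"
    proof (rule image_subsetI)
      fix \<phi> assume a: "\<phi> \<in> ?M"
      then have "\<phi> b \<in> {1..n}" using bV by (auto simp: injections_def)
      then show "\<phi> b \<in> {x\<in>{1..n}. card (orbit (eval_word s w) x) = l}" using orb[OF m[OF a]] by simp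
    qed
  qed simp
  then show ?thesis using num_cycles_times[OF p, of l] by simp
qed

text \<open>By independence, the probability that a given injection is an embedding is the product over the
colours.\<close>

lemma expected_num_cycles_ge:
  fixes \<epsilon> :: real
  assumes "realizable l w" "w \<in> words k" "l \<ge> 1" "k \<ge> 1" and A: "colour_sets A" and e: "0 < \<epsilon>" "\<epsilon> < 1"
  shows "\<exists>n0. \<forall>n\<ge>n0. \<forall>(M :: 'a measure) s. n \<in> admissible k A \<longrightarrow> prob_space M \<longrightarrow>
    prob_space.indep_vars M (\<lambda>i. count_space (perms_with_cycles n (A i))) s {1..k} \<longrightarrow>
    (\<forall>i\<in>{1..k}. distr M (count_space (perms_with_cycles n (A i))) (s i) =
       uniform_count_measure (perms_with_cycles n (A i))) \<longrightarrow>
    (1 - \<epsilon>) / l \<le> (\<integral>x. real (num_cycles n l (eval_word (\<lambda>i. s i x) w)) \<partial>M)"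
proof -
  obtain V C b where G: "graph V C" "euler V C = 0" "determined V C b"
    "\<And>s \<phi>. model V C s \<phi> \<Longrightarrow> card (orbit (eval_word s w) (\<phi> b)) = l"
    using assms(1) unfolding realizable_def by blast
  have fV: "finite V" using G(1) by (simp add: graph_def)
  obtain n0 where n0: "\<And>n. n \<ge> n0 \<Longrightarrow> (\<forall>i\<in>{1..k}. cyc_perms {1..n} (A i) \<noteq> {}) \<Longrightarrow>
    1 - \<epsilon> \<le> (\<Sum>\<phi>\<in>injections V {1..n}. \<Prod>i\<in>{1..k}.
      real (card {\<sigma> \<in> cyc_perms {1..n} (A i). realizes C i \<phi> \<sigma>}) / card (cyc_perms {1..n} (A i)))"
    using expected_models_ge[OF G(1,2) A e] by blast
  show ?thesis
  proof (intro exI[of _ n0] allI impI)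
    fix n and M :: "'a measure" and s
    assume n: "n0 \<le> n" and adm: "n \<in> admissible k A" and pM: "prob_space M"
      and ind: "prob_space.indep_vars M (\<lambda>i. count_space (perms_with_cycles n (A i))) s {1..k}"
      and dis: "\<forall>i\<in>{1..k}. distr M (count_space (perms_with_cycles n (A i))) (s i) =
       uniform_count_measure (perms_with_cycles n (A i))"
    interpret prob_space M by fact
    define S where "S i = cyc_perms {1..n} (A i)" for i
    note S = S_def[folded perms_with_cycles_eq_cyc_perms, symmetric]
    have fS: "finite (S i)" for i by (simp add: S_def finite_cyc_perms)
    have rv: "s i \<in> measurable M (count_space (S i))" if "i \<in> {1..k}" for i
      using ind that unfolding indep_vars_def2 S by blast
    have sp: "s i x \<in> S i" if "i \<in> {1..k}" "x \<in> space M" for i x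
      using measurable_space[OF rv[OF that(1)] that(2)] by simp
    have perm: "s i x permutes {1..n}" if "i \<in> {1..k}" "x \<in> space M" for i x
      using sp[OF that] by (simp add: S_def cyc_perms_permutes)
    let ?B = "\<lambda>\<phi> i. {\<sigma> \<in> S i. realizes C i \<phi> \<sigma>}"
    define E where "E \<phi> = (\<Inter>i\<in>{1..k}. s i -` ?B \<phi> i \<inter> space M)" for \<phi>
    have meas: "s i -` ?B \<phi> i \<inter> space M \<in> events" if "i \<in> {1..k}" for i \<phi>
      using rv[OF that] by (rule measurable_sets) auto
    have Eev: "E \<phi> \<in> events" for \<phi>
      unfolding E_def using meas assms(4) by (intro sets.finite_INT) auto
    have prob1: "prob (s i -` ?B \<phi> i \<inter> space M) = real (card (?B \<phi> i)) / card (S i)" if i: "i \<in> {1..k}" for i \<phi>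
    proof -
      have "prob (s i -` ?B \<phi> i \<inter> space M) = measure (distr M (count_space (S i)) (s i)) (?B \<phi> i)"
        by (rule measure_distr[symmetric, OF rv[OF i]]) auto
      also have "\<dots> = measure (uniform_count_measure (S i)) (?B \<phi> i)" using dis i unfolding S by simp
      also have "\<dots> = real (card (?B \<phi> i)) / card (S i)"
        by (rule measure_uniform_count_measure[OF fS]) auto
      finally show ?thesis .
    qed
    have probE: "prob (E \<phi>) = (\<Prod>i\<in>{1..k}. real (card (?B \<phi> i)) / card (S i))" for \<phi>
    proof -
      have "prob (E \<phi>) = (\<Prod>i\<in>{1..k}. prob (s i -` ?B \<phi> i \<inter> space M))"
        unfolding E_def using ind[unfolded S] assms(4)
        by (intro indep_varsD_finite[where M' = "\<lambda>i. count_space (S i)"]) auto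
      then show ?thesis using prob1 by simp
    qed
    let ?N = "\<lambda>x. real (num_cycles n l (eval_word (\<lambda>i. s i x) w))"
    have Nmeas: "?N \<in> borel_measurable M"
    proof -
      have fin: "PiM {1..k} (\<lambda>i. count_space (S i)) = count_space (PiE {1..k} S)"
        by (rule count_space_PiM_finite) (auto simp: fS countable_finite)
      have "(\<lambda>x. \<lambda>i\<in>{1..k}. s i x) \<in> measurable M (PiM {1..k} (\<lambda>i. count_space (S i)))"
        using rv by (intro measurable_restrict) auto
      then have r: "(\<lambda>x. \<lambda>i\<in>{1..k}. s i x) \<in> measurable M (count_space (PiE {1..k} S))" unfolding fin .
      have "(\<lambda>t. real (num_cycles n l (eval_word t w))) \<in> borel_measurable (count_space (PiE {1..k} S))"
        by simp
      from measurable_compose[OF r this]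
      have "(\<lambda>x. real (num_cycles n l (eval_word (\<lambda>i\<in>{1..k}. s i x) w))) \<in> borel_measurable M" .
      moreover have "eval_word (\<lambda>i\<in>{1..k}. s i x) w = eval_word (\<lambda>i. s i x) w" for x
        using assms(2) by (intro eval_word_cong[where k = k]) auto
      ultimately show ?thesis by simp
    qed
    have Nint: "integrable M ?N"
      by (rule integrable_const_bound[of _ "real n"]) (use Nmeas num_cycles_le in auto)
    have low: "(\<Sum>\<phi>\<in>injections V {1..n}. indicator (E \<phi>) x) \<le> real l * ?N x" if x: "x \<in> space M" for x
    proof -
      have "(\<Sum>\<phi>\<in>injections V {1..n}. indicator (E \<phi>) x :: real) =
          card {\<phi> \<in> injections V {1..n}. x \<in> E \<phi>}"
        using finite_injections[OF fV, of "{1..n}"] by (simp add: indicator_def sum.If_cases Int_def)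
      also have "{\<phi> \<in> injections V {1..n}. x \<in> E \<phi>} =
          {\<phi> \<in> injections V {1..n}. \<forall>i\<in>{1..k}. realizes C i \<phi> (s i x)}"
        using sp x by (auto simp: E_def)
      also have "real (card \<dots>) \<le> real (l * num_cycles n l (eval_word (\<lambda>i. s i x) w))"
      proof (rule of_nat_mono, rule card_models_le[OF G(3) assms(2)])
        show "card (orbit (eval_word s w) (\<phi> b)) = l" if "model V C s \<phi>" for s \<phi> using that by (rule G(4))
        show "s i x permutes {1..n}" if "i \<in> {1..k}" for i using that x by (rule perm)
      qed
      finally show ?thesis by simp
    qed
    have "\<forall>i\<in>{1..k}. cyc_perms {1..n} (A i) \<noteq> {}"
      using adm by (simp add: admissible_def perms_with_cycles_eq_cyc_perms)
    then have "1 - \<epsilon> \<le> (\<Sum>\<phi>\<in>injections V {1..n}. prob (E \<phi>))"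
      using n0[OF n] unfolding probE S_def by blast
    also have "\<dots> = (\<integral>x. (\<Sum>\<phi>\<in>injections V {1..n}. indicator (E \<phi>) x) \<partial>M)"
      using Eev by (subst Bochner_Integration.integral_sum) (auto simp: measure_def[symmetric] emeasure_eq_measure)
    also have "\<dots> \<le> (\<integral>x. real l * ?N x \<partial>M)"
      using Eev Nint low by (intro integral_mono) (auto simp: emeasure_eq_measure intro!: Bochner_Integration.integrable_sum)
    also have "\<dots> = real l * (\<integral>x. ?N x \<partial>M)" by simp
    finally show "(1 - \<epsilon>) / l \<le> (\<integral>x. ?N x \<partial>M)" using assms(3) by (simp add: field_simps)
  qed
qed

end

section \<open>Uniqueness of one-syllable reductions\<close>

definition exponent_sum :: "nat \<Rightarrow> word \<Rightarrow> int" where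
  "exponent_sum i w = (\<Sum>x\<leftarrow>w. if fst x = i then if snd x then 1 else - 1 else 0)"

lemma exponent_sum_append [simp]: "exponent_sum i (u @ v) = exponent_sum i u + exponent_sum i v"
  by (simp add: exponent_sum_def)

lemma exponent_sum_gpow: "exponent_sum i (gpow j a) = (if j = i then a else 0)"
proof -
  have "exponent_sum i (replicate n (j, b)) = (if j = i then if b then int n else - int n else 0)" for n b
    by (induction n) (auto simp: exponent_sum_def)
  then show ?thesis by (auto simp: gpow_def)
qed

lemma exponent_sum_inv_word [simp]: "exponent_sum i (inv_word u) = - exponent_sum i u"
  by (induction u) (auto simp: exponent_sum_def inv_word_def inv_letter_def)

lemma exponent_sum_partial_cyc_reduction:
  assumes "partial_cyc_reduction k d w v" "d i = \<infinity>"
  shows "exponent_sum i w = exponent_sum i v"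
  using assms(1) unfolding partial_cyc_reduction_def
proof (induction rule: rtranclp_induct)
  case (step y z)
  from step(2) have "exponent_sum i y = exponent_sum i z"
  proof cases
    case (conj j m a u)
    then have "j \<noteq> i" using assms(2) by auto
    then show ?thesis using conj by (simp add: exponent_sum_gpow)
  next
    case (power j m a b v')
    then have "j \<noteq> i" using assms(2) by auto
    then show ?thesis using power by (simp add: exponent_sum_gpow)
  qed simp
  then show ?case using step by simp
qed simp

lemma eval_word_gpow_torsion:
  assumes "bij (s i)" "\<And>x. (s i ^^ m) x = x"
  shows "eval_word s (gpow i (a * int m)) x = x"
proof -
  have "(s i ^^ (n * m)) x = x" for n
    by (induction n) (simp_all add: funpow_add assms(2))
  then have *: "(s i ^^ nat \<bar>a * int m\<bar>) x = x" by (simp add: abs_mult nat_mult_distrib)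
  show ?thesis
    using * finv_funpow_fixed[OF assms(1) *] by (auto simp: eval_word_gpow abs_if split: if_splits)
qed

text \<open>If the torsion relations hold for the permutations, then all words of a cyclic reduction act by
conjugate permutations.\<close>

lemma fixed_point_partial_cyc_reduction:
  assumes red: "partial_cyc_reduction k d w v" and w: "w \<in> words k"
    and s: "\<And>i. i \<in> {1..k} \<Longrightarrow> s i permutes X"
    and tors: "\<And>i m x. i \<in> {1..k} \<Longrightarrow> d i = enat m \<Longrightarrow> (s i ^^ m) x = x"
    and fix_w: "x \<in> X" "eval_word s w x = x"
  shows "\<exists>y\<in>X. eval_word s v y = y"
proof -
  have "(\<exists>y\<in>X. eval_word s v y = y) \<and> v \<in> words k"
    using red unfolding partial_cyc_reduction_def
  proof (induction rule: rtranclp_induct)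
    case (step u v)
    then obtain y where y: "y \<in> X" "eval_word s u y = y" by blast
    have id: "eval_word s (p @ gpow i (a * int m) @ inv_word p @ q) = eval_word s q"
      if "i \<in> {1..k}" "d i = enat m" "p \<in> words k" for i m a p q
    proof
      fix z
      have "eval_word s (gpow i (a * int m)) z' = z'" for z'
        using tors[OF that(1,2)] permutes_bij[OF s[OF that(1)]] by (intro eval_word_gpow_torsion) auto
      then show "eval_word s (p @ gpow i (a * int m) @ inv_word p @ q) z = eval_word s q z"
        using eval_word_inv_word[of k s p] permutes_bij[OF s] that(3) by (simp add: eval_word_append)
    qed
    from step(2) show ?case
    proof cases
      case (rotate p q)
      have "eval_word s q permutes X" using rotate by (intro eval_word_permutes[where k = k] s) auto
      then have "eval_word s q y \<in> X" using permutes_in_image y(1) by metis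
      moreover have "eval_word s v (eval_word s q y) = eval_word s q y"
        using y(2) rotate by (simp add: eval_word_append)
      ultimately show ?thesis using rotate by auto
    next
      case (conj i m a p)
      then show ?thesis using y id by auto
    next
      case (power i m a b v')
      then have "eval_word s u = eval_word s v" using id[of i m "[]" a v] by simp
      then show ?thesis using y power gpow_in_words by auto
    qed
  qed (use w fix_w in auto)
  then show ?thesis ..
qed

lemma num_cyc_perms_pos_add:
  assumes "j \<ge> 1" "j \<in> A" "num_cyc_perms A n > 0"
  shows "num_cyc_perms A (n + j) > 0"
proof -
  have "cyc_density A n \<le> (n + j) * cyc_density A (n + j)"
    using cyc_density_diff_le[OF assms(1,2), of "n + j"] by simp
  moreover have "cyc_density A n > 0" using assms(3) by (simp add: cyc_density_pos_iff)
  ultimately have "cyc_density A (n + j) \<noteq> 0" by auto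
  then show ?thesis using cyc_density_nonneg[of A "n + j"] by (simp add: flip: cyc_density_pos_iff)
qed

lemma num_cyc_perms_pos_multiple:
  assumes "m \<ge> 1" "m \<in> A"
  shows "num_cyc_perms A (t * m) > 0"
proof (induction t)
  case (Suc t)
  then show ?case using num_cyc_perms_pos_add[OF assms, of "t * m"] by (simp add: add.commute)
qed (simp add: num_cyc_perms_0)

lemma cyc_perms_nonempty: "num_cyc_perms A n > 0 \<Longrightarrow> cyc_perms {1..n} A \<noteq> {}"
  by (auto simp: num_cyc_perms_def)

lemma orbit_card_1: "permutation f \<Longrightarrow> card (orbit f x) = 1 \<Longrightarrow> f x = x"
  using permutation_self_in_orbit[of f x] orbit_eq_singleton_iff[of f x] by (auto simp: card_1_singleton_iff)

text \<open>The lower bound for the expectation is applied to an auxiliary choice of cycle lengths, for which \<open>w\<close>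
acts like a conjugate of the \<open>a\<close>-th power of \<open>s i\<close>. It yields permutations for which \<open>w\<close> has a fixed point,
although all cycles of \<open>s i\<close> are longer than \<open>|a|\<close>.\<close>

lemma (in coloured) realizable_not_conj_gpow:
  assumes real: "realizable 1 w" and w: "w \<in> words k" and Z: "\<And>i. i \<in> {1..k} \<Longrightarrow> Z i = []"
    and i: "i \<in> {1..k}" "d i = \<infinity>" and a: "a \<noteq> 0"
  shows "\<not> partial_cyc_reduction k d w (gpow i a)"
proof
  assume red: "partial_cyc_reduction k d w (gpow i a)"
  define m where "m j = the_enat (d j)" for j
  \<comment> \<open>Cycle lengths for which the relators act trivially and \<open>s i\<close> has no cycle of length at most \<open>|a|\<close>.\<close>
  define A where "A j = (if d j = \<infinity> then {nat \<bar>a\<bar> + 1..} else {m j})" for j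
  have dm: "d j = enat (m j)" if "d j \<noteq> \<infinity>" for j using that by (auto simp: m_def)
  have m1: "m j \<ge> 1" if "j \<in> {1..k}" "d j \<noteq> \<infinity>" for j
    using d_ge_2[OF that(1)] dm[OF that(2)] by (metis enat_ord_simps(1) numeral_eq_enat one_le_numeral order_trans)
  have sup: "(SUP j\<in>{c..}. enat j) = \<infinity>" for c
  proof (rule ccontr)
    assume "(SUP j\<in>{c..}. enat j) \<noteq> \<infinity>"
    then obtain b where b: "(SUP j\<in>{c..}. enat j) = enat b" by auto
    have "enat (max c (Suc b)) \<le> (SUP j\<in>{c..}. enat j)" by (rule SUP_upper) simp
    then show False unfolding b by simp
  qed
  have A: "colour_sets A"
    unfolding colour_sets_def using Z m1 dm sup by (auto simp: A_def)
  obtain V C b where G: "graph V C" "euler V C = 0" "determined V C b"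
    "\<And>s \<phi>. model V C s \<phi> \<Longrightarrow> card (orbit (eval_word s w) (\<phi> b)) = 1"
    using real unfolding realizable_def by blast
  have "\<exists>n0. \<forall>n\<ge>n0. (\<forall>i\<in>{1..k}. cyc_perms {1..n} (A i) \<noteq> {}) \<longrightarrow>
    1 - 1 / 2 \<le> (\<Sum>\<phi>\<in>injections V {1..n}. \<Prod>i\<in>{1..k}.
      real (card {\<sigma> \<in> cyc_perms {1..n} (A i). realizes C i \<phi> \<sigma>}) / card (cyc_perms {1..n} (A i)))"
    by (rule expected_models_ge[OF G(1,2) A]) auto
  then obtain n0 where n0: "\<And>n. n \<ge> n0 \<Longrightarrow> (\<forall>i\<in>{1..k}. cyc_perms {1..n} (A i) \<noteq> {}) \<Longrightarrow>
    1 - 1 / 2 \<le> (\<Sum>\<phi>\<in>injections V {1..n}. \<Prod>i\<in>{1..k}.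
      real (card {\<sigma> \<in> cyc_perms {1..n} (A i). realizes C i \<phi> \<sigma>}) / card (cyc_perms {1..n} (A i)))"
    by blast
  define J where "J = {j\<in>{1..k}. d j \<noteq> \<infinity>}"
  \<comment> \<open>Permutations of \<open>n\<close> points with these cycle lengths exist if \<open>n\<close> is a multiple of all finite \<open>d j\<close>
    and exceeds \<open>|a|\<close>.\<close>
  define n where "n = (n0 + nat \<bar>a\<bar> + 1) * prod m J"
  have fJ: "finite J" by (simp add: J_def)
  have "prod m J \<ge> 1" using m1 by (intro prod_ge_1) (auto simp: J_def)
  then have "(n0 + nat \<bar>a\<bar> + 1) * 1 \<le> n" unfolding n_def by (rule mult_le_mono2)
  then have n: "n \<ge> n0" "n \<ge> nat \<bar>a\<bar> + 1" by auto
  have ne: "cyc_perms {1..n} (A j) \<noteq> {}" if j: "j \<in> {1..k}" for j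
  proof (rule cyc_perms_nonempty)
    show "num_cyc_perms (A j) n > 0"
    proof (cases "d j = \<infinity>")
      case True
      then show ?thesis using num_cyc_perms_pos_multiple[of n "A j" 1] n by (simp add: A_def)
    next
      case False
      then have "m j dvd n" using j fJ unfolding n_def by (intro dvd_mult dvd_prodI) (auto simp: J_def)
      then obtain t where "n = t * m j" by (metis dvdE mult.commute)
      have Aj: "A j = {m j}" unfolding A_def using False by (simp only: if_False)
      show ?thesis
        unfolding Aj \<open>n = t * m j\<close> using m1[OF j False] by (intro num_cyc_perms_pos_multiple) auto
    qed
  qed
  have "(\<Sum>\<phi>\<in>injections V {1..n}. \<Prod>i\<in>{1..k}.
      real (card {\<sigma> \<in> cyc_perms {1..n} (A i). realizes C i \<phi> \<sigma>}) / card (cyc_perms {1..n} (A i))) \<noteq> 0"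
    using n0[OF n(1)] ne by fastforce
  then obtain \<phi> where \<phi>: "\<phi> \<in> injections V {1..n}"
    "(\<Prod>i\<in>{1..k}. real (card {\<sigma> \<in> cyc_perms {1..n} (A i). realizes C i \<phi> \<sigma>}) / card (cyc_perms {1..n} (A i))) \<noteq> 0"
    by (meson sum.neutral)
  have "\<forall>j\<in>{1..k}. \<exists>\<sigma>. \<sigma> \<in> cyc_perms {1..n} (A j) \<and> realizes C j \<phi> \<sigma>"
  proof
    fix j assume "j \<in> {1..k}"
    then have "card {\<sigma> \<in> cyc_perms {1..n} (A j). realizes C j \<phi> \<sigma>} \<noteq> 0" using \<phi>(2) by auto
    then show "\<exists>\<sigma>. \<sigma> \<in> cyc_perms {1..n} (A j) \<and> realizes C j \<phi> \<sigma>" by (metis (mono_tags, lifting) card.empty empty_Collect_eq)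
  qed
  from bchoice[OF this] obtain s where s: "\<And>j. j \<in> {1..k} \<Longrightarrow> s j \<in> cyc_perms {1..n} (A j) \<and> realizes C j \<phi> (s j)"
    by blast
  have p: "s j permutes {1..n}" if "j \<in> {1..k}" for j using s[OF that] cyc_perms_permutes by blast
  have perm: "permutation (s j)" if "j \<in> {1..k}" for j
    using p[OF that] by (rule permutes_imp_permutation[rotated]) simp
  have "inj_on \<phi> V" using \<phi>(1) by (simp add: injections_def)
  moreover have "(\<forall>xs\<in>C j. comp_walk (d j) (s j) (map \<phi> xs)) \<and> closed_walk (s j) (map \<phi> (Z j))"
    if "j \<in> {1..k}" for j using s[OF that] unfolding realizes_def by blast
  ultimately have "model V C s \<phi>" using perm by (simp add: model_def)
  then have c1: "card (orbit (eval_word s w) (\<phi> b)) = 1" by (rule G(4))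
  have "permutation (eval_word s w)" using perm w by (rule permutation_eval_word)
  from orbit_card_1[OF this c1] have fixed: "eval_word s w (\<phi> b) = \<phi> b" .
  have "\<phi> b \<in> {1..n}" using \<phi>(1) G(3) by (auto simp: injections_def determined_def)
  moreover have "(s j ^^ mm) x = x" if "j \<in> {1..k}" "d j = enat mm" for j mm x
  proof (cases "x \<in> {1..n}")
    case True
    then have "card (orbit (s j) x) = mm" using s[OF that(1)] that(2) by (auto simp: cyc_perms_def A_def m_def)
    then show ?thesis using orbit_period(1)[OF p[OF that(1)], of x] by simp
  next
    case False
    have "(s j ^^ q) x = x" for q by (induction q) (simp_all add: permutes_not_in[OF p[OF that(1)] False])
    then show ?thesis .
  qed
  ultimately obtain y where y: "y \<in> {1..n}" "eval_word s (gpow i a) y = y"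
    using fixed_point_partial_cyc_reduction[OF red w p _ _ fixed] by blast
  have bij: "bij (s i)" using perm[OF i(1)] by (rule permutation_bijective)
  have "(s i ^^ nat \<bar>a\<bar>) y = y"
  proof (cases "0 \<le> a")
    case True
    then show ?thesis using y(2) by (simp add: eval_word_gpow)
  next
    case False
    then have "(finv (s i) ^^ nat \<bar>a\<bar>) y = y" using y(2) by (simp add: eval_word_gpow)
    from finv_funpow_fixed[OF bij_imp_bij_inv[OF bij] this] show ?thesis by (simp add: inv_inv_eq[OF bij])
  qed
  moreover have "nat \<bar>a\<bar> < card (orbit (s i) y)"
    using s[OF i(1)] y(1) i(2) by (auto simp: cyc_perms_def A_def Suc_le_eq)
  ultimately have "nat \<bar>a\<bar> = 0"
    using inj_onD[OF orbit_period(2)[OF p[OF i(1)], of y], of "nat \<bar>a\<bar>" 0] by simp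
  then show False using a by simp
qed

section \<open>The limit theorem\<close>

lemma Liminf_ge_inverse:
  fixes f :: "nat \<Rightarrow> real"
  assumes "l \<ge> (1 :: nat)" "F = inf sequentially (principal S)"
    and "\<And>\<epsilon> :: real. 0 < \<epsilon> \<Longrightarrow> \<epsilon> < 1 \<Longrightarrow> \<exists>n0. \<forall>n\<ge>n0. n \<in> S \<longrightarrow> (1 - \<epsilon>) / l \<le> f n"
  shows "Liminf F (\<lambda>n. ereal (f n)) \<ge> ereal (1 / real l)"
proof (subst le_Liminf_iff, intro allI impI)
  fix y assume "y < ereal (1 / real l)"
  then obtain r where r: "y < ereal r" "r < 1 / real l" using ereal_dense2 by (metis less_ereal.simps(1))
  \<comment> \<open>A positive bound between \<open>y\<close> and \<open>1/l\<close>, so that \<open>\<epsilon> = 1 - r' l\<close> is less than \<open>1\<close>.\<close>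
  define r' where "r' = max r (1 / (2 * real l))"
  have l0: "real l > 0" using assms(1) by simp
  have half: "0 < 1 / (2 * real l)" "1 / (2 * real l) < 1 / real l" using l0 by (simp_all add: field_simps)
  have "ereal r \<le> ereal r'" by (simp add: r'_def)
  then have r': "y < ereal r'" "r' < 1 / real l" "0 < r'"
    using r half by (auto simp: r'_def intro: less_le_trans)
  have "0 < 1 - r' * l" "1 - r' * l < 1" using r' assms(1) by (auto simp: field_simps)
  then obtain n0 where n0: "\<And>n. n \<ge> n0 \<Longrightarrow> n \<in> S \<Longrightarrow> (1 - (1 - r' * l)) / l \<le> f n"
    using assms(3) by blast
  have "y < ereal (f n)" if "n \<ge> n0" "n \<in> S" for n
  proof -
    have "r' \<le> f n" using n0[OF that] assms(1) by simp
    then show ?thesis using r'(1) by (meson ereal_less_eq(3) less_le_trans)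
  qed
  then show "\<forall>\<^sub>F n in F. y < ereal (f n)"
    unfolding assms(2) eventually_inf_principal eventually_sequentially by blast
qed

theorem theorem3p4:
  fixes k :: nat
    and A :: "nat \<Rightarrow> nat set"
    and d :: "nat \<Rightarrow> enat"
    and M :: "nat \<Rightarrow> 'a measure"
    and s :: "nat \<Rightarrow> nat \<Rightarrow> 'a \<Rightarrow> nat \<Rightarrow> nat"
    and w :: word
    and \<sigma> :: "nat \<Rightarrow> 'a \<Rightarrow> nat \<Rightarrow> nat"
    and F :: "nat filter"
  assumes "k \<ge> 1"
    and "\<And>i. i \<in> {1..k} \<Longrightarrow> A i \<noteq> {} \<and> A i \<subseteq> {1..} \<and> A i \<noteq> {1}"
    and "\<And>i. i \<in> {1..k} \<Longrightarrow> finite (A i) \<or> (\<lambda>j. 1 / real j) summable_on ({1..} - A i)"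
    and "\<And>i. d i = (SUP j\<in>A i. enat j)"
    and "F = inf sequentially (principal (admissible k A))"
    and "\<And>n. n \<in> admissible k A \<Longrightarrow> prob_space (M n)"
    and "\<And>n. n \<in> admissible k A \<Longrightarrow>
           prob_space.indep_vars (M n) (\<lambda>i. count_space (perms_with_cycles n (A i))) (s n) {1..k}"
    and "\<And>n i. n \<in> admissible k A \<Longrightarrow> i \<in> {1..k} \<Longrightarrow>
           distr (M n) (count_space (perms_with_cycles n (A i))) (s n i) =
           uniform_count_measure (perms_with_cycles n (A i))"
    and "w \<in> words k"
    and "cyclically_reduced w"
    and "infinite_order k d w"
    and "\<And>n x. \<sigma> n x = eval_word (\<lambda>i. s n i x) w"
  shows "((\<forall>i\<in>{1..k}. \<forall>a. gpow i a \<notin> cyc_reductions k d w) \<or>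
          (\<exists>i\<in>{1..k}. infinite (A i) \<and> (\<exists>a. a \<noteq> 0 \<and> cyc_reductions k d w = {gpow i a}))) \<and>
         ((\<forall>i\<in>{1..k}. \<forall>a. gpow i a \<notin> cyc_reductions k d w) \<longrightarrow>
            (\<forall>l\<ge>1. Liminf F (\<lambda>n. ereal (\<integral>x. real (num_cycles n l (\<sigma> n x)) \<partial>M n))
                      \<ge> ereal (1 / real l))) \<and>
         (\<forall>i\<in>{1..k}. \<forall>a. infinite (A i) \<and> a \<noteq> 0 \<and> cyc_reductions k d w = {gpow i a} \<longrightarrow>
            (\<forall>l\<ge>1. l * nat \<bar>a\<bar> \<in> A i \<longrightarrow>
                      Liminf F (\<lambda>n. ereal (\<integral>x. real (num_cycles n l (\<sigma> n x)) \<partial>M n))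
                        \<ge> ereal (1 / real l)))"
proof -
  have d2: "2 \<le> d i" if i: "i \<in> {1..k}" for i
  proof -
    have Ai: "A i \<noteq> {}" "A i \<subseteq> {1..}" "A i \<noteq> {1}" using assms(2)[OF i] by auto
    then have "\<exists>j\<in>A i. j \<noteq> 1" by auto
    then obtain j where j: "j \<in> A i" "j \<noteq> 1" by blast
    then have "2 \<le> j" using Ai(2) by force
    then have "2 \<le> enat j" by (simp add: numeral_eq_enat)
    also have "\<dots> \<le> d i" unfolding assms(4) using j(1) by (rule SUP_upper)
    finally show ?thesis .
  qed
  have fin_d: "finite (A i) \<longleftrightarrow> d i \<noteq> \<infinity>" if i: "i \<in> {1..k}" for i
  proof
    assume "finite (A i)"
    then have "d i \<le> enat (Max (A i))" unfolding assms(4) by (intro SUP_least) simp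
    then show "d i \<noteq> \<infinity>" by (cases "d i = \<infinity>") simp_all
  next
    assume "d i \<noteq> \<infinity>"
    then obtain m where m: "d i = enat m" by auto
    have "j \<le> m" if "j \<in> A i" for j
    proof -
      have "enat j \<le> d i" unfolding assms(4) using that by (rule SUP_upper)
      then show ?thesis using m by simp
    qed
    then show "finite (A i)" by (meson finite_nat_set_iff_bounded_le)
  qed
  interpret R: coloured k d "\<lambda>_. []" by unfold_locales (auto simp: d2)
  have syl: "(\<exists>i\<in>{1..k}. \<exists>a. v = gpow i a) \<or>
      (\<exists>ss. v = syllable_word ss \<and> 2 \<le> length ss \<and> R.valid_syllables ss \<and> fst (last ss) \<noteq> fst (hd ss))"
    if v: "d_cyclically_reduced k d v" for v
  proof -
    obtain ss where ss: "v = syllable_word ss" "\<forall>(i, a)\<in>set ss. i \<in> {1..k} \<and> 0 < \<bar>a\<bar> \<and> enat (nat \<bar>a\<bar>) < d i"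
      "successively (\<lambda>p q. fst p \<noteq> fst q) ss" "2 \<le> length ss \<longrightarrow> fst (last ss) \<noteq> fst (hd ss)"
      using v unfolding d_cyclically_reduced_def syllable_word_def by blast
    consider "ss = []" | i a where "ss = [(i, a)]" | "2 \<le> length ss"
    proof (cases ss)
      case (Cons p ss')
      then show ?thesis using that(2)[of "fst p" "snd p"] that(3) by (cases ss') auto
    qed (use that in blast)
    then show ?thesis
    proof cases
      case 1
      \<comment> \<open>The empty word counts as a zeroth power of the first generator.\<close>
      then have "v = gpow 1 0" using ss(1) by simp
      then show ?thesis using assms(1) by (metis atLeastAtMost_iff order_refl)
    next
      case (2 i a)
      then show ?thesis using ss by auto
    next
      case 3
      then show ?thesis using ss by (auto simp: R.valid_syllables_def)
    qed
  qed
  have realw: "R.realizable l w"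
    if "v \<in> cyc_reductions k d w" "v = syllable_word ss" "2 \<le> length ss" "R.valid_syllables ss"
      "fst (last ss) \<noteq> fst (hd ss)" "l \<ge> 1" for v ss l
    using R.realizable_partial_cyc_reduction[of w v l] R.realizable_syllables[OF that(3,4,5) _ that(6)] that(1,2)
    by (simp add: cyc_reductions_def)
  have dicho: "infinite (A i) \<and> a \<noteq> 0 \<and> cyc_reductions k d w = {gpow i a}"
    if i: "i \<in> {1..k}" and g: "gpow i a \<in> cyc_reductions k d w" for i a
  proof -
    have red: "partial_cyc_reduction k d w (gpow i a)" using g by (simp add: cyc_reductions_def)
    have io: "infinite_order k d (gpow i a)"
      using infinite_order_partial_cyc_reduction[OF red assms(11)] .
    have a: "a \<noteq> 0" using io not_infinite_order_Nil by (metis gpow_0)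
    have inf: "d i = \<infinity>"
    proof (cases "d i")
      case (enat m)
      then have "m \<noteq> 0" using d2[OF i] by (metis enat_0 le_zero_eq zero_neq_numeral)
      then show ?thesis using not_infinite_order_gpow[where d = d, OF i enat] io by simp
    qed
    have "v = gpow i a" if v: "v \<in> cyc_reductions k d w" for v
    proof -
      have redv: "partial_cyc_reduction k d w v" "d_cyclically_reduced k d v" using v by (auto simp: cyc_reductions_def)
      from syl[OF redv(2)] show ?thesis
      proof (elim disjE bexE exE conjE)
        fix j b assume "v = gpow j b"
        moreover have "exponent_sum i (gpow i a) = exponent_sum i v"
          using exponent_sum_partial_cyc_reduction[where d = d, OF red inf]
            exponent_sum_partial_cyc_reduction[where d = d, OF redv(1) inf] by simp
        ultimately show ?thesis using a by (auto simp: exponent_sum_gpow split: if_splits)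
      next
        fix ss assume "v = syllable_word ss" "2 \<le> length ss" "R.valid_syllables ss" "fst (last ss) \<noteq> fst (hd ss)"
        then have "R.realizable 1 w" using realw[OF v] by simp
        then show ?thesis
          using R.realizable_not_conj_gpow[OF _ assms(9) _ i inf a] red by simp
      qed
    qed
    then have "cyc_reductions k d w = {gpow i a}" using g by blast
    then show ?thesis using a inf fin_d[OF i] by blast
  qed
  have lim: "Liminf F (\<lambda>n. ereal (\<integral>x. real (num_cycles n l (\<sigma> n x)) \<partial>M n)) \<ge> ereal (1 / real l)"
    if h: "coloured k d Z" "coloured.realizable k d Z l w" "coloured.colour_sets k d Z A" "l \<ge> 1" for Z l
  proof (rule Liminf_ge_inverse[OF h(4) assms(5)])
    fix \<epsilon> :: real assume e: "0 < \<epsilon>" "\<epsilon> < 1"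
    obtain n0 where n0: "\<forall>n\<ge>n0. \<forall>(M :: 'a measure) s. n \<in> admissible k A \<longrightarrow> prob_space M \<longrightarrow>
      prob_space.indep_vars M (\<lambda>i. count_space (perms_with_cycles n (A i))) s {1..k} \<longrightarrow>
      (\<forall>i\<in>{1..k}. distr M (count_space (perms_with_cycles n (A i))) (s i) =
         uniform_count_measure (perms_with_cycles n (A i))) \<longrightarrow>
      (1 - \<epsilon>) / l \<le> (\<integral>x. real (num_cycles n l (eval_word (\<lambda>i. s i x) w)) \<partial>M)"
      using coloured.expected_num_cycles_ge[OF h(1,2) assms(9) h(4) assms(1) h(3) e, where ?'a = 'a] ..
    show "\<exists>n0. \<forall>n\<ge>n0. n \<in> admissible k A \<longrightarrow> (1 - \<epsilon>) / l \<le> (\<integral>x. real (num_cycles n l (\<sigma> n x)) \<partial>M n)"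
    proof (intro exI[of _ n0] allI impI)
      fix n assume n: "n0 \<le> n" "n \<in> admissible k A"
      have "\<forall>i\<in>{1..k}. distr (M n) (count_space (perms_with_cycles n (A i))) (s n i) =
          uniform_count_measure (perms_with_cycles n (A i))"
        using assms(8)[OF n(2)] by (rule ballI)
      with n0[rule_format, OF n assms(6)[OF n(2)] assms(7)[OF n(2)]]
      show "(1 - \<epsilon>) / l \<le> (\<integral>x. real (num_cycles n l (\<sigma> n x)) \<partial>M n)"
        unfolding assms(12) by simp
    qed
  qed
  show ?thesis
  proof (intro conjI)
    show "(\<forall>i\<in>{1..k}. \<forall>a. gpow i a \<notin> cyc_reductions k d w) \<or>
        (\<exists>i\<in>{1..k}. infinite (A i) \<and> (\<exists>a. a \<noteq> 0 \<and> cyc_reductions k d w = {gpow i a}))"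
      using dicho by blast
    show "(\<forall>i\<in>{1..k}. \<forall>a. gpow i a \<notin> cyc_reductions k d w) \<longrightarrow>
        (\<forall>l\<ge>1. Liminf F (\<lambda>n. ereal (\<integral>x. real (num_cycles n l (\<sigma> n x)) \<partial>M n)) \<ge> ereal (1 / real l))"
    proof (intro impI allI)
      fix l :: nat assume none: "\<forall>i\<in>{1..k}. \<forall>a. gpow i a \<notin> cyc_reductions k d w" and l: "1 \<le> l"
      have "d i \<noteq> 0" if "i \<in> {1..k}" for i using d2[OF that] by auto
      then obtain v where v: "v \<in> cyc_reductions k d w"
        using cyc_reduction_exists[OF _ assms(9,10)] by blast
      then obtain ss where "v = syllable_word ss" "2 \<le> length ss" "R.valid_syllables ss" "fst (last ss) \<noteq> fst (hd ss)"
        using syl[of v] none by (auto simp: cyc_reductions_def)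
      then have "R.realizable l w" using realw v l by blast
      moreover have "R.colour_sets A" using assms(2,4) by (simp add: R.colour_sets_def)
      ultimately show "Liminf F (\<lambda>n. ereal (\<integral>x. real (num_cycles n l (\<sigma> n x)) \<partial>M n)) \<ge> ereal (1 / real l)"
        by (rule lim[OF R.coloured_axioms _ _ l])
    qed
    show "\<forall>i\<in>{1..k}. \<forall>a. infinite (A i) \<and> a \<noteq> 0 \<and> cyc_reductions k d w = {gpow i a} \<longrightarrow>
        (\<forall>l\<ge>1. l * nat \<bar>a\<bar> \<in> A i \<longrightarrow>
          Liminf F (\<lambda>n. ereal (\<integral>x. real (num_cycles n l (\<sigma> n x)) \<partial>M n)) \<ge> ereal (1 / real l))"
    proof (intro ballI allI impI)
      fix i a and l :: nat
      assume i: "i \<in> {1..k}" and g: "infinite (A i) \<and> a \<noteq> 0 \<and> cyc_reductions k d w = {gpow i a}"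
        and l: "1 \<le> l" "l * nat \<bar>a\<bar> \<in> A i"
      \<comment> \<open>The distinguished cycle of colour \<open>i\<close> carries the loop.\<close>
      define Z where "Z j = (if j = i then [0..<l * nat \<bar>a\<bar>] else [])" for j
      have inf: "d i = \<infinity>" using fin_d[OF i] g by simp
      interpret T: coloured k d Z
        by unfold_locales (auto simp: d2 Z_def inf split: if_splits)
      have "T.realizable l (gpow i a)"
        using g l i by (intro T.realizable_gpow) (auto simp: Z_def)
      moreover have "partial_cyc_reduction k d w (gpow i a)" using g by (auto simp: cyc_reductions_def)
      ultimately have "T.realizable l w" by (rule T.realizable_partial_cyc_reduction[rotated])
      moreover have "\<exists>L>0. cyc_density (A i) \<longlonglongrightarrow> L"
        using assms(3)[OF i] g by (intro cyc_density_tendsto) simp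
      then have "T.colour_sets A" using assms(2,4) l by (auto simp: T.colour_sets_def Z_def split: if_splits)
      ultimately show "Liminf F (\<lambda>n. ereal (\<integral>x. real (num_cycles n l (\<sigma> n x)) \<partial>M n)) \<ge> ereal (1 / real l)"
        by (rule lim[OF T.coloured_axioms _ _ l(1)])
    qed
  qed
qed

end
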